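(* Suppose $\{\gamma_k\}_{k=0}^\infty$ is a non-trivial Laguerre multiplier sequence and let $\{g_k^*(x)\}_{k=0}^\infty$ be the reversed Jensen polynomials associated with $\{\gamma_k\}_{k=0}^\infty$. Then, for each $n\in\mathbb{N}_0$, the sequence $$\{b_{n,m}\}_{m=0}^\infty:=\left\{\sum_{k=0}^m \binom{m}{k} \frac{(-1)^n}{n!} \left(\sum_{j=0}^n \binom{n}{j} \frac{(k+j)!}{((k+j)-n)!}\,g_{k+j}^*(-1)\right)\right\}_{m=0}^\infty$$ is a Laguerre multiplier sequence.
   Context: $\mathbb{N}_0=\{0,1,2,\ldots\}$. The Laguerre polynomials are $L_n(x)=\sum_{k=0}^n\frac{(-1)^k}{k!}\binom{n}{k}x^k$, $n\in\mathbb{N}_0$. A linear operator $T:\mathbb{R}[x]\to\mathbb{R}[x]$ is hyperbolicity preserving if $T[p(x)]$ has only real zeros whenever $p(x)\in\mathbb{R}[x]$ has only real zeros (the zero polynomial is regarded as having only real zeros). A sequence of real numbers $\{\gamma_n\}_{n=0}^\infty$ is a Laguerre multiplier sequence if the linear operator defined by $T[L_n(x)]=\gamma_nL_n(x)$ for all $n\in\mathbb{N}_0$ is hyperbolicity preserving. It is trivial if it is of the form $\{0,0,\ldots,0,\alpha,\beta,0,0,\ldots\}$ with $\alpha,\beta\in\mathbb{R}$ (all terms zero except possibly two consecutive ones), and non-trivial otherwise. The reversed Jensen polynomials associated with $\{\gamma_k\}_{k=0}^\infty$ are $g_n^*(x):=\sum_{k=0}^n\binom{n}{k}\gamma_kx^{n-k}$,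 $n\in\mathbb{N}_0$. The quotient $\frac{(k+j)!}{((k+j)-n)!}$ is the falling factorial $(k+j)(k+j-1)\cdots(k+j-n+1)$; in particular it is $0$ when $k+j<n$. *)

theory Defs
  imports Complex_Main "HOL-Computational_Algebra.Polynomial"
begin

definition laguerre_poly :: "nat \<Rightarrow> real poly" where
  "laguerre_poly n = (\<Sum>k=0..n. monom ((-1) ^ k / fact k * real (n choose k)) k)"

definition only_real_zeros :: "real poly \<Rightarrow> bool" where
  "only_real_zeros p \<longleftrightarrow>
     p = 0 \<or> (\<forall>z::complex. poly (map_poly complex_of_real p) z = 0 \<longrightarrow> z \<in> \<real>)"

definition hyperbolicity_preserving :: "(real poly \<Rightarrow> real poly) \<Rightarrow> bool" where
  "hyperbolicity_preserving T \<longleftrightarrow>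
     Vector_Spaces.linear smult smult T \<and>
     (\<forall>p. only_real_zeros p \<longrightarrow> only_real_zeros (T p))"

text \<open>
  The locale predicate \<^const>\<open>Vector_Spaces.linear\<close> includes the vector space axioms for both
  scalar multiplications; they hold here, so it imposes nothing beyond linearity.
\<close>

lemma vector_space_smult: "vector_space (smult :: real \<Rightarrow> real poly \<Rightarrow> real poly)"
  by unfold_locales (simp_all add: smult_add_left smult_add_right)

lemma linear_smult_iff:
  "Vector_Spaces.linear smult smult (T :: real poly \<Rightarrow> real poly) \<longleftrightarrow>
     (\<forall>p q. T (p + q) = T p + T q) \<and> (\<forall>c p. T (smult c p) = smult c (T p))"
  by (auto simp: Vector_Spaces.linear_iff vector_space_smult)

text \<open>
  The polynomials \<^term>\<open>laguerre_poly n\<close> form a basis of the space of real polynomials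
  (\<^term>\<open>laguerre_poly n\<close> has degree \<open>n\<close>), so there is exactly one
  linear operator with the values prescribed below, and the existential quantifier merely names it.
\<close>

definition laguerre_multiplier_sequence :: "(nat \<Rightarrow> real) \<Rightarrow> bool" where
  "laguerre_multiplier_sequence \<gamma> \<longleftrightarrow>
     (\<exists>T. hyperbolicity_preserving T \<and>
          (\<forall>n. T (laguerre_poly n) = smult (\<gamma> n) (laguerre_poly n)))"

definition trivial_sequence :: "(nat \<Rightarrow> real) \<Rightarrow> bool" where
  "trivial_sequence \<gamma> \<longleftrightarrow>
     (\<exists>N \<alpha> \<beta>. \<gamma> = (\<lambda>k. if k = N then \<alpha> else if k = Suc N then \<beta> else 0))"

definition reversed_jensen_poly :: "(nat \<Rightarrow> real) \<Rightarrow> nat \<Rightarrow> real poly" where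
  "reversed_jensen_poly \<gamma> n = (\<Sum>k=0..n. monom (real (n choose k) * \<gamma> k) (n - k))"

text \<open>\<open>N (N - 1) \<cdots> (N - n + 1)\<close>, which equals \<open>N! / (N - n)!\<close> for \<open>n \<le> N\<close> and \<open>0\<close> for \<open>N < n\<close>.\<close>

definition falling_factorial :: "nat \<Rightarrow> nat \<Rightarrow> real" where
  "falling_factorial N n = (\<Prod>i<n. real N - real i)"

end

theory Submission
  imports Defs "HOL-Computational_Algebra.Fundamental_Theorem_Algebra"
begin

text \<open>
  Write \<open>a k\<close> for the \<open>k\<close>-th forward difference of \<open>\<gamma>\<close> at \<open>0\<close>; it is the value of the
  \<open>k\<close>-th reversed Jensen polynomial at \<open>-1\<close>, and \<open>\<gamma> m = (\<Sum>k\<le>m. (m choose k) a k)\<close>. So \<open>\<gamma>\<close> is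
  encoded by the power series \<open>A(y) = (\<Sum>k. a k y^k)\<close>, and the sequence \<open>b n\<close> of the theorem is encoded
  in the same way by \<open>(-1)^n / n! (1 + y)^n A^(n)(y)\<close>. The theorem follows from a characterisation:
  a non-trivial sequence is a Laguerre multiplier sequence if and only if \<open>A\<close> is a non-zero polynomial
  whose zeros all lie in \<open>[-1, 0]\<close>. By Gauss and Lucas this property passes to derivatives (as long
  as they do not vanish), and it survives multiplication by \<open>1 + y\<close>.

  Zeros in \<open>[-1, 0]\<close> suffice
  (\<open>laguerre_multiplier_sequence_of_unit_interval_zeros\<close>): the diagonal operator is
  \<open>F(x, -D)\<close> with \<open>x\<close> written to the left of \<open>D\<close> and
  \<open>F(x, y) = (\<Sum>k. a k y^k L_k(x (1 + y)))\<close>. For fixed \<open>y\<close> this is obtained from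
  \<open>A(y - y (1 + y) x)\<close> by dividing the coefficient of \<open>x^j\<close> by \<open>j!\<close>. A zero \<open>-\<theta>\<close> of \<open>A\<close> gives
  the zero \<open>x = \<theta> / y + (1 - \<theta>) / (1 + y)\<close>, which lies in the lower half-plane when \<open>y\<close> lies in the
  upper one; division by factorials keeps it there. Hence \<open>F(x, _)\<close> has no zero in the upper
  half-plane when \<open>Im x > 0\<close>, and neither has \<open>F(x, -D) p\<close> for a real-rooted \<open>p\<close>, unless it is zero.

  For the converse, let \<open>T\<close> be the diagonal operator. Testing \<open>T\<close> on quadratic multiples of Laguerre
  polynomials shows that the support of \<open>\<gamma>\<close> is a final segment \<open>k \<ge> q\<close> on which the sign of
  \<open>\<gamma> k \<gamma> (k + 1)\<close> is constant (\<open>gamma_support\<close>, \<open>gamma_signs\<close>). Suppose this sign is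
  positive. Then \<open>T (x + s)^M\<close> has no zero in the upper half-plane when \<open>Im s > 0\<close>
  (\<open>shifted_power_image_half_plane\<close>), so its value \<open>P(s)\<close> and its derivative \<open>R(s)\<close> at \<open>x = 0\<close> satisfy
  \<open>Im (R / P) \<le> 0\<close>. Because \<open>T\<close> commutes with the Laguerre differential operator,
  \<open>R = -M P + (M + s) P' - s P''\<close>; \<open>P\<close> is real-rooted as a limit
  of polynomials without zeros in the upper half-plane, and comparing poles shows that its non-zero zeros are simple
  and gives an inequality at each of them. Summing these inequalities with suitable weights bounds the
  number of non-zero zeros independently of \<open>M\<close> (\<open>few_nonzero_zeros\<close>). The coefficients of
  \<open>P\<close> are multiples of the \<open>a k\<close>, so \<open>A\<close> is a polynomial. Letting \<open>M\<close> tend to infinity with \<open>s = -M / y\<close>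
  turns \<open>Im (R / P) \<le> 0\<close> into \<open>Im (y + y (1 + y) A' / A) \<ge> 0\<close>, and the poles of this
  function force the zeros of \<open>A\<close> into \<open>[-1, 0]\<close>. A negative sign reverses the first inequality and
  contradicts Newton's inequalities (\<open>negative_orientation_impossible\<close>).
\<close>

section \<open>Polynomials without zeros in the upper half-plane\<close>

definition upper_free :: "complex poly \<Rightarrow> bool" where
  "upper_free p \<longleftrightarrow> (\<forall>z. Im z > 0 \<longrightarrow> poly p z \<noteq> 0)"

lemma upper_freeD: "upper_free p \<Longrightarrow> Im z > 0 \<Longrightarrow> poly p z \<noteq> 0"
  by (simp add: upper_free_def)

lemma complex_poly_factor:
  fixes p :: "complex poly"
  assumes "p \<noteq> 0"
  obtains A where "p = smult (lead_coeff p) (\<Prod>x\<in>#A. [:-x, 1:])" "size A = degree p"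
    "\<And>x. x \<in># A \<longleftrightarrow> poly p x = 0"
proof -
  obtain A where A: "size A = degree p" "p = smult (lead_coeff p) (\<Prod>x\<in>#A. [:-x, 1:])"
    using alg_closed_imp_factorization[OF assms] by blast
  have "poly p x = 0 \<longleftrightarrow> x \<in># A" for x
  proof -
    have "poly p x = lead_coeff p * (\<Prod>y\<in>#A. x - y)"
      by (subst A(2)) (simp add: poly_prod_mset image_mset.compositionality o_def)
    then show ?thesis using assms by (auto simp: prod_mset_zero_iff)
  qed
  with A show thesis using that by metis
qed

lemma upper_free_factor:
  assumes "upper_free p"
  obtains A where "p = smult (lead_coeff p) (\<Prod>x\<in>#A. [:-x, 1:])" "size A = degree p"
    "\<And>x. x \<in># A \<Longrightarrow> Im x \<le> 0" "lead_coeff p \<noteq> 0"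
proof -
  have "p \<noteq> 0" using upper_freeD[OF assms, of \<i>] by auto
  then obtain A where A: "p = smult (lead_coeff p) (\<Prod>x\<in>#A. [:-x, 1:])" "size A = degree p"
    "\<And>x. x \<in># A \<longleftrightarrow> poly p x = 0"
    using complex_poly_factor by blast
  show thesis
    by (rule that[OF A(1,2)]) (use A(3) assms \<open>p \<noteq> 0\<close> in \<open>force simp: upper_free_def not_less[symmetric]\<close>)+
qed

text \<open>
  The sign of \<open>Im (p / q)\<close> at \<open>z\<close>, written without a division so that zeros of \<open>q\<close> need no special
  treatment.
\<close>

definition im_pair :: "complex poly \<Rightarrow> complex poly \<Rightarrow> complex \<Rightarrow> real" where
  "im_pair p q z = Im (poly p z * cnj (poly q z))"

lemma Im_cmod_mult: "Im ((w * cnj w) * u) = (cmod w)\<^sup>2 * Im u"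
  unfolding complex_norm_square[symmetric] by (simp flip: of_real_power)

lemma im_pair_smult: "im_pair (smult c p) (smult c q) z = (cmod c)\<^sup>2 * im_pair p q z"
proof -
  have "poly (smult c p) z * cnj (poly (smult c q) z) = (c * cnj c) * (poly p z * cnj (poly q z))" by simp
  then show ?thesis unfolding im_pair_def by (simp only: Im_cmod_mult)
qed

lemma im_pair_linear_mult:
  "im_pair (pderiv ([:-x, 1:] * W)) ([:-x, 1:] * W) z =
    (cmod (z - x))\<^sup>2 * im_pair (pderiv W) W z - (cmod (poly W z))\<^sup>2 * (Im z - Im x)"
proof -
  have d: "pderiv ([:-x, 1:] * W) = W + [:-x, 1:] * pderiv W"
    by (subst pderiv_mult) (simp add: pderiv_pCons)
  have "poly (pderiv ([:-x, 1:] * W)) z * cnj (poly ([:-x, 1:] * W) z) =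
    ((z - x) * cnj (z - x)) * (poly (pderiv W) z * cnj (poly W z)) + (poly W z * cnj (poly W z)) * cnj (z - x)"
    unfolding d by (simp add: algebra_simps)
  then show ?thesis
    unfolding im_pair_def by (simp only: Im_cmod_mult plus_complex.sel) (simp add: algebra_simps)
qed

text \<open>
  The logarithmic derivative is the sum of \<open>1 / (z - x)\<close> over the zeros \<open>x\<close>, and each summand has
  negative imaginary part when \<open>z\<close> lies above \<open>x\<close>.
\<close>

lemma log_deriv_prod_mset:
  fixes A :: "complex multiset"
  assumes "\<And>x. x \<in># A \<Longrightarrow> Im x \<le> 0" "Im z \<ge> 0"
  defines "V \<equiv> (\<Prod>x\<in>#A. [:-x, 1:])"
  shows "im_pair (pderiv V) V z \<le> 0 \<and> (A \<noteq> {#} \<and> Im z > 0 \<longrightarrow> im_pair (pderiv V) V z < 0)"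
  using assms(1) unfolding V_def
proof (induction A)
  case empty
  then show ?case by (simp add: im_pair_def)
next
  case (add x A)
  let ?W = "\<Prod>x\<in>#A. [:-x, 1:]"
  have IH: "im_pair (pderiv ?W) ?W z \<le> 0" using add by auto
  have x: "Im x \<le> 0" using add.prems by simp
  have a: "(cmod (z - x))\<^sup>2 * im_pair (pderiv ?W) ?W z \<le> 0"
    using IH by (simp add: mult_nonneg_nonpos)
  have b: "(cmod (poly ?W z))\<^sup>2 * (Im z - Im x) \<ge> 0" using x assms(2) by simp
  have c: "(cmod (poly ?W z))\<^sup>2 * (Im z - Im x) > 0" if "Im z > 0"
  proof -
    have "poly ?W z \<noteq> 0"
      using that add.prems
      by (auto simp: poly_prod_mset image_mset.compositionality o_def prod_mset_zero_iff; force)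
    then show ?thesis using that x by simp
  qed
  show ?case using a b c by (simp add: im_pair_linear_mult del: mult_pCons_left; linarith)
qed

lemma upper_free_log_deriv:
  assumes "upper_free V" "Im z \<ge> 0"
  shows "im_pair (pderiv V) V z \<le> 0"
    and "degree V > 0 \<Longrightarrow> Im z > 0 \<Longrightarrow> im_pair (pderiv V) V z < 0"
proof -
  obtain A where A: "V = smult (lead_coeff V) (\<Prod>x\<in>#A. [:-x, 1:])" "size A = degree V"
    "\<And>x. x \<in># A \<Longrightarrow> Im x \<le> 0" "lead_coeff V \<noteq> 0"
    using upper_free_factor[OF assms(1)] by blast
  define c where "c = lead_coeff V"
  let ?W = "\<Prod>x\<in>#A. [:-x, 1:]"
  have e: "im_pair (pderiv V) V z = (cmod c)\<^sup>2 * im_pair (pderiv ?W) ?W z"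
    by (subst (1 2) A(1)[folded c_def]) (simp add: pderiv_smult im_pair_smult)
  note L = log_deriv_prod_mset[of A z, OF A(3) assms(2)]
  show "im_pair (pderiv V) V z \<le> 0"
    unfolding e using L by (simp add: mult_nonneg_nonpos)
  assume "degree V > 0" "Im z > 0"
  then show "im_pair (pderiv V) V z < 0"
    unfolding e using L A(2,4) by (auto simp: c_def mult_pos_neg)
qed

text \<open>
  A zero of \<open>q - c q'\<close> would give \<open>q' / q = 1 / c\<close>, but the imaginary parts of the two sides have
  different signs.
\<close>

lemma upper_free_minus_deriv:
  assumes "upper_free q" "Im c \<le> 0"
  shows "upper_free (q - smult c (pderiv q))"
  unfolding upper_free_def
proof (intro allI impI notI)
  fix z assume z: "Im z > 0" and "poly (q - smult c (pderiv q)) z = 0"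
  then have e: "poly q z = c * poly (pderiv q) z" by simp
  have nz: "poly q z \<noteq> 0" using upper_freeD assms z by blast
  have d: "degree q > 0"
  proof (rule ccontr)
    assume "\<not> ?thesis"
    then have "pderiv q = 0" by (simp add: pderiv_eq_0_iff)
    then show False using e nz by simp
  qed
  have c: "c \<noteq> 0" using e nz by auto
  have "poly (pderiv q) z * cnj (poly q z) = inverse c * (poly q z * cnj (poly q z))"
    using e c by (simp add: field_simps)
  then have "im_pair (pderiv q) q z = Im (inverse c) * (cmod (poly q z))\<^sup>2"
    unfolding im_pair_def by (metis Im_cmod_mult mult.commute)
  moreover have "Im (inverse c) \<ge> 0" using assms(2) by (simp add: divide_nonpos_nonneg)
  ultimately have "im_pair (pderiv q) q z \<ge> 0" by (simp only: mult_nonneg_nonneg zero_le_power2)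
  moreover have "im_pair (pderiv q) q z < 0" using upper_free_log_deriv(2)[OF assms(1)] z d by simp
  ultimately show False by linarith
qed

lemma upper_free_deriv_plus:
  assumes "upper_free q" "Im \<eta> \<le> 0"
  shows "pderiv q + smult \<eta> q = 0 \<or> upper_free (pderiv q + smult \<eta> q)"
proof (cases "degree q = 0")
  case True
  then obtain a where "q = [:a:]" using degree_eq_zeroE by blast
  then show ?thesis by (auto simp: upper_free_def)
next
  case False
  have "upper_free (pderiv q + smult \<eta> q)"
    unfolding upper_free_def
  proof (intro allI impI notI)
    fix z assume z: "Im z > 0" and "poly (pderiv q + smult \<eta> q) z = 0"
    then have e: "poly (pderiv q) z = - \<eta> * poly q z" by (simp add: add_eq_0_iff2)
    have "im_pair (pderiv q) q z < 0"
      using upper_free_log_deriv(2)[OF assms(1)] z False by simp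
    moreover have "poly (pderiv q) z * cnj (poly q z) = - \<eta> * (poly q z * cnj (poly q z))" by (simp add: e)
    then have "im_pair (pderiv q) q z = - Im \<eta> * (cmod (poly q z))\<^sup>2"
      unfolding im_pair_def complex_norm_square[symmetric] by simp
    moreover have "- Im \<eta> * (cmod (poly q z))\<^sup>2 \<ge> 0" using assms(2) by (simp add: mult_nonpos_nonneg)
    ultimately show False by linarith
  qed
  then show ?thesis ..
qed

section \<open>Division of coefficients by factorials\<close>

text \<open>
  The map \<open>x^j \<mapsto> x^(j + d) / (j + d)!\<close>. Only \<open>d = 0\<close> is wanted in the end, but multiplying the argument by
  \<open>x\<close> raises \<open>d\<close>, so an induction over the zeros needs all \<open>d\<close>.
\<close>

definition exp_shift :: "'a::field_char_0 poly \<Rightarrow> nat \<Rightarrow> 'a poly" where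
  "exp_shift p = fold_coeffs (\<lambda>a f d. monom (a / fact d) d + f (Suc d)) p (\<lambda>_. 0)"

lemma exp_shift_0 [simp]: "exp_shift 0 d = 0"
  by (simp add: exp_shift_def)

lemma exp_shift_pCons [simp]: "exp_shift (pCons a p) d = monom (a / fact d) d + exp_shift p (Suc d)"
  by (cases "a = 0 \<and> p = 0")
    (auto simp: exp_shift_def fold_coeffs_pCons_coeff_not_0_eq fold_coeffs_pCons_not_0_0_eq)

lemma exp_shift_add: "exp_shift (p + q) d = exp_shift p d + exp_shift q d"
proof (induction p q arbitrary: d rule: poly_induct2)
  case (pCons a p b q)
  then show ?case by (simp add: add_divide_distrib add_monom[symmetric] algebra_simps)
qed simp

lemma exp_shift_smult: "exp_shift (smult c p) d = smult c (exp_shift p d)"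
  by (induction p arbitrary: d) (auto simp: smult_monom smult_add_right)

lemma pderiv_exp_shift: "pderiv (exp_shift p (Suc d)) = exp_shift p d"
proof (induction p arbitrary: d)
  case (pCons a p)
  have "of_nat (Suc d) * (a / fact (Suc d)) = a / fact d"
    by (simp add: field_simps del: of_nat_Suc)
  then show ?case using pCons by (simp add: pderiv_add pderiv_monom del: of_nat_Suc)
qed simp

lemma exp_shift_linear_mult:
  "exp_shift ([:-c, 1:] * p) d = exp_shift p (Suc d) - smult c (pderiv (exp_shift p (Suc d)))"
proof -
  have "[:-c, 1:] * p = pCons 0 p + smult (-c) p" by simp
  then show ?thesis
    by (simp only: exp_shift_add exp_shift_smult pderiv_exp_shift exp_shift_pCons) simp
qed

text \<open>
  A linear factor \<open>x - c\<close> of the argument acts on the image as \<open>1 - c D\<close> (after \<open>d\<close> has been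
  raised by one), and this operator keeps the upper half-plane free of zeros. The induction ends with a
  monomial.
\<close>

lemma upper_free_exp_shift:
  assumes "upper_free p"
  shows "upper_free (exp_shift p d)"
proof -
  obtain A where A: "p = smult (lead_coeff p) (\<Prod>x\<in>#A. [:-x, 1:])"
    "\<And>x. x \<in># A \<Longrightarrow> Im x \<le> 0" "lead_coeff p \<noteq> 0"
    using upper_free_factor[OF assms] by metis
  have "upper_free (exp_shift (\<Prod>x\<in>#A. [:-x, 1:]) d)"
    using A(2)
  proof (induction A arbitrary: d)
    case empty
    have "exp_shift 1 d = monom (1 / fact d :: complex) d"
      unfolding one_pCons by simp
    then show ?case by (auto simp: upper_free_def poly_monom)
  next
    case (add x A)
    then show ?case
      using upper_free_minus_deriv[of "exp_shift (\<Prod>x\<in>#A. [:-x, 1:]) (Suc d)" x]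
      by (simp add: exp_shift_linear_mult del: mult_pCons_left)
  qed
  then show ?thesis
    using A(3) by (subst A(1)) (simp add: exp_shift_smult upper_free_def)
qed

section \<open>Differential operators with constant coefficients\<close>

text \<open>The operator \<open>F(-D)\<close>.\<close>

definition neg_diffop :: "'a::field_char_0 poly \<Rightarrow> 'a poly \<Rightarrow> 'a poly" where
  "neg_diffop F = fold_coeffs (\<lambda>a f q. smult a q + f (- pderiv q)) F (\<lambda>_. 0)"

lemma neg_diffop_0 [simp]: "neg_diffop 0 p = 0"
  by (simp add: neg_diffop_def)

lemma neg_diffop_pCons [simp]: "neg_diffop (pCons a F) p = smult a p + neg_diffop F (- pderiv p)"
  by (cases "a = 0 \<and> F = 0")
    (auto simp: neg_diffop_def fold_coeffs_pCons_coeff_not_0_eq fold_coeffs_pCons_not_0_0_eq)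

lemma neg_diffop_add: "neg_diffop (F + G) p = neg_diffop F p + neg_diffop G p"
  by (induction F G arbitrary: p rule: poly_induct2) (auto simp: smult_add_left algebra_simps)

lemma neg_diffop_smult: "neg_diffop (smult c F) p = smult c (neg_diffop F p)"
  by (induction F arbitrary: p) (auto simp: smult_add_right)

lemma neg_diffop_add_right: "neg_diffop F (p + q) = neg_diffop F p + neg_diffop F q"
proof (induction F arbitrary: p q)
  case (pCons a F)
  have "- pderiv (p + q) = - pderiv p + - pderiv q" by (simp add: pderiv_add)
  then show ?case by (simp only: neg_diffop_pCons pCons.IH smult_add_right) (simp add: algebra_simps)
qed simp

lemma neg_diffop_smult_right: "neg_diffop F (smult c p) = smult c (neg_diffop F p)"
proof (induction F arbitrary: p)
  case (pCons a F)
  have "- pderiv (smult c p) = smult c (- pderiv p)" by (simp add: pderiv_smult)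
  then show ?case by (simp only: neg_diffop_pCons pCons.IH smult_add_right) (simp add: algebra_simps)
qed simp

lemma neg_diffop_zero_right [simp]: "neg_diffop F 0 = 0"
  by (induction F) auto

lemma neg_diffop_linear_mult:
  "neg_diffop ([:a, b:] * F) p = neg_diffop F (smult a p - smult b (pderiv p))"
proof -
  have "[:a, b:] * F = smult a F + pCons 0 (smult b F)" by simp
  moreover have "smult a p - smult b (pderiv p) = smult a p + smult b (- pderiv p)" by simp
  ultimately show ?thesis
    by (simp only: neg_diffop_add neg_diffop_smult neg_diffop_add_right neg_diffop_smult_right
        neg_diffop_pCons) simp
qed

text \<open>
  The factor \<open>y - x\<close> of \<open>F\<close> acts as \<open>-(D + x)\<close>, and \<open>D + x\<close> keeps the upper half-plane free of zeros
  when \<open>Im x \<le> 0\<close>. A constant argument may be mapped to zero, whence the alternative.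
\<close>

lemma upper_free_neg_diffop:
  assumes "upper_free F" "upper_free p"
  shows "neg_diffop F p = 0 \<or> upper_free (neg_diffop F p)"
proof -
  obtain A where A: "F = smult (lead_coeff F) (\<Prod>x\<in>#A. [:-x, 1:])"
    "\<And>x. x \<in># A \<Longrightarrow> Im x \<le> 0" "lead_coeff F \<noteq> 0"
    using upper_free_factor[OF assms(1)] by metis
  have "neg_diffop (\<Prod>x\<in>#A. [:-x, 1:]) p = 0 \<or> upper_free (neg_diffop (\<Prod>x\<in>#A. [:-x, 1:]) p)"
    using A(2) assms(2)
  proof (induction A arbitrary: p)
    case empty
    have "neg_diffop 1 p = p" unfolding one_pCons by simp
    then show ?case using empty by simp
  next
    case (add x A)
    have "pderiv p + smult x p = 0 \<or> upper_free (pderiv p + smult x p)"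
      using upper_free_deriv_plus add.prems by simp
    then have "- (pderiv p + smult x p) = 0 \<or> upper_free (- (pderiv p + smult x p))"
      unfolding upper_free_def by (metis poly_minus neg_equal_0_iff_equal)
    moreover have "neg_diffop (\<Prod>x\<in>#add_mset x A. [:-x, 1:]) p
        = neg_diffop (\<Prod>x\<in>#A. [:-x, 1:]) (- (pderiv p + smult x p))"
    proof -
      have "- (pderiv p + smult x p) = smult (- x) p - smult 1 (pderiv p)" by simp
      then show ?thesis by (simp only: image_mset_add_mset prod_mset.add_mset neg_diffop_linear_mult)
    qed
    ultimately show ?case using add by (metis neg_diffop_zero_right union_iff add_mset_add_single)
  qed
  then show ?thesis
    using A(3) by (subst (1 2) A(1)) (auto simp: neg_diffop_smult upper_free_def)
qed

section \<open>Operators that are diagonal on the Laguerre polynomials\<close>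

lemma coeff_laguerre_poly: "coeff (laguerre_poly n) i = (-1) ^ i / fact i * real (n choose i)"
  by (cases "i \<le> n") (auto simp: laguerre_poly_def coeff_sum if_distrib cong: if_cong)

text \<open>
  The generalized Laguerre polynomial of degree \<open>N - r\<close> and parameter \<open>r\<close>. In this indexing \<open>-D\<close> raises
  \<open>r\<close>, and \<open>1 - D\<close> raises both \<open>N\<close> and \<open>r\<close>.
\<close>

definition laguerre_shift :: "nat \<Rightarrow> nat \<Rightarrow> real poly" where
  "laguerre_shift N r = (\<Sum>i\<le>N. monom ((-1) ^ i / fact i * real (N choose (r + i))) i)"

lemma coeff_laguerre_shift: "coeff (laguerre_shift N r) i = (-1) ^ i / fact i * real (N choose (r + i))"
  by (cases "i \<le> N") (auto simp: laguerre_shift_def coeff_sum if_distrib cong: if_cong)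

lemma laguerre_shift_0: "laguerre_shift n 0 = laguerre_poly n"
  by (rule poly_eqI) (simp add: coeff_laguerre_shift coeff_laguerre_poly)

lemma pderiv_laguerre_shift: "- pderiv (laguerre_shift N r) = laguerre_shift N (Suc r)"
  by (rule poly_eqI)
    (simp add: coeff_pderiv coeff_laguerre_shift fact_Suc field_simps del: of_nat_Suc binomial_Suc_Suc)

lemma laguerre_shift_Suc: "laguerre_shift N r - pderiv (laguerre_shift N r) = laguerre_shift (Suc N) (Suc r)"
proof -
  have "laguerre_shift N r - pderiv (laguerre_shift N r) = laguerre_shift N r + laguerre_shift N (Suc r)"
    using pderiv_laguerre_shift[of N r] by (metis diff_conv_add_uminus)
  also have "\<dots> = laguerre_shift (Suc N) (Suc r)"
    by (rule poly_eqI) (simp add: coeff_laguerre_shift field_simps)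
  finally show ?thesis .
qed

lemma neg_diffop_power_laguerre_shift:
  "neg_diffop ([:1, 1:] ^ j) (laguerre_shift N r) = laguerre_shift (N + j) (r + j)"
proof (induction j arbitrary: N r)
  case 0
  show ?case by (simp add: one_pCons)
next
  case (Suc j)
  have "neg_diffop ([:1, 1:] ^ Suc j) (laguerre_shift N r) =
      neg_diffop ([:1, 1:] ^ j) (laguerre_shift N r - pderiv (laguerre_shift N r))"
    by (simp only: power_Suc neg_diffop_linear_mult smult_1_left)
  then show ?case by (simp only: laguerre_shift_Suc Suc) simp
qed

lemma neg_diffop_monom_laguerre_shift:
  "neg_diffop (monom 1 k * F) (laguerre_shift N r) = neg_diffop F (laguerre_shift N (r + k))"
proof (induction k arbitrary: r)
  case (Suc k)
  have "monom 1 (Suc k) * F = pCons 0 (monom 1 k * F)" by (simp add: monom_Suc)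
  then show ?case by (simp add: pderiv_laguerre_shift Suc)
qed simp

text \<open>
  Expand \<open>(n + j) choose (k + s)\<close> by Vandermonde's identity, sum over \<open>j\<close> by the same identity, and use it
  a third time for what remains.
\<close>

lemma sum_choose_prod:
  "(\<Sum>j\<le>k. (k choose j) * (s choose j) * ((n + j) choose (k + s))) = (n choose k) * (n choose s)"
proof -
  have inner: "(\<Sum>j\<le>k. (k choose j) * (s choose j) * (j choose i)) = (k choose i) * ((k + s - i) choose k)"
    if i: "i \<le> k" for i
  proof -
    have "(\<Sum>j\<le>k. (k choose j) * (s choose j) * (j choose i))
        = (\<Sum>j\<in>{i..k}. (k choose j) * (s choose j) * (j choose i))"
      by (rule sum.mono_neutral_right) auto
    also have "\<dots> = (\<Sum>j\<in>{i..k}. (k choose i) * (((k - i) choose (k - j)) * (s choose j)))"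
    proof (rule sum.cong[OF refl])
      fix j assume j: "j \<in> {i..k}"
      have "(k choose j) * (j choose i) = (k choose i) * ((k - i) choose (j - i))"
        using choose_mult[of i j k] j by simp
      moreover have "(k - i) choose (j - i) = (k - i) choose (k - j)"
        using binomial_symmetric[of "j - i" "k - i"] j by auto
      ultimately show "(k choose j) * (s choose j) * (j choose i) = (k choose i) * (((k - i) choose (k - j)) * (s choose j))"
        by (metis mult.assoc mult.commute)
    qed
    also have "\<dots> = (k choose i) * (\<Sum>j\<in>{i..k}. ((k - i) choose (k - j)) * (s choose j))"
      by (simp add: sum_distrib_left)
    also have "(\<Sum>j\<in>{i..k}. ((k - i) choose (k - j)) * (s choose j))
        = (\<Sum>j\<le>k. ((k - i) choose (k - j)) * (s choose j))"
      using i by (intro sum.mono_neutral_left) (auto simp: binomial_eq_0_iff)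
    also have "\<dots> = (s + (k - i)) choose k"
      unfolding vandermonde[symmetric] by (simp add: mult.commute)
    also have "s + (k - i) = k + s - i" using i by simp
    finally show ?thesis .
  qed
  have "(\<Sum>j\<le>k. (k choose j) * (s choose j) * ((n + j) choose (k + s)))
      = (\<Sum>j\<le>k. \<Sum>i\<le>k. (k choose j) * (s choose j) * (j choose i) * (n choose (k + s - i)))"
  proof (rule sum.cong[OF refl])
    fix j assume j: "j \<in> {..k}"
    have "(n + j) choose (k + s) = (\<Sum>i\<le>k + s. (j choose i) * (n choose (k + s - i)))"
      by (metis vandermonde add.commute)
    also have "\<dots> = (\<Sum>i\<le>k. (j choose i) * (n choose (k + s - i)))"
      using j by (intro sum.mono_neutral_right) (auto simp: binomial_eq_0_iff)
    finally show "(k choose j) * (s choose j) * ((n + j) choose (k + s)) =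
        (\<Sum>i\<le>k. (k choose j) * (s choose j) * (j choose i) * (n choose (k + s - i)))"
      by (simp add: sum_distrib_left mult.assoc)
  qed
  also have "\<dots> = (\<Sum>i\<le>k. (\<Sum>j\<le>k. (k choose j) * (s choose j) * (j choose i)) * (n choose (k + s - i)))"
    by (subst sum.swap) (simp add: sum_distrib_right)
  also have "\<dots> = (\<Sum>i\<le>k. (k choose i) * ((n choose (k + s - i)) * ((k + s - i) choose k)))"
    using inner by (intro sum.cong refl) (simp add: mult.assoc mult.left_commute mult.commute[of _ "n choose _"])
  also have "\<dots> = (n choose k) * (n choose s)"
  proof (cases "k \<le> n")
    case False
    have "(n choose (k + s - i)) * ((k + s - i) choose k) = 0" for i
      using False by (cases "k \<le> k + s - i") (auto simp: binomial_eq_0_iff)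
    then have "(\<Sum>i\<le>k. (k choose i) * ((n choose (k + s - i)) * ((k + s - i) choose k))) = 0" by simp
    then show ?thesis using False by (simp add: binomial_eq_0)
  next
    case True
    have "(\<Sum>i\<le>k. (k choose i) * ((n choose (k + s - i)) * ((k + s - i) choose k)))
       = (\<Sum>i\<in>{..min k s}. (n choose k) * ((k choose i) * ((n - k) choose (s - i))))"
    proof (rule sum.mono_neutral_cong_right)
      fix i assume "i \<in> {..min k s}"
      then have i: "i \<le> k" "i \<le> s" by auto
      have "(n choose (k + s - i)) * ((k + s - i) choose k) = (n choose k) * ((n - k) choose (s - i))"
      proof (cases "k + s - i \<le> n")
        case True
        then show ?thesis using choose_mult[of k "k + s - i" n] i by simp
      next
        case False
        then have "n < k + s - i" "n - k < s - i" using i \<open>k \<le> n\<close> by linarith+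
        then show ?thesis by (simp add: binomial_eq_0)
      qed
      then show "(k choose i) * ((n choose (k + s - i)) * ((k + s - i) choose k)) =
        (n choose k) * ((k choose i) * ((n - k) choose (s - i)))" by simp
    qed (auto simp: binomial_eq_0_iff)
    also have "\<dots> = (\<Sum>i\<le>s. (n choose k) * ((k choose i) * ((n - k) choose (s - i))))"
      by (rule sum.mono_neutral_left) (auto simp: binomial_eq_0_iff)
    also have "\<dots> = (n choose k) * ((k + (n - k)) choose s)"
      by (simp add: sum_distrib_left[symmetric] vandermonde)
    finally show ?thesis using True by simp
  qed
  finally show ?thesis .
qed

text \<open>
  The operator \<open>F(x, -D)\<close> for \<open>F(x, y) = (\<Sum>k. a k y^k L_k(x (1 + y)))\<close>, where \<open>a k\<close> are the
  coefficients of \<open>A\<close>. This \<open>F\<close> is found by applying the diagonal operator to \<open>e^(-xy)\<close>, whose expansion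
  in Laguerre polynomials is a multiple of their generating function.
\<close>

definition laguerre_op :: "real poly \<Rightarrow> real poly \<Rightarrow> real poly" where
  "laguerre_op A p = (\<Sum>k\<le>degree A. smult (coeff A k) (\<Sum>j\<le>k.
     smult ((-1) ^ j * real (k choose j) / fact j) (monom 1 j * neg_diffop (monom 1 k * [:1, 1:] ^ j) p)))"

text \<open>
  The \<open>k\<close>-th summand of the operator has eigenvalues \<open>n choose k\<close>: comparing coefficients of \<open>x^s\<close> reduces
  this to the identity \<open>sum_choose_prod\<close>.
\<close>

lemma laguerre_op_basis:
  "(\<Sum>j\<le>k. smult ((-1) ^ j * real (k choose j) / fact j)
      (monom 1 j * neg_diffop (monom 1 k * [:1, 1:] ^ j) (laguerre_poly n)))
    = smult (real (n choose k)) (laguerre_poly n)"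
proof (rule poly_eqI)
  fix s
  have L: "neg_diffop (monom 1 k * [:1, 1:] ^ j) (laguerre_poly n) = laguerre_shift (n + j) (k + j)" for j
    unfolding laguerre_shift_0[symmetric]
    by (simp add: neg_diffop_monom_laguerre_shift neg_diffop_power_laguerre_shift)
  have "coeff (\<Sum>j\<le>k. smult ((-1) ^ j * real (k choose j) / fact j)
      (monom 1 j * neg_diffop (monom 1 k * [:1, 1:] ^ j) (laguerre_poly n))) s
    = (\<Sum>j\<le>k. (-1) ^ j * real (k choose j) / fact j * coeff (monom 1 j * laguerre_shift (n + j) (k + j)) s)"
    by (simp add: coeff_sum L)
  also have "\<dots> = (\<Sum>j\<le>k. (-1) ^ s / fact s * (real (k choose j) * real (s choose j) * real ((n + j) choose (k + s))))"
  proof (rule sum.cong[OF refl])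
    fix j
    show "(-1) ^ j * real (k choose j) / fact j * coeff (monom 1 j * laguerre_shift (n + j) (k + j)) s
      = (-1) ^ s / fact s * (real (k choose j) * real (s choose j) * real ((n + j) choose (k + s)))"
    proof (cases "j \<le> s")
      case True
      have f: "real (s choose j) = fact s / (fact j * fact (s - j))"
        using binomial_fact[OF True] by simp
      have g: "(-1::real) ^ s = (-1) ^ j * (-1) ^ (s - j)"
        using True by (simp add: power_add[symmetric])
      show ?thesis
        using True by (simp add: coeff_monom_mult coeff_laguerre_shift f g)
    next
      case False
      then show ?thesis by (simp add: coeff_monom_mult binomial_eq_0)
    qed
  qed
  also have "\<dots> = (-1) ^ s / fact s * real (\<Sum>j\<le>k. (k choose j) * (s choose j) * ((n + j) choose (k + s)))"
    by (simp add: sum_distrib_left)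
  also have "\<dots> = coeff (smult (real (n choose k)) (laguerre_poly n)) s"
    by (simp add: sum_choose_prod coeff_laguerre_poly)
  finally show "coeff (\<Sum>j\<le>k. smult ((-1) ^ j * real (k choose j) / fact j)
      (monom 1 j * neg_diffop (monom 1 k * [:1, 1:] ^ j) (laguerre_poly n))) s
    = coeff (smult (real (n choose k)) (laguerre_poly n)) s" .
qed

lemma laguerre_op_eigen:
  "laguerre_op A (laguerre_poly n) = smult (\<Sum>k=0..n. real (n choose k) * coeff A k) (laguerre_poly n)"
proof -
  have "laguerre_op A (laguerre_poly n) = smult (\<Sum>k\<le>degree A. real (n choose k) * coeff A k) (laguerre_poly n)"
    unfolding laguerre_op_def laguerre_op_basis by (simp add: smult_sum[symmetric] mult.commute)
  also have "(\<Sum>k\<le>degree A. real (n choose k) * coeff A k) = (\<Sum>k\<le>degree A + n. real (n choose k) * coeff A k)"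
    by (rule sum.mono_neutral_left) (auto simp: coeff_eq_0)
  also have "\<dots> = (\<Sum>k=0..n. real (n choose k) * coeff A k)"
    by (rule sum.mono_neutral_right) auto
  finally show ?thesis .
qed

lemma smult_sum_right: "smult c (\<Sum>i\<in>I. f i) = (\<Sum>i\<in>I. smult c (f i))"
  by (induction I rule: infinite_finite_induct) (auto simp: smult_add_right)

lemma linear_laguerre_op: "Vector_Spaces.linear smult smult (laguerre_op A)"
  unfolding linear_smult_iff laguerre_op_def
  by (auto simp: neg_diffop_add_right neg_diffop_smult_right smult_add_right distrib_left sum.distrib
      smult_sum_right mult_ac)

section \<open>Complexification of real polynomials\<close>

abbreviation cpoly :: "real poly \<Rightarrow> complex poly" where
  "cpoly \<equiv> map_poly complex_of_real"

lemma cpoly_add: "cpoly (p + q) = cpoly p + cpoly q"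
  by (rule poly_eqI) (simp add: coeff_map_poly)

lemma cpoly_minus: "cpoly (- p) = - cpoly p"
  by (rule poly_eqI) (simp add: coeff_map_poly)

lemma cpoly_smult: "cpoly (smult c p) = smult (of_real c) (cpoly p)"
  by (rule poly_eqI) (simp add: coeff_map_poly)

lemma cpoly_monom: "cpoly (monom c n) = monom (of_real c) n"
  by (rule poly_eqI) (simp add: coeff_map_poly)

lemma cpoly_mult: "cpoly (p * q) = cpoly p * cpoly q"
  by (rule poly_eqI) (simp add: coeff_map_poly coeff_mult)

lemma cpoly_pCons: "cpoly (pCons a p) = pCons (of_real a) (cpoly p)"
  by (rule map_poly_pCons) simp

lemma cpoly_power: "cpoly (p ^ n) = cpoly p ^ n"
  by (induction n) (auto simp: cpoly_mult)

lemma cpoly_sum: "cpoly (\<Sum>i\<in>I. f i) = (\<Sum>i\<in>I. cpoly (f i))"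
  by (induction I rule: infinite_finite_induct) (auto simp: cpoly_add)

lemma cpoly_pderiv: "cpoly (pderiv p) = pderiv (cpoly p)"
  by (rule poly_eqI) (simp add: coeff_map_poly coeff_pderiv)

lemma degree_cpoly: "degree (cpoly p) = degree p"
  by (rule degree_map_poly) simp

lemma cpoly_eq_0_iff: "cpoly p = 0 \<longleftrightarrow> p = 0"
  by (simp add: poly_eq_iff coeff_map_poly)

lemma poly_cpoly_of_real: "poly (cpoly p) (of_real x) = of_real (poly p x)"
  by (induction p) (auto simp: cpoly_pCons)

lemma poly_cpoly_cnj: "poly (cpoly p) (cnj z) = cnj (poly (cpoly p) z)"
  by (induction p) (auto simp: cpoly_pCons)

lemma neg_diffop_cpoly: "cpoly (neg_diffop F p) = neg_diffop (cpoly F) (cpoly p)"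
  by (induction F arbitrary: p)
    (auto simp: cpoly_pCons cpoly_add cpoly_smult cpoly_minus cpoly_pderiv)

lemma only_real_zeros_iff: "only_real_zeros p \<longleftrightarrow> p = 0 \<or> upper_free (cpoly p)"
proof (cases "p = 0")
  case False
  have "upper_free (cpoly p)" if "only_real_zeros p"
    using that False by (force simp: only_real_zeros_def upper_free_def complex_is_Real_iff)
  moreover have "only_real_zeros p" if u: "upper_free (cpoly p)"
    unfolding only_real_zeros_def
  proof (intro disjI2 allI impI)
    fix z assume z: "poly (cpoly p) z = 0"
    then have "poly (cpoly p) (cnj z) = 0" by (simp add: poly_cpoly_cnj)
    then have "\<not> Im z > 0" "\<not> Im (cnj z) > 0" using u z unfolding upper_free_def by blast+
    then show "z \<in> \<real>" by (simp add: complex_is_Real_iff)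
  qed
  ultimately show ?thesis using False by blast
qed (simp add: only_real_zeros_def)

section \<open>The symbol of a diagonal operator\<close>

text \<open>The symbol \<open>F(x, _)\<close> as a polynomial in its second variable, for a fixed complex \<open>x\<close>.\<close>

definition laguerre_symbol :: "real poly \<Rightarrow> complex \<Rightarrow> complex poly" where
  "laguerre_symbol A x = (\<Sum>k\<le>degree A. smult (of_real (coeff A k)) (\<Sum>j\<le>k.
     smult ((-x) ^ j * of_nat (k choose j) / fact j) (monom 1 k * [:1, 1:] ^ j)))"

lemma neg_diffop_sum: "neg_diffop (\<Sum>i\<in>I. F i) p = (\<Sum>i\<in>I. neg_diffop (F i) p)"
  by (induction I rule: infinite_finite_induct) (auto simp: neg_diffop_add)

lemma poly_laguerre_op:
  "poly (cpoly (laguerre_op A p)) x = poly (neg_diffop (laguerre_symbol A x) (cpoly p)) x"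
proof -
  have "(- x) ^ j = (- 1) ^ j * x ^ j" for j by (rule power_minus)
  then show ?thesis
    unfolding laguerre_op_def laguerre_symbol_def
    by (simp add: neg_diffop_sum neg_diffop_smult neg_diffop_cpoly cpoly_sum cpoly_smult cpoly_mult cpoly_monom
      cpoly_power cpoly_pCons poly_sum poly_monom mult_ac)
qed

lemma exp_shift_sum: "exp_shift (\<Sum>i\<in>I. f i) d = (\<Sum>i\<in>I. exp_shift (f i) d)"
  by (induction I rule: infinite_finite_induct) (auto simp: exp_shift_add)

lemma exp_shift_monom: "exp_shift (monom c j) d = monom (c / fact (j + d)) (j + d)"
  by (induction j arbitrary: d) (auto simp: monom_0 monom_Suc)

lemma poly_exp_shift_linear_power:
  fixes a b x :: "'a::field_char_0"
  shows "poly (exp_shift ([:a, b:] ^ k) 0) x = (\<Sum>j\<le>k. of_nat (k choose j) * a ^ (k - j) * b ^ j / fact j * x ^ j)"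
proof -
  have "[:a, b:] ^ k = (monom b 1 + [:a:]) ^ k" by (simp add: monom_Suc monom_0)
  also have "\<dots> = (\<Sum>j\<le>k. of_nat (k choose j) * monom b 1 ^ j * [:a:] ^ (k - j))"
    by (rule binomial_ring)
  also have "\<dots> = (\<Sum>j\<le>k. monom (of_nat (k choose j) * a ^ (k - j) * b ^ j) j)"
    by (intro sum.cong refl poly_eqI)
      (simp add: monom_power poly_const_pow of_nat_poly coeff_monom mult_ac)
  finally have e: "[:a, b:] ^ k = (\<Sum>j\<le>k. monom (of_nat (k choose j) * a ^ (k - j) * b ^ j) j)" .
  show ?thesis by (simp add: e exp_shift_sum exp_shift_monom poly_sum poly_monom)
qed

text \<open>
  Seen as a function of \<open>x\<close>, the symbol is the image of \<open>A(y - y (1 + y) x)\<close> under division of the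
  coefficients by factorials. This trades the second variable for the first and makes the zeros
  of \<open>A\<close> accessible.
\<close>

lemma poly_laguerre_symbol:
  "poly (laguerre_symbol A x) y = poly (exp_shift (pcompose (cpoly A) [:y, - (y * (1 + y)):]) 0) x"
proof -
  have "cpoly A = (\<Sum>k\<le>degree A. monom (of_real (coeff A k)) k)"
    using poly_as_sum_of_monoms[of "cpoly A"] by (simp add: degree_cpoly coeff_map_poly)
  moreover have "pcompose (p ^ k) q = pcompose p q ^ k" for p q :: "complex poly" and k
    by (induction k) (auto simp: pcompose_mult pcompose_1)
  ultimately have P: "pcompose (cpoly A) q = (\<Sum>k\<le>degree A. smult (of_real (coeff A k)) (q ^ k))" for q
    by (simp add: pcompose_sum monom_altdef pcompose_smult pcompose_pCons)
  have "poly (exp_shift (pcompose (cpoly A) [:y, - (y * (1 + y)):]) 0) x =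
     (\<Sum>k\<le>degree A. of_real (coeff A k) * (\<Sum>j\<le>k. of_nat (k choose j) * y ^ (k - j) * (- (y * (1 + y))) ^ j / fact j * x ^ j))"
    by (simp add: P exp_shift_smult exp_shift_sum poly_sum poly_exp_shift_linear_power)
  also have "\<dots> = (\<Sum>k\<le>degree A. of_real (coeff A k) * (\<Sum>j\<le>k. (- x) ^ j * of_nat (k choose j) / fact j * (y ^ k * (1 + y) ^ j)))"
  proof (rule sum.cong[OF refl], rule arg_cong2[where f = "(*)", OF refl], rule sum.cong[OF refl])
    fix k j :: nat assume "j \<in> {..k}"
    then have "y ^ k = y ^ (k - j) * y ^ j" by (simp add: power_add[symmetric])
    moreover have "(- (y * (1 + y))) ^ j * x ^ j = (- x) ^ j * y ^ j * (1 + y) ^ j"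
      by (simp add: power_mult_distrib[symmetric] algebra_simps)
    ultimately show "of_nat (k choose j) * y ^ (k - j) * (- (y * (1 + y))) ^ j / fact j * x ^ j =
      (- x) ^ j * of_nat (k choose j) / fact j * (y ^ k * (1 + y) ^ j)"
      by (simp add: mult_ac)
  qed
  also have "\<dots> = poly (laguerre_symbol A x) y"
    by (simp add: laguerre_symbol_def poly_sum poly_monom)
  finally show ?thesis ..
qed

lemma poly_cpoly_laguerre_poly:
  "poly (cpoly (laguerre_poly n)) x = (\<Sum>j\<le>n. (-x) ^ j * of_nat (n choose j) / fact j)"
proof -
  have "(- x) ^ j = (- 1) ^ j * x ^ j" for j by (rule power_minus)
  then show ?thesis
    by (simp add: laguerre_poly_def cpoly_sum cpoly_monom poly_sum poly_monom atLeast0AtMost mult_ac)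
qed

text \<open>Division by factorials turns \<open>(1 - x)^n\<close> into the Laguerre polynomial.\<close>

lemma upper_free_laguerre_poly: "upper_free (cpoly (laguerre_poly n))"
proof -
  have "upper_free ([:1, -1:] ^ n)" by (auto simp: upper_free_def)
  then have "upper_free (exp_shift ([:1, -1:] ^ n) 0)" by (rule upper_free_exp_shift)
  moreover have "poly (exp_shift ([:1, -1:] ^ n) 0) x = poly (cpoly (laguerre_poly n)) x" for x
    by (simp add: poly_exp_shift_linear_power poly_cpoly_laguerre_poly power_minus[of x] mult_ac)
  ultimately show ?thesis by (simp add: upper_free_def)
qed

section \<open>Sufficiency of zeros in the unit interval\<close>

definition unit_interval_zeros :: "real poly \<Rightarrow> bool" where
  "unit_interval_zeros A \<longleftrightarrow> (\<forall>z. poly (cpoly A) z = 0 \<longrightarrow> (\<exists>\<theta>\<in>{0..1}. z = - of_real \<theta>))"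

text \<open>
  A zero \<open>-\<theta>\<close> of \<open>A\<close> becomes the zero \<open>t = (y + \<theta>) / (y (1 + y))\<close> of \<open>A(y - y (1 + y) t)\<close>;
  by partial fractions it is a convex combination of \<open>1 / y\<close> and \<open>1 / (1 + y)\<close>, because
  \<open>0 \<le> \<theta> \<le> 1\<close>.
\<close>

lemma upper_free_laguerre_symbol:
  assumes "unit_interval_zeros A" "Im x > 0"
  shows "upper_free (laguerre_symbol A x)"
  unfolding upper_free_def
proof (intro allI impI)
  fix y :: complex assume y: "Im y > 0"
  define w where "w = y * (1 + y)"
  have nz: "y \<noteq> 0" "1 + y \<noteq> 0" using y by (auto simp: complex_eq_iff)
  have "upper_free (pcompose (cpoly A) [:y, - w:])"
    unfolding upper_free_def
  proof (intro allI impI notI)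
    fix t assume t: "Im t > 0" and "poly (pcompose (cpoly A) [:y, - w:]) t = 0"
    then have "poly (cpoly A) (y - t * w) = 0" by (simp add: poly_pcompose)
    then obtain \<theta> where \<theta>: "\<theta> \<in> {0..1}" "y - t * w = - of_real \<theta>"
      using assms(1) unfolding unit_interval_zeros_def by blast
    have "t * w = y + of_real \<theta>" using \<theta>(2) by (simp add: algebra_simps)
    then have "t = (y + of_real \<theta>) / (y * (1 + y))"
      using nz unfolding w_def by (simp add: eq_divide_eq)
    also have "\<dots> = of_real \<theta> * inverse y + of_real (1 - \<theta>) * inverse (1 + y)"
      using nz by (simp add: divide_simps) (simp add: algebra_simps)
    finally have "t = of_real \<theta> * inverse y + of_real (1 - \<theta>) * inverse (1 + y)" .
    then have "Im t = \<theta> * Im (inverse y) + (1 - \<theta>) * Im (inverse (1 + y))" by simp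
    moreover have "Im (inverse y) \<le> 0" "Im (inverse (1 + y)) \<le> 0"
      using y by (auto intro!: divide_nonpos_nonneg)
    ultimately have "Im t \<le> 0" using \<theta>(1) by (smt (verit) atLeastAtMost_iff mult_nonneg_nonpos)
    then show False using t by simp
  qed
  then show "poly (laguerre_symbol A x) y \<noteq> 0"
    using upper_freeD[OF upper_free_exp_shift assms(2)] unfolding poly_laguerre_symbol w_def by blast
qed

text \<open>
  The lowest coefficient of the symbol is a multiple of a Laguerre polynomial in \<open>x\<close>. As this does not vanish
  in the upper half-plane, the order of vanishing at \<open>y = 0\<close> is the same for all such \<open>x\<close>; this
  decides when the operator annihilates a polynomial.
\<close>

lemma coeff_laguerre_symbol_low:
  assumes "\<And>k. k < r \<Longrightarrow> coeff A k = 0" "i \<le> r"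
  shows "coeff (laguerre_symbol A x) i =
    (if i = r then of_real (coeff A r) * poly (cpoly (laguerre_poly r)) x else 0)"
proof -
  have c0: "coeff ([:1, 1::complex:] ^ j) 0 = 1" for j
    by (induction j) (auto simp: coeff_mult)
  have t: "coeff (\<Sum>j\<le>k. smult ((-x) ^ j * of_nat (k choose j) / fact j) (monom 1 k * [:1, 1:] ^ j)) i
     = (if k = r \<and> i = r then poly (cpoly (laguerre_poly r)) x else 0)" if "k \<ge> r" for k
    using that assms(2)
    by (auto simp: coeff_sum coeff_monom_mult poly_cpoly_laguerre_poly c0)
  have "coeff (laguerre_symbol A x) i =
     (\<Sum>k\<le>degree A. of_real (coeff A k) * (if k = r \<and> i = r then poly (cpoly (laguerre_poly r)) x else 0))"
    unfolding laguerre_symbol_def coeff_sum coeff_smult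
  proof (rule sum.cong[OF refl])
    fix k
    show "complex_of_real (coeff A k) * (\<Sum>j\<le>k. (- x) ^ j * of_nat (k choose j) / fact j * coeff (monom 1 k * [:1, 1:] ^ j) i) =
       of_real (coeff A k) * (if k = r \<and> i = r then poly (cpoly (laguerre_poly r)) x else 0)"
      using t[of k] assms(1)[of k] by (cases "k < r") (auto simp: coeff_sum)
  qed
  also have "\<dots> = (if i = r then of_real (coeff A r) * poly (cpoly (laguerre_poly r)) x else 0)"
    by (cases "r \<le> degree A") (auto simp: coeff_eq_0 if_distrib cong: if_cong)
  finally show ?thesis .
qed

lemma degree_neg_diffop: "degree (neg_diffop F p) \<le> degree p"
proof (induction F arbitrary: p)
  case (pCons a F)
  have "degree (neg_diffop F (- pderiv p)) \<le> degree p"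
    using pCons.IH[of "- pderiv p"] by (simp add: degree_pderiv)
  then show ?case by (simp add: degree_add_le degree_smult_le)
qed simp

lemma neg_diffop_eq_0:
  assumes "\<And>k. k \<le> degree p \<Longrightarrow> coeff F k = 0"
  shows "neg_diffop F p = 0"
  using assms
proof (induction F arbitrary: p)
  case (pCons a F)
  have "a = 0" using pCons.prems[of 0] by simp
  moreover have "neg_diffop F (- pderiv p) = 0"
  proof (cases "degree p = 0")
    case True
    then have "pderiv p = 0" by (simp add: pderiv_eq_0_iff)
    then show ?thesis by simp
  next
    case False
    show ?thesis
    proof (rule pCons.IH)
      fix k assume "k \<le> degree (- pderiv p)"
      then have "Suc k \<le> degree p" using False by (simp add: degree_pderiv)
      then show "coeff F k = 0" using pCons.prems[of "Suc k"] by simp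
    qed
  qed
  ultimately show ?case by simp
qed simp

lemma neg_diffop_nonzero:
  assumes "\<And>k. k < r \<Longrightarrow> coeff F k = 0" "coeff F r \<noteq> 0" "r \<le> degree p" "p \<noteq> 0"
  shows "neg_diffop F p \<noteq> 0"
  using assms
proof (induction r arbitrary: F p)
  case 0
  obtain a G where F: "F = pCons a G" using pCons_cases by blast
  have "coeff (neg_diffop G (- pderiv p)) (degree p) = 0"
  proof (cases "degree p = 0")
    case True
    then have "pderiv p = 0" by (simp add: pderiv_eq_0_iff)
    then show ?thesis by simp
  next
    case False
    then show ?thesis
      using degree_neg_diffop[of G "- pderiv p"] by (intro coeff_eq_0) (simp add: degree_pderiv)
  qed
  then have "coeff (neg_diffop F p) (degree p) = a * lead_coeff p" by (simp add: F)
  moreover have "a * lead_coeff p \<noteq> 0" using 0 F by simp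
  ultimately show ?case by (metis coeff_0)
next
  case (Suc r)
  obtain a G where F: "F = pCons a G" using pCons_cases by blast
  have a: "a = 0" using Suc.prems(1)[of 0] F by simp
  have "neg_diffop G (- pderiv p) \<noteq> 0"
  proof (rule Suc.IH)
    show "coeff G k = 0" if "k < r" for k using Suc.prems(1)[of "Suc k"] that F by simp
    show "coeff G r \<noteq> 0" using Suc.prems(2) F by simp
    show "r \<le> degree (- pderiv p)" using Suc.prems(3) by (simp add: degree_pderiv)
    show "- pderiv p \<noteq> 0" using Suc.prems(3) by (simp add: pderiv_eq_0_iff)
  qed
  then show ?case by (simp add: F a)
qed

theorem laguerre_multiplier_sequence_of_unit_interval_zeros:
  assumes "A = 0 \<or> unit_interval_zeros A"
  shows "laguerre_multiplier_sequence (\<lambda>n. \<Sum>k=0..n. real (n choose k) * coeff A k)"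
proof -
  have "only_real_zeros (laguerre_op A p)" if p: "only_real_zeros p" for p
  proof (cases "A = 0 \<or> p = 0")
    case True
    then have "laguerre_op A p = 0" by (auto simp: laguerre_op_def)
    then show ?thesis by (simp add: only_real_zeros_def)
  next
    case False
    then have A: "A \<noteq> 0" "unit_interval_zeros A" and p0: "p \<noteq> 0" and up: "upper_free (cpoly p)"
      using assms p by (auto simp: only_real_zeros_iff)
    \<comment> \<open>The operator annihilates exactly the polynomials of degree less than \<open>r\<close>.\<close>
    define r where "r = (LEAST k. coeff A k \<noteq> 0)"
    have "\<exists>k. coeff A k \<noteq> 0" using A(1) by (auto simp: poly_eq_iff)
    then have r: "coeff A r \<noteq> 0" unfolding r_def by (rule LeastI_ex)
    have r': "coeff A k = 0" if "k < r" for k using that not_less_Least unfolding r_def by blast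
    show ?thesis
    proof (cases "r \<le> degree p")
      case False
      have "poly (cpoly (laguerre_op A p)) x = 0" for x
      proof -
        have "neg_diffop (laguerre_symbol A x) (cpoly p) = 0"
          using False by (intro neg_diffop_eq_0) (simp add: degree_cpoly coeff_laguerre_symbol_low[OF r'])
        then show ?thesis by (simp add: poly_laguerre_op)
      qed
      then have "laguerre_op A p = 0" using poly_all_0_iff_0 cpoly_eq_0_iff by blast
      then show ?thesis by (simp add: only_real_zeros_def)
    next
      case True
      have "upper_free (cpoly (laguerre_op A p))"
        unfolding upper_free_def
      proof (intro allI impI)
        fix x :: complex assume x: "Im x > 0"
        let ?S = "laguerre_symbol A x"
        have "neg_diffop ?S (cpoly p) \<noteq> 0"
        proof (rule neg_diffop_nonzero)
          show "coeff ?S k = 0" if "k < r" for k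
            using that by (simp add: coeff_laguerre_symbol_low[OF r'])
          show "coeff ?S r \<noteq> 0"
            using r upper_freeD[OF upper_free_laguerre_poly x] by (simp add: coeff_laguerre_symbol_low[OF r'])
        qed (use True p0 in \<open>simp_all add: degree_cpoly cpoly_eq_0_iff\<close>)
        then have "upper_free (neg_diffop ?S (cpoly p))"
          using upper_free_neg_diffop[OF upper_free_laguerre_symbol[OF A(2) x] up] by blast
        then show "poly (cpoly (laguerre_op A p)) x \<noteq> 0"
          using upper_freeD x by (simp add: poly_laguerre_op)
      qed
      then show ?thesis by (simp add: only_real_zeros_iff)
    qed
  qed
  then have "hyperbolicity_preserving (laguerre_op A)"
    by (simp add: hyperbolicity_preserving_def linear_laguerre_op)
  then show ?thesis
    unfolding laguerre_multiplier_sequence_def using laguerre_op_eigen by blast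
qed

section \<open>Derivatives and the transformed sequence\<close>

lemma poly_pderiv_prod_mset:
  fixes A :: "'a::field_char_0 multiset"
  assumes "z \<notin># A"
  shows "poly (pderiv (\<Prod>x\<in>#A. [:-x, 1:])) z = poly (\<Prod>x\<in>#A. [:-x, 1:]) z * (\<Sum>x\<in>#A. inverse (z - x))"
  using assms
proof (induction A)
  case (add x A)
  have d: "pderiv ([:-x, 1:] * W) = W + [:-x, 1:] * pderiv W" for W
    by (subst pderiv_mult) (simp add: pderiv_pCons)
  have z: "z - x \<noteq> 0" "z \<notin># A" using add.prems by auto
  have "poly (pderiv (\<Prod>x\<in>#add_mset x A. [:-x, 1:])) z =
     poly (\<Prod>x\<in>#A. [:-x, 1:]) z * (1 + (z - x) * (\<Sum>x\<in>#A. inverse (z - x)))"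
    by (simp only: image_mset_add_mset prod_mset.add_mset d poly_add poly_mult add.IH[OF z(2)])
      (simp add: algebra_simps)
  also have "1 + (z - x) * (\<Sum>x\<in>#A. inverse (z - x)) = (z - x) * (\<Sum>x\<in>#add_mset x A. inverse (z - x))"
    using z by (simp add: distrib_left)
  finally show ?case by (simp add: algebra_simps)
qed simp

lemma Re_sum_mset_pos:
  assumes "\<And>x. x \<in># A \<Longrightarrow> Re (f x) > 0" "A \<noteq> {#}"
  shows "Re (\<Sum>x\<in>#A. f x) > 0"
  using assms
proof (induction A)
  case (add x A)
  then show ?case by (cases "A = {#}") (auto intro!: add_pos_pos)
qed simp

text \<open>
  The theorem of Gauss and Lucas for the interval \<open>[-1, 0]\<close>. Non-real zeros of the derivative are
  excluded by the half-plane argument, and to the right or left of the interval all summands of the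
  logarithmic derivative have the same sign.
\<close>

lemma unit_interval_zeros_pderiv:
  assumes "unit_interval_zeros A"
  shows "pderiv A = 0 \<or> unit_interval_zeros (pderiv A)"
proof (cases "pderiv A = 0")
  case False
  then have deg: "degree A > 0" by (simp add: pderiv_eq_0_iff)
  then have A0: "cpoly A \<noteq> 0" by (auto simp: cpoly_eq_0_iff)
  have up: "upper_free (cpoly A)" using assms unfolding upper_free_def unit_interval_zeros_def by fastforce
  have nz: "poly (cpoly (pderiv A)) z \<noteq> 0" if "Im z > 0" for z
    using upper_free_log_deriv(2)[OF up, of z] that deg
    by (auto simp: degree_cpoly im_pair_def cpoly_pderiv)
  have "\<exists>\<theta>\<in>{0..1}. z = - of_real \<theta>" if z: "poly (cpoly (pderiv A)) z = 0" for z
  proof (rule ccontr)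
    assume c: "\<not> ?thesis"
    have "poly (cpoly (pderiv A)) (cnj z) = 0" using z by (simp add: poly_cpoly_cnj)
    then have "\<not> Im (cnj z) > 0" "\<not> Im z > 0" using nz z by blast+
    then have "Im z = 0" by simp
    then obtain t where t: "z = of_real t" by (metis complex_is_Real_iff Reals_cases)
    obtain B where B: "cpoly A = smult (lead_coeff (cpoly A)) (\<Prod>x\<in>#B. [:-x, 1:])"
      "size B = degree (cpoly A)" "\<And>x. x \<in># B \<longleftrightarrow> poly (cpoly A) x = 0"
      using complex_poly_factor[OF A0] by blast
    have zB: "z \<notin># B" using c assms B(3) unfolding unit_interval_zeros_def by blast
    define cc where "cc = lead_coeff (cpoly A)"
    have cc: "cc \<noteq> 0" using A0 by (simp add: cc_def)
    have "poly (pderiv (cpoly A)) z = cc * (poly (\<Prod>x\<in>#B. [:-x, 1:]) z * (\<Sum>x\<in>#B. inverse (z - x)))"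
      by (subst B(1)[folded cc_def]) (simp add: pderiv_smult poly_pderiv_prod_mset[OF zB])
    moreover have "poly (\<Prod>x\<in>#B. [:-x, 1:]) z \<noteq> 0"
      using zB by (auto simp: poly_prod_mset image_mset.compositionality o_def prod_mset_zero_iff)
    ultimately have s: "(\<Sum>x\<in>#B. inverse (z - x)) = 0" using z cc by (simp add: cpoly_pderiv)
    have Bne: "B \<noteq> {#}" using B(2) deg by (auto simp: degree_cpoly)
    have roots: "\<exists>\<theta>\<in>{0..1}. x = - of_real \<theta>" if "x \<in># B" for x
      using that B(3) assms unfolding unit_interval_zeros_def by blast
    have inv: "Re (inverse (z - x)) = inverse (t + \<theta>)" if "x = - of_real \<theta>" for x \<theta>
      using that by (simp add: t flip: of_real_add of_real_inverse)
    have "t > 0 \<or> t < -1"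
    proof (rule ccontr)
      assume "\<not> ?thesis"
      then have "-t \<in> {0..1}" "z = - of_real (- t)" by (auto simp: t)
      then show False using c by blast
    qed
    then show False
    proof
      assume "t > 0"
      have "Re (\<Sum>x\<in>#B. inverse (z - x)) > 0"
      proof (rule Re_sum_mset_pos[OF _ Bne])
        fix x assume "x \<in># B"
        then obtain \<theta> where "\<theta> \<in> {0..1}" "x = - of_real \<theta>" using roots by blast
        then show "Re (inverse (z - x)) > 0" using inv \<open>t > 0\<close> by simp
      qed
      then show False using s by simp
    next
      assume "t < -1"
      have "Re (\<Sum>x\<in>#B. - inverse (z - x)) > 0"
      proof (rule Re_sum_mset_pos[OF _ Bne])
        fix x assume "x \<in># B"
        then obtain \<theta> where "\<theta> \<in> {0..1}" "x = - of_real \<theta>" using roots by blast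
        then show "Re (- inverse (z - x)) > 0" using inv \<open>t < -1\<close> by simp
      qed
      moreover have "(\<Sum>x\<in>#B. - inverse (z - x)) = - (\<Sum>x\<in>#B. inverse (z - x))"
        by (induction B) auto
      ultimately show False using s by simp
    qed
  qed
  then show ?thesis by (simp add: unit_interval_zeros_def)
qed simp

lemma unit_interval_zeros_higher_pderiv:
  assumes "unit_interval_zeros A"
  shows "(pderiv ^^ n) A = 0 \<or> unit_interval_zeros ((pderiv ^^ n) A)"
  by (induction n) (use assms unit_interval_zeros_pderiv in auto)

lemma unit_interval_zeros_mult:
  assumes "unit_interval_zeros A" "unit_interval_zeros B"
  shows "unit_interval_zeros (A * B)"
  using assms by (auto simp: unit_interval_zeros_def cpoly_mult)

lemma unit_interval_zeros_power: "unit_interval_zeros A \<Longrightarrow> unit_interval_zeros (A ^ n)"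
  by (induction n) (auto simp: unit_interval_zeros_mult, simp add: unit_interval_zeros_def)

definition forward_diff :: "(nat \<Rightarrow> real) \<Rightarrow> nat \<Rightarrow> real" where
  "forward_diff \<gamma> n = poly (reversed_jensen_poly \<gamma> n) (-1)"

lemma falling_factorial_pochhammer: "falling_factorial (k + n) n = pochhammer (real (Suc k)) n"
proof -
  have "pochhammer (real (Suc k)) n = (\<Prod>i=1..n. real (Suc k) + real (n - i))"
    by (rule pochhammer_prod_rev)
  also have "\<dots> = (\<Prod>i<n. real (k + n) - real i)"
    by (rule prod.reindex_bij_witness[of _ Suc "\<lambda>i. i - 1"]) (auto simp: of_nat_diff)
  finally show ?thesis by (simp add: falling_factorial_def)
qed

lemma falling_factorial_eq_0: "N < n \<Longrightarrow> falling_factorial N n = 0"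
  unfolding falling_factorial_def by (rule prod_zero) auto

text \<open>
  This identifies the inner sum of the theorem: up to the factor \<open>(-1)^n / n!\<close>, the transformed sequence is
  encoded by \<open>(1 + y)^n A^(n)(y)\<close>.
\<close>

lemma coeff_linear_power_mult_higher_pderiv:
  "coeff ([:1, 1:] ^ n * (pderiv ^^ n) A) k =
    (\<Sum>j=0..n. real (n choose j) * falling_factorial (k + j) n * coeff A (k + j))"
proof -
  have c: "coeff ([:1, 1::real:] ^ n) l = real (n choose l)" for l
  proof (cases "l \<le> n")
    case False
    then show ?thesis by (simp add: binomial_eq_0 coeff_eq_0 degree_linear_power)
  qed (simp add: coeff_linear_poly_power)
  have "coeff ([:1, 1:] ^ n * (pderiv ^^ n) A) k =
     (\<Sum>l\<le>k. real (n choose l) * (falling_factorial (k - l + n) n * coeff A (k - l + n)))"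
    by (simp only: coeff_mult c coeff_higher_pderiv falling_factorial_pochhammer)
  also have "\<dots> = (\<Sum>l\<in>{..min k n}. real (n choose l) * (falling_factorial (k - l + n) n * coeff A (k - l + n)))"
    by (rule sum.mono_neutral_right) (auto simp: binomial_eq_0)
  also have "\<dots> = (\<Sum>j\<in>{n - k..n}. real (n choose j) * falling_factorial (k + j) n * coeff A (k + j))"
  proof (rule sum.reindex_bij_witness[of _ "\<lambda>j. n - j" "\<lambda>l. n - l"])
    fix l assume l: "l \<in> {..min k n}"
    then have "k + (n - l) = k - l + n" "n choose (n - l) = n choose l"
      using binomial_symmetric[of l n] by auto
    then show "real (n choose (n - l)) * falling_factorial (k + (n - l)) n * coeff A (k + (n - l)) =
      real (n choose l) * (falling_factorial (k - l + n) n * coeff A (k - l + n))" by simp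
  qed auto
  also have "\<dots> = (\<Sum>j=0..n. real (n choose j) * falling_factorial (k + j) n * coeff A (k + j))"
    by (rule sum.mono_neutral_left) (auto simp: falling_factorial_eq_0)
  finally show ?thesis .
qed

theorem laguerre_multiplier_sequence_of_forward_diff_poly:
  assumes "unit_interval_zeros A" "\<And>k. coeff A k = forward_diff \<gamma> k"
  shows "laguerre_multiplier_sequence
    (\<lambda>m. \<Sum>k=0..m. real (m choose k) * ((-1) ^ n / fact n *
        (\<Sum>j=0..n. real (n choose j) * falling_factorial (k + j) n *
                    poly (reversed_jensen_poly \<gamma> (k + j)) (-1))))"
proof -
  define C where "C = smult ((-1) ^ n / fact n) ([:1, 1:] ^ n * (pderiv ^^ n) A)"
  have "unit_interval_zeros [:1, 1:]"
    unfolding unit_interval_zeros_def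
    by (auto simp: cpoly_pCons add_eq_0_iff intro!: bexI[of _ 1])
  then have "unit_interval_zeros ([:1, 1:] ^ n)" by (rule unit_interval_zeros_power)
  then have "(pderiv ^^ n) A = 0 \<or> unit_interval_zeros ([:1, 1:] ^ n * (pderiv ^^ n) A)"
    using unit_interval_zeros_higher_pderiv[OF assms(1)] unit_interval_zeros_mult by blast
  then have "C = 0 \<or> unit_interval_zeros C"
    by (auto simp: C_def unit_interval_zeros_def cpoly_smult)
  then have "laguerre_multiplier_sequence (\<lambda>m. \<Sum>k=0..m. real (m choose k) * coeff C k)"
    by (rule laguerre_multiplier_sequence_of_unit_interval_zeros)
  moreover have "coeff C k = (-1) ^ n / fact n *
        (\<Sum>j=0..n. real (n choose j) * falling_factorial (k + j) n *
                    poly (reversed_jensen_poly \<gamma> (k + j)) (-1))" for k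
    unfolding C_def coeff_smult coeff_linear_power_mult_higher_pderiv assms(2) forward_diff_def ..
  ultimately show ?thesis by (simp only:)
qed

section \<open>Leading coefficients of real-rooted polynomials\<close>

lemma real_rooted_factor:
  assumes "only_real_zeros p" "p \<noteq> 0"
  obtains B :: "real multiset" where "p = smult (lead_coeff p) (\<Prod>x\<in>#B. [:-x, 1:])" "size B = degree p"
proof -
  obtain A where A: "cpoly p = smult (lead_coeff (cpoly p)) (\<Prod>x\<in>#A. [:-x, 1:])" "size A = degree (cpoly p)"
    "\<And>x. x \<in># A \<longleftrightarrow> poly (cpoly p) x = 0"
    using complex_poly_factor[of "cpoly p"] assms(2) by (auto simp: cpoly_eq_0_iff)
  have real: "x = of_real (Re x)" if "x \<in># A" for x
    using that A(3) assms by (auto simp: only_real_zeros_def complex_is_Real_iff complex_eq_iff)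
  have prod: "cpoly (\<Prod>x\<in>#image_mset Re A. [:-x, 1:]) = (\<Prod>x\<in>#A. [:-x, 1:])" if "\<And>x. x \<in># A \<Longrightarrow> x = of_real (Re x)" for A
    using that
  proof (induction A)
    case (add x A)
    have "x = of_real (Re x)" using add.prems by simp
    then have "cpoly [:- Re x, 1:] = [:-x, 1:]" by (simp add: cpoly_pCons)
    then show ?case using add by (simp add: cpoly_mult del: mult_pCons_left)
  qed simp
  have "cpoly (\<Prod>x\<in>#image_mset Re A. [:-x, 1:]) = (\<Prod>x\<in>#A. [:-x, 1:])"
    using prod real by blast
  moreover have "lead_coeff (cpoly p) = of_real (lead_coeff p)" by (simp add: degree_cpoly coeff_map_poly)
  ultimately have "cpoly p = cpoly (smult (lead_coeff p) (\<Prod>x\<in>#image_mset Re A. [:-x, 1:]))"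
    using A(1) by (simp only: cpoly_smult)
  then have "cpoly (p - smult (lead_coeff p) (\<Prod>x\<in>#image_mset Re A. [:-x, 1:])) = 0"
    by (simp add: diff_conv_add_uminus cpoly_add cpoly_minus del: add_uminus_conv_diff)
  then have "p = smult (lead_coeff p) (\<Prod>x\<in>#image_mset Re A. [:-x, 1:])"
    by (simp add: cpoly_eq_0_iff)
  then show thesis using that[of "image_mset Re A"] A(2) by (simp add: degree_cpoly)
qed

lemma coeff_linear_mult_Suc: "coeff ([:-x, 1:] * W) (Suc i) = coeff W i - x * coeff W (Suc i)"
  for x :: "'a::comm_ring_1"
  by simp

lemma coeff_prod_mset_ge_size:
  fixes B :: "'a::comm_ring_1 multiset"
  shows "i \<ge> size B \<Longrightarrow> coeff (\<Prod>x\<in>#B. [:-x, 1:]) i = (if i = size B then 1 else 0)"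
proof (induction B arbitrary: i)
  case (add x B)
  then obtain j where "i = Suc j" "j \<ge> size B" by (cases i) auto
  then show ?case using add.IH[of j] add.IH[of "Suc j"]
    by (simp add: coeff_linear_mult_Suc del: mult_pCons_left)
qed (auto simp: coeff_eq_0)

lemma vieta_sum:
  fixes B :: "'a::comm_ring_1 multiset"
  shows "size B = Suc i \<Longrightarrow> coeff (\<Prod>x\<in>#B. [:-x, 1:]) i = - (\<Sum>x\<in>#B. x)"
proof (induction B arbitrary: i)
  case (add x B)
  have sB: "size B = i" using add.prems by simp
  show ?case
  proof (cases i)
    case 0
    then show ?thesis using sB by simp
  next
    case (Suc j)
    then show ?thesis using sB add.IH[of j]
      by (simp add: coeff_linear_mult_Suc coeff_prod_mset_ge_size del: mult_pCons_left)
  qed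
qed simp

lemma vieta_sum_squares:
  fixes B :: "'a::comm_ring_1 multiset"
  shows "size B = Suc (Suc i) \<Longrightarrow> 2 * coeff (\<Prod>x\<in>#B. [:-x, 1:]) i = (\<Sum>x\<in>#B. x)\<^sup>2 - (\<Sum>x\<in>#B. x\<^sup>2)"
proof (induction B arbitrary: i)
  case (add x B)
  have sB: "size B = Suc i" using add.prems by simp
  show ?case
  proof (cases i)
    case 0
    then obtain y where "B = {#y#}" using sB by (metis One_nat_def size_1_singleton_mset)
    then show ?thesis using 0 by (simp add: power2_eq_square algebra_simps)
  next
    case (Suc j)
    have "2 * coeff ([:-x, 1:] * (\<Prod>x\<in>#B. [:-x, 1:])) (Suc j) =
        2 * coeff (\<Prod>x\<in>#B. [:-x, 1:]) j - 2 * x * coeff (\<Prod>x\<in>#B. [:-x, 1:]) (Suc j)"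
      by (simp only: coeff_linear_mult_Suc) (simp add: algebra_simps)
    then show ?thesis using Suc sB add.IH[of j] vieta_sum[of B i]
      by (simp add: power2_eq_square algebra_simps del: mult_pCons_left)
  qed
qed simp

lemma sum_mset_squares_nonneg: "(\<Sum>x\<in>#B. (x::real)\<^sup>2) \<ge> 0"
  by (induction B) auto

text \<open>
  The three leading coefficients of a real-rooted polynomial determine the sum of the squares of its zeros,
  which is therefore both non-negative and a bound for every zero.
\<close>

lemma real_rooted_top_coeffs:
  assumes "only_real_zeros p" "degree p = Suc (Suc i)"
  obtains B where "p = smult (lead_coeff p) (\<Prod>x\<in>#B. [:-x, 1:])" "size B = Suc (Suc i)"
    "(lead_coeff p)\<^sup>2 * (\<Sum>x\<in>#B. x\<^sup>2) = (coeff p (Suc i))\<^sup>2 - 2 * lead_coeff p * coeff p i"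
    "coeff p (Suc i) = - lead_coeff p * (\<Sum>x\<in>#B. x)"
proof -
  have "p \<noteq> 0" using assms(2) by auto
  then obtain B where B: "p = smult (lead_coeff p) (\<Prod>x\<in>#B. [:-x, 1:])" "size B = degree p"
    using real_rooted_factor assms(1) by blast
  define c where "c = lead_coeff p"
  have 1: "coeff p (Suc i) = - c * (\<Sum>x\<in>#B. x)"
    by (subst B(1)[folded c_def]) (simp add: vieta_sum B(2) assms(2))
  have "2 * coeff p i = c * (2 * coeff (\<Prod>x\<in>#B. [:-x, 1:]) i)"
    by (subst B(1)[folded c_def]) simp
  then have 2: "2 * coeff p i = c * ((\<Sum>x\<in>#B. x)\<^sup>2 - (\<Sum>x\<in>#B. x\<^sup>2))"
    by (simp only: vieta_sum_squares[OF B(2)[unfolded assms(2)]])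
  have "c * (2 * coeff p i) = c\<^sup>2 * (\<Sum>x\<in>#B. x)\<^sup>2 - c\<^sup>2 * (\<Sum>x\<in>#B. x\<^sup>2)"
    unfolding 2 by (simp add: power2_eq_square algebra_simps)
  then have "c\<^sup>2 * (\<Sum>x\<in>#B. x\<^sup>2) = (coeff p (Suc i))\<^sup>2 - 2 * c * coeff p i"
    unfolding 1 by (simp add: power2_eq_square algebra_simps)
  then show thesis using that[of B] B assms(2) 1 by (simp add: c_def)
qed

lemma real_rooted_newton_top:
  assumes "only_real_zeros p" "degree p \<le> Suc (Suc i)"
  shows "2 * coeff p (Suc (Suc i)) * coeff p i \<le> (coeff p (Suc i))\<^sup>2"
proof (cases "degree p = Suc (Suc i)")
  case True
  obtain B where "(lead_coeff p)\<^sup>2 * (\<Sum>x\<in>#B. x\<^sup>2) = (coeff p (Suc i))\<^sup>2 - 2 * lead_coeff p * coeff p i"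
    using real_rooted_top_coeffs[OF assms(1) True] by metis
  moreover have "(lead_coeff p)\<^sup>2 * (\<Sum>x\<in>#B. x\<^sup>2) \<ge> 0"
    by (simp add: sum_mset_squares_nonneg)
  ultimately show ?thesis using True by simp
next
  case False
  then show ?thesis using assms(2) by (simp add: coeff_eq_0)
qed

section \<open>Quadratic multiples of Laguerre polynomials\<close>

text \<open>The factor that Newton's inequality produces for the Laguerre coefficients below; it depends on \<open>m\<close> only.\<close>

definition gap_bound :: "nat \<Rightarrow> real" where
  "gap_bound m = (real m + 2)\<^sup>2 * fact (m + 2) * fact m / (2 * (fact (m + 1))\<^sup>2)"

text \<open>
  Newton's inequality for the three leading coefficients, in the Laguerre basis. With no term \<open>L_(m + 1)\<close>, the
  second coefficient is proportional to \<open>a\<close>, so \<open>b\<close> cannot be large with the sign of \<open>a\<close>.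
\<close>

lemma laguerre_gap_newton:
  assumes rr: "only_real_zeros (smult a (laguerre_poly (m + 2)) + smult b (laguerre_poly m) + r)"
    and r: "\<And>i. i \<ge> m \<Longrightarrow> coeff r i = 0"
  shows "a * b \<le> gap_bound m * a\<^sup>2"
proof -
  let ?p = "smult a (laguerre_poly (m + 2)) + smult b (laguerre_poly m) + r"
  have deg: "degree ?p \<le> Suc (Suc m)"
    by (rule degree_le) (simp add: coeff_laguerre_poly r binomial_eq_0)
  have c2: "coeff ?p (Suc (Suc m)) = a * ((-1) ^ m / fact (m + 2))"
    by (simp add: coeff_laguerre_poly r)
  have c1: "coeff ?p (Suc m) = - (a * ((-1) ^ m * (real m + 2) / fact (m + 1)))"
  proof -
    have "(m + 2) choose (Suc m) = m + 2" by (metis add_2_eq_Suc' binomial_Suc_n)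
    then show ?thesis by (simp add: coeff_laguerre_poly r binomial_eq_0 del: binomial_Suc_Suc)
  qed
  have c0: "coeff ?p m = (a * real ((m + 2) choose m) + b) * ((-1) ^ m / fact m)"
    by (simp add: coeff_laguerre_poly r algebra_simps)
  have s: "((-1::real) ^ m) * (-1) ^ m = 1" by (simp flip: power_add)
  have N: "2 * coeff ?p (Suc (Suc m)) * coeff ?p m \<le> (coeff ?p (Suc m))\<^sup>2"
    by (rule real_rooted_newton_top[OF rr deg])
  have e1: "2 * (a * ((-1) ^ m / fact (m + 2))) * ((a * real ((m + 2) choose m) + b) * ((-1) ^ m / fact m))
     = (((-1) ^ m) * (-1) ^ m) * (2 * a * (a * real ((m + 2) choose m) + b) / (fact (m + 2) * fact m))"
    by (simp add: field_simps)
  have e2: "(- (a * ((-1) ^ m * (real m + 2) / fact (m + 1))))\<^sup>2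
     = (((-1) ^ m) * (-1) ^ m) * (a\<^sup>2 * (real m + 2)\<^sup>2 / (fact (m + 1))\<^sup>2)"
    by (simp add: power2_eq_square)
  have "2 * a * (a * real ((m + 2) choose m) + b) / (fact (m + 2) * fact m) \<le> a\<^sup>2 * (real m + 2)\<^sup>2 / (fact (m + 1))\<^sup>2"
    using N unfolding c2 c1 c0 e1 e2 s mult_1 .
  then have "2 * a * (a * real ((m + 2) choose m) + b) \<le> a\<^sup>2 * (real m + 2)\<^sup>2 / (fact (m + 1))\<^sup>2 * (fact (m + 2) * fact m)"
    by (simp only: divide_le_eq) simp
  also have "\<dots> = 2 * (gap_bound m * a\<^sup>2)" by (simp add: gap_bound_def)
  finally have "a * (a * real ((m + 2) choose m)) + a * b \<le> gap_bound m * a\<^sup>2"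
    by (simp add: algebra_simps)
  moreover have "a * (a * real ((m + 2) choose m)) \<ge> 0" by (simp flip: mult.assoc)
  ultimately show ?thesis by linarith
qed

lemma binomial_absorb_Suc: "real (Suc j) * real (m choose Suc j) = (real m - real j) * real (m choose j)"
proof (cases "j \<le> m")
  case True
  have "Suc j * (m choose Suc j) = (m - j) * (m choose j)"
    by (metis binomial_absorb_comp binomial_absorption diff_Suc_1 mult.commute binomial_eq_0 Suc_times_binomial_add)
  then have "real (Suc j * (m choose Suc j)) = real ((m - j) * (m choose j))" by (rule arg_cong)
  then show ?thesis by (simp only: of_nat_mult of_nat_diff[OF True])
qed (simp add: binomial_eq_0)

lemma binomial_absorb_pred: "real m * real ((m - 1) choose j) = (real m - real j) * real (m choose j)"
proof (cases "j \<le> m")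
  case True
  have "real ((m - j) * (m choose j)) = real (m * ((m - 1) choose j))"
    by (metis binomial_absorb_comp)
  then show ?thesis by (simp only: of_nat_mult of_nat_diff[OF True])
qed (simp add: binomial_eq_0)

text \<open>The three-term recurrence. For \<open>m = 0\<close> the last term has coefficient zero.\<close>

lemma mult_x_laguerre_poly:
  "pCons 0 (laguerre_poly m) = smult (- (real m + 1)) (laguerre_poly (m + 1)) + smult (2 * real m + 1) (laguerre_poly m)
     - smult (real m) (laguerre_poly (m - 1))"
proof (rule poly_eqI)
  fix i
  show "coeff (pCons 0 (laguerre_poly m)) i = coeff (smult (- (real m + 1)) (laguerre_poly (m + 1))
     + smult (2 * real m + 1) (laguerre_poly m) - smult (real m) (laguerre_poly (m - 1))) i"
  proof (cases i)
    case 0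
    then show ?thesis by (simp add: coeff_laguerre_poly)
  next
    case (Suc j)
    note a = binomial_absorb_pred[of m "Suc j"]
    note b = binomial_absorb_Suc[of j m]
    have c: "real ((m + 1) choose Suc j) = real (m choose Suc j) + real (m choose j)" by simp
    have main: "- real (Suc j) * real (m choose j) = - (real m + 1) * real ((m + 1) choose Suc j)
       + (2 * real m + 1) * real (m choose Suc j) - real m * real ((m - 1) choose Suc j)"
      unfolding a c using b by (simp add: algebra_simps)
    have f: "(-1) ^ j / fact j = ((-1) ^ Suc j / fact (Suc j) :: real) * (- real (Suc j))"
      by (simp add: field_simps del: of_nat_Suc)
    have "coeff (pCons 0 (laguerre_poly m)) i = ((-1) ^ Suc j / fact (Suc j)) * (- real (Suc j) * real (m choose j))"
      by (simp only: Suc coeff_pCons_Suc coeff_laguerre_poly f mult.assoc)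
    also have "\<dots> = coeff (smult (- (real m + 1)) (laguerre_poly (m + 1))
     + smult (2 * real m + 1) (laguerre_poly m) - smult (real m) (laguerre_poly (m - 1))) i"
      unfolding main Suc by (simp only: coeff_add coeff_diff coeff_smult coeff_laguerre_poly) (simp only: algebra_simps)
    finally show ?thesis .
  qed
qed

text \<open>
  The recurrence applied twice. An operator that is diagonal on the Laguerre polynomials multiplies the
  terms on the right by numbers, while the left-hand side is real-rooted as soon as \<open>4 g \<le> e\<^sup>2\<close>.
\<close>

lemma quadratic_mult_laguerre_poly:
  "[:g, -e, 1:] * laguerre_poly K =
     smult ((real K + 1) * (real K + 2)) (laguerre_poly (K + 2))
     + smult ((real K + 1) * (e - 4 * real K - 4)) (laguerre_poly (K + 1))
     + smult (6 * (real K)\<^sup>2 + 6 * real K + 2 - e * (2 * real K + 1) + g) (laguerre_poly K)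
     + smult (real K * (e - 4 * real K)) (laguerre_poly (K - 1))
     + smult (real K * (real K - 1)) (laguerre_poly (K - 2))"
proof -
  have q: "[:g, -e, 1:] * p = smult g p - smult e (pCons 0 p) + pCons 0 (pCons 0 p)" for p :: "real poly"
    by simp
  have X: "pCons 0 (smult c p + smult d q - smult f s) = smult c (pCons 0 p) + smult d (pCons 0 q) - smult f (pCons 0 s)"
    for c d f :: real and p q s by simp
  have K1: "smult (real K) (pCons 0 (laguerre_poly (K - 1))) = smult (real K) (smult (- real K) (laguerre_poly K)
     + smult (2 * real K - 1) (laguerre_poly (K - 1)) - smult (real K - 1) (laguerre_poly (K - 2)))"
  proof (cases "K = 0")
    case False
    then have c: "real (K - 1) = real K - 1" "K - 1 + 1 = K" "K - 1 - 1 = K - 2"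
      "- (real K - 1 + 1) = - real K" "2 * (real K - 1) + 1 = 2 * real K - 1" by simp_all
    show ?thesis using mult_x_laguerre_poly[of "K - 1"] unfolding c by simp
  qed simp
  have xx: "pCons 0 (pCons 0 (laguerre_poly K)) = smult (- (real K + 1)) (pCons 0 (laguerre_poly (K + 1)))
     + smult (2 * real K + 1) (pCons 0 (laguerre_poly K)) - smult (real K) (pCons 0 (laguerre_poly (K - 1)))"
    by (subst mult_x_laguerre_poly) (rule X)
  have K2: "pCons 0 (laguerre_poly (K + 1)) = smult (- (real K + 2)) (laguerre_poly (K + 2))
     + smult (2 * real K + 3) (laguerre_poly (K + 1)) - smult (real K + 1) (laguerre_poly K)"
    using mult_x_laguerre_poly[of "K + 1"] by (simp add: add_ac)
  show ?thesis
    unfolding q xx unfolding K1 K2 mult_x_laguerre_poly[of K]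
    by (rule poly_eqI) (simp add: algebra_simps power2_eq_square)
qed

lemma only_real_zeros_quadratic_mult:
  assumes "4 * g \<le> e\<^sup>2" "only_real_zeros p"
  shows "only_real_zeros ([:g, -e, 1:] * p)"
proof -
  have "upper_free (cpoly [:g, -e, 1:])"
    unfolding upper_free_def
  proof (intro allI impI notI)
    fix z assume z: "Im z > 0" and "poly (cpoly [:g, -e, 1:]) z = 0"
    then have q: "of_real g - of_real e * z + z * z = 0" by (simp add: cpoly_pCons algebra_simps)
    then have "Im (of_real g - of_real e * z + z * z) = 0" "Re (of_real g - of_real e * z + z * z) = 0" by simp_all
    then have "Im z * (2 * Re z - e) = 0" and re: "g - e * Re z + (Re z * Re z - Im z * Im z) = 0"
      by (simp_all add: algebra_simps)
    then have "e = 2 * Re z" using z by simp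
    then have "g - (Re z)\<^sup>2 - (Im z)\<^sup>2 = 0" "g \<le> (Re z)\<^sup>2"
      using re assms(1) by (simp_all add: power2_eq_square algebra_simps)
    then show False using z by (smt (verit) zero_less_power)
  qed
  then show ?thesis using assms(2) by (auto simp: only_real_zeros_iff cpoly_mult upper_free_def simp del: mult_pCons_left)
qed

lemma only_real_zeros_laguerre_poly: "only_real_zeros (laguerre_poly n)"
  by (simp add: only_real_zeros_iff upper_free_laguerre_poly)

section \<open>The support and the signs of a multiplier sequence\<close>

lemma monom_laguerre_expansion:
  "monom 1 k = smult (fact k) (\<Sum>m\<le>k. smult ((-1) ^ m * real (k choose m)) (laguerre_poly m))"
proof (rule poly_eqI)
  fix i
  have "coeff (smult (fact k) (\<Sum>m\<le>k. smult ((-1) ^ m * real (k choose m)) (laguerre_poly m))) i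
    = fact k * (-1) ^ i / fact i * (\<Sum>m\<le>k. (-1) ^ m * real (k choose m) * real (m choose i))"
    by (simp add: coeff_sum coeff_laguerre_poly sum_distrib_left mult_ac)
  also have "(\<Sum>m\<le>k. (-1) ^ m * real (k choose m) * real (m choose i)) = (if i = k then (-1) ^ k else 0)"
  proof (cases "i \<le> k")
    case True
    have "(\<Sum>m\<le>k. (-1) ^ m * real (k choose m) * real (m choose i)) =
       (\<Sum>m\<in>{i..k}. (-1) ^ m * real (k choose m) * real (m choose i))"
      by (rule sum.mono_neutral_right) auto
    also have "\<dots> = (\<Sum>l\<le>k - i. (-1) ^ (l + i) * (real (k choose i) * real ((k - i) choose l)))"
    proof (rule sum.reindex_bij_witness[of _ "\<lambda>l. l + i" "\<lambda>m. m - i"])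
      fix m assume m: "m \<in> {i..k}"
      have "(k choose m) * (m choose i) = (k choose i) * ((k - i) choose (m - i))"
        using choose_mult[of i m k] m by simp
      then have "real ((k choose m) * (m choose i)) = real ((k choose i) * ((k - i) choose (m - i)))" by simp
      then show "(-1) ^ (m - i + i) * (real (k choose i) * real ((k - i) choose (m - i))) = (-1) ^ m * real (k choose m) * real (m choose i)"
        using m by simp
    qed (use True in auto)
    also have "\<dots> = (-1) ^ i * real (k choose i) * (\<Sum>l\<le>k - i. (-1) ^ l * real ((k - i) choose l))"
      by (simp add: sum_distrib_left power_add mult_ac)
    also have "(\<Sum>l\<le>k - i. (-1) ^ l * real ((k - i) choose l)) = (if i = k then 1 else 0)"
      using True choose_alternating_sum[of "k - i", where 'a = real] by auto
    finally show ?thesis by simp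
  next
    case False
    then have "(\<Sum>m\<le>k. (-1) ^ m * real (k choose m) * real (m choose i)) = 0"
      by (intro sum.neutral) (auto simp: binomial_eq_0)
    then show ?thesis using False by simp
  qed
  also have "fact k * (-1) ^ i / fact i * (if i = k then (-1) ^ k else 0) = coeff (monom 1 k :: real poly) i"
    by (simp flip: power_add)
  finally show "coeff (monom 1 k) i = coeff (smult (fact k) (\<Sum>m\<le>k. smult ((-1) ^ m * real (k choose m)) (laguerre_poly m))) i" ..
qed

text \<open>
  An operator witnessing that \<open>\<gamma>\<close> is a Laguerre multiplier sequence.
\<close>

locale laguerre_multiplier =
  fixes T :: "real poly \<Rightarrow> real poly" and \<gamma> :: "nat \<Rightarrow> real"
  assumes hyp: "hyperbolicity_preserving T"
    and eigen: "\<And>n. T (laguerre_poly n) = smult (\<gamma> n) (laguerre_poly n)"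
begin

lemma T_add: "T (p + q) = T p + T q" and T_smult: "T (smult c p) = smult c (T p)"
  using hyp by (auto simp: hyperbolicity_preserving_def linear_smult_iff)

lemma T_0 [simp]: "T 0 = 0" using T_smult[of 0 0] by simp

lemma T_sum: "T (\<Sum>i\<in>I. f i) = (\<Sum>i\<in>I. T (f i))"
  by (induction I rule: infinite_finite_induct) (auto simp: T_add)

lemma T_real: "only_real_zeros p \<Longrightarrow> only_real_zeros (T p)"
  using hyp by (auto simp: hyperbolicity_preserving_def)

definition monom_image :: "nat \<Rightarrow> real poly" where "monom_image k = T (monom 1 k)"

lemma monom_image_eq: "monom_image k = smult (fact k) (\<Sum>m\<le>k. smult ((-1) ^ m * real (k choose m) * \<gamma> m) (laguerre_poly m))"
  unfolding monom_image_def by (subst monom_laguerre_expansion) (simp add: T_smult T_sum eigen)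

lemma T_eq_sum:
  assumes "degree p \<le> n" shows "T p = (\<Sum>k\<le>n. smult (coeff p k) (monom_image k))"
proof -
  have "p = (\<Sum>k\<le>n. smult (coeff p k) (monom 1 k))"
    using poly_as_sum_of_monoms'[OF assms] by (simp add: smult_monom)
  then have "T p = T (\<Sum>k\<le>n. smult (coeff p k) (monom 1 k))" by simp
  then show ?thesis by (simp only: T_sum T_smult monom_image_def)
qed

lemma coeff_monom_image_eq_0: "i > k \<Longrightarrow> coeff (monom_image k) i = 0"
  by (auto simp: monom_image_eq coeff_sum coeff_laguerre_poly binomial_eq_0 intro!: sum.neutral)

lemma coeff_monom_image_lead: "coeff (monom_image k) k = \<gamma> k"
proof -
  have "(\<Sum>m\<le>k. (-1) ^ m * real (k choose m) * \<gamma> m * ((-1) ^ k / fact k * real (m choose k)))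
     = (\<Sum>m\<in>{k}. (-1) ^ m * real (k choose m) * \<gamma> m * ((-1) ^ k / fact k * real (m choose k)))"
    by (rule sum.mono_neutral_right) auto
  also have "\<dots> = \<gamma> k / fact k" by (simp flip: power_add mult.assoc)
  finally show ?thesis by (simp add: monom_image_eq coeff_sum coeff_laguerre_poly)
qed

text \<open>
  The image of a real-rooted quadratic multiple of \<open>L_K\<close>. The parameter \<open>\<nu>\<close> replaces \<open>g\<close>; for any given
  \<open>e\<close> it may be an arbitrary number below a positive bound.
\<close>

lemma quadratic_test:
  assumes "4 * \<nu> \<le> (e - 2 * (2 * real K + 1))\<^sup>2 + 8 * (real K)\<^sup>2 + 8 * real K + 4"
  shows "only_real_zeros (smult (\<gamma> (K + 2) * ((real K + 1) * (real K + 2))) (laguerre_poly (K + 2))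
     + smult (\<gamma> (K + 1) * ((real K + 1) * (e - 4 * real K - 4))) (laguerre_poly (K + 1))
     + smult (\<gamma> K * \<nu>) (laguerre_poly K)
     + smult (\<gamma> (K - 1) * (real K * (e - 4 * real K))) (laguerre_poly (K - 1))
     + smult (\<gamma> (K - 2) * (real K * (real K - 1))) (laguerre_poly (K - 2)))"
proof -
  define g where "g = \<nu> - (6 * (real K)\<^sup>2 + 6 * real K + 2) + e * (2 * real K + 1)"
  have nu: "6 * (real K)\<^sup>2 + 6 * real K + 2 - e * (2 * real K + 1) + g = \<nu>" by (simp add: g_def)
  have "4 * g \<le> e\<^sup>2" using assms by (simp add: g_def power2_eq_square algebra_simps)
  then have "only_real_zeros (T ([:g, -e, 1:] * laguerre_poly K))"
    using T_real only_real_zeros_quadratic_mult only_real_zeros_laguerre_poly by blast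
  then show ?thesis
    unfolding quadratic_mult_laguerre_poly nu by (simp add: T_add T_smult eigen mult.commute)
qed

text \<open>For \<open>e = 4 K + 4\<close> the term with \<open>L_(K + 1)\<close> vanishes while \<open>\<nu>\<close> may tend to \<open>-\<infinity>\<close>.\<close>

lemma gamma_step_two_nonneg: "\<gamma> K * \<gamma> (K + 2) \<ge> 0"
proof (rule ccontr)
  assume "\<not> ?thesis"
  then have neg: "\<gamma> K * \<gamma> (K + 2) < 0" by simp
  define k where "k = (real K + 1) * (real K + 2)"
  have k: "k > 0" by (simp add: k_def)
  let ?a = "\<gamma> (K + 2) * k"
  have "?a * (\<gamma> K * \<nu>) \<le> gap_bound K * ?a\<^sup>2" if "\<nu> \<le> 0" for \<nu>
  proof (rule laguerre_gap_newton)
    have "4 * \<nu> \<le> (4 * real K + 4 - 2 * (2 * real K + 1))\<^sup>2 + 8 * (real K)\<^sup>2 + 8 * real K + 4"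
    proof -
      have "0 \<le> 8 * (real K)\<^sup>2 + 8 * real K" by simp
      moreover have "(4 * real K + 4 - 2 * (2 * real K + 1))\<^sup>2 = 4" by simp
      ultimately show ?thesis using that by linarith
    qed
    from quadratic_test[OF this]
    show "only_real_zeros (smult ?a (laguerre_poly (K + 2)) + smult (\<gamma> K * \<nu>) (laguerre_poly K)
      + (smult (\<gamma> (K - 1) * (real K * 4)) (laguerre_poly (K - 1))
         + smult (\<gamma> (K - 2) * (real K * (real K - 1))) (laguerre_poly (K - 2))))"
      by (simp add: k_def add.assoc)
  next
    fix i assume "i \<ge> K"
    then show "coeff (smult (\<gamma> (K - 1) * (real K * 4)) (laguerre_poly (K - 1))
         + smult (\<gamma> (K - 2) * (real K * (real K - 1))) (laguerre_poly (K - 2))) i = 0"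
      by (cases "K = 0") (auto simp: coeff_laguerre_poly binomial_eq_0)
  qed
  then have le: "?a * \<gamma> K * \<nu> \<le> gap_bound K * ?a\<^sup>2" if "\<nu> \<le> 0" for \<nu>
    using that by (simp only: mult.assoc)
  have p: "?a * \<gamma> K < 0" using neg k by (metis mult.assoc mult.commute mult_neg_pos)
  have b: "gap_bound K * ?a\<^sup>2 \<ge> 0" by (simp add: gap_bound_def)
  have "(gap_bound K * ?a\<^sup>2 + 1) / (?a * \<gamma> K) \<le> 0" using p b by (intro divide_nonneg_neg) auto
  from le[OF this] have "?a * \<gamma> K * ((gap_bound K * ?a\<^sup>2 + 1) / (?a * \<gamma> K)) \<le> gap_bound K * ?a\<^sup>2" .
  moreover have "x * (y / x) = y" if "x \<noteq> 0" for x y :: real using that by simp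
  ultimately show False using p by (metis less_irrefl add_le_same_cancel1 not_one_le_zero)
qed

text \<open>
  Now the term with \<open>L_(K + 1)\<close> vanishes for every \<open>e\<close>, and a large \<open>e\<close> allows a large positive \<open>\<nu>\<close>.
\<close>

lemma gamma_no_single_gap:
  assumes "\<gamma> (K + 1) = 0"
  shows "\<gamma> K * \<gamma> (K + 2) = 0"
proof (rule ccontr)
  assume "\<not> ?thesis"
  then have pos: "\<gamma> K * \<gamma> (K + 2) > 0" using gamma_step_two_nonneg[of K] by linarith
  define k where "k = (real K + 1) * (real K + 2)"
  have k: "k > 0" by (simp add: k_def)
  let ?a = "\<gamma> (K + 2) * k"
  have le: "?a * (\<gamma> K * \<nu>) \<le> gap_bound K * ?a\<^sup>2" if "\<nu> \<ge> 0" for \<nu>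
  proof (rule laguerre_gap_newton)
    \<comment> \<open>The square of \<open>2 + \<nu>\<close> exceeds \<open>4 \<nu>\<close>, as the test requires.\<close>
    define e where "e = 2 * (2 * real K + 1) + (2 + \<nu>)"
    have "0 \<le> 8 * (real K)\<^sup>2 + 8 * real K" by simp
    moreover have "4 * \<nu> \<le> (2 + \<nu>)\<^sup>2 + 4" using zero_le_power2[of \<nu>] by (simp add: power2_sum)
    moreover have "(e - 2 * (2 * real K + 1))\<^sup>2 = (2 + \<nu>)\<^sup>2" by (simp add: e_def)
    ultimately have "4 * \<nu> \<le> (e - 2 * (2 * real K + 1))\<^sup>2 + 8 * (real K)\<^sup>2 + 8 * real K + 4" by linarith
    from quadratic_test[OF this]
    show "only_real_zeros (smult ?a (laguerre_poly (K + 2)) + smult (\<gamma> K * \<nu>) (laguerre_poly K)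
      + (smult (\<gamma> (K - 1) * (real K * (e - 4 * real K))) (laguerre_poly (K - 1))
         + smult (\<gamma> (K - 2) * (real K * (real K - 1))) (laguerre_poly (K - 2))))"
      using assms by (simp add: k_def add.assoc)
    fix i assume "i \<ge> K"
    then show "coeff (smult (\<gamma> (K - 1) * (real K * (e - 4 * real K))) (laguerre_poly (K - 1))
         + smult (\<gamma> (K - 2) * (real K * (real K - 1))) (laguerre_poly (K - 2))) i = 0"
      by (cases "K = 0") (auto simp: coeff_laguerre_poly binomial_eq_0)
  qed
  have p: "?a * \<gamma> K > 0" using pos k by (simp add: mult_ac zero_less_mult_iff)
  have b: "gap_bound K * ?a\<^sup>2 \<ge> 0" by (simp add: gap_bound_def)
  have "(gap_bound K * ?a\<^sup>2 + 1) / (?a * \<gamma> K) \<ge> 0" using p b by (intro divide_nonneg_pos) auto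
  from le[OF this] have "?a * \<gamma> K * ((gap_bound K * ?a\<^sup>2 + 1) / (?a * \<gamma> K)) \<le> gap_bound K * ?a\<^sup>2"
    by (simp only: mult.assoc)
  moreover have "x * (y / x) = y" if "x \<noteq> 0" for x y :: real using that by simp
  ultimately show False using p by (metis less_irrefl add_le_same_cancel1 not_one_le_zero)
qed

text \<open>
  If the two values above \<open>K + 2\<close> vanish, then \<open>L_(K + 2)\<close> is the leading term of the image. Its coefficient is
  proportional to \<open>\<nu>\<close> and may tend to \<open>0\<close> through positive values, while the coefficient of \<open>L_K\<close> stays
  fixed. This is what excludes a finite support of more than two elements.
\<close>

lemma gamma_top_of_support:
  assumes "\<gamma> (K + 3) = 0" "\<gamma> (K + 4) = 0" "\<gamma> (K + 2) \<noteq> 0"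
  shows "\<gamma> K = 0"
proof (rule ccontr)
  assume "\<gamma> K \<noteq> 0"
  then have "\<gamma> K * \<gamma> (K + 2) \<noteq> 0" using assms by simp
  then have pos: "\<gamma> K * \<gamma> (K + 2) > 0" using gamma_step_two_nonneg[of K] by linarith
  define k where "k = (real K + 1) * (real K + 2)"
  have k: "k > 0" by (simp add: k_def)
  have le: "(\<gamma> (K + 2) * \<nu>) * (\<gamma> K * k) \<le> gap_bound K * (\<gamma> (K + 2) * \<nu>)\<^sup>2" if "\<nu> \<le> 1" for \<nu>
  proof (rule laguerre_gap_newton[where r = 0])
    have "0 \<le> 8 * (real (K + 2))\<^sup>2 + 8 * real (K + 2)" by simp
    moreover have "(4 * real (K + 2) - 2 * (2 * real (K + 2) + 1))\<^sup>2 = 4" by simp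
    ultimately have "4 * \<nu> \<le> (4 * real (K + 2) - 2 * (2 * real (K + 2) + 1))\<^sup>2 + 8 * (real (K + 2))\<^sup>2 + 8 * real (K + 2) + 4"
      using that by linarith
    from quadratic_test[OF this]
    show "only_real_zeros (smult (\<gamma> (K + 2) * \<nu>) (laguerre_poly (K + 2)) + smult (\<gamma> K * k) (laguerre_poly K) + 0)"
      using assms by (simp add: k_def numeral_eq_Suc mult_ac add_ac)
  qed auto
  define d where "d = gap_bound K * (\<gamma> (K + 2))\<^sup>2"
  define e where "e = \<gamma> (K + 2) * (\<gamma> K * k)"
  have e: "e > 0" using pos k by (simp add: e_def mult_ac zero_less_mult_iff)
  have d: "d \<ge> 0" by (simp add: d_def gap_bound_def)
  \<comment> \<open>The inequality reads \<open>\<nu> e \<le> d \<nu>\<^sup>2\<close> and fails for small positive \<open>\<nu>\<close>.\<close>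
  define \<nu> where "\<nu> = min 1 (e / (2 * (d + 1)))"
  have nu: "\<nu> > 0" "\<nu> \<le> 1" using e d by (auto simp: \<nu>_def)
  have "\<nu> * e \<le> \<nu> * (d * \<nu>)" using le[OF nu(2)] by (simp add: d_def e_def power2_eq_square mult_ac)
  then have "e \<le> d * \<nu>" using nu(1) by simp
  also have "\<dots> \<le> (d + 1) * (e / (2 * (d + 1)))" using d nu(1) by (intro mult_mono) (auto simp: \<nu>_def)
  also have "\<dots> = e / 2" using d by (simp add: field_simps)
  finally show False using e by simp
qed

lemma abs_prod_mset_le:
  assumes "\<And>x. x \<in># B \<Longrightarrow> \<bar>x\<bar> \<le> r"
  shows "\<bar>\<Prod>x\<in>#B. (t - x :: real)\<bar> \<le> (\<bar>t\<bar> + r) ^ size B"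
  using assms
proof (induction B)
  case (add x B)
  have "\<bar>t - x\<bar> \<le> \<bar>t\<bar> + r" using add.prems[of x] by simp
  then show ?case using add by (auto simp: abs_mult intro!: mult_mono)
qed simp

text \<open>
  Two vanishing values below \<open>n + 2\<close> make the three leading coefficients of the image of
  \<open>x^(n + 2) + N x^(n + 1)\<close> independent of \<open>N\<close>. Hence its zeros are bounded uniformly in \<open>N\<close>, which
  is possible only if the image of \<open>x^(n + 1)\<close> is zero.
\<close>

lemma gamma_no_double_gap:
  assumes "\<gamma> (n + 2) \<noteq> 0" "\<gamma> (n + 1) = 0" "\<gamma> n = 0" "j \<le> n"
  shows "\<gamma> j = 0"
proof -
  have Uz: "coeff (monom_image (n + 1)) i = 0" if "i \<ge> n" for i
    using that assms by (auto simp: monom_image_eq coeff_sum coeff_laguerre_poly binomial_eq_0 le_Suc_eq intro!: sum.neutral)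
      (metis le_antisym le_eq_less_or_eq less_imp_le binomial_eq_0 of_nat_0 order_trans)
  have U0: "monom_image (n + 1) = 0"
  proof (rule ccontr)
    assume "monom_image (n + 1) \<noteq> 0"
    then obtain t where t: "poly (monom_image (n + 1)) t \<noteq> 0" using poly_all_0_iff_0 by blast
    define c where "c = coeff (monom_image (n + 2)) (n + 2)"
    have c: "c \<noteq> 0" using assms(1) by (simp add: c_def coeff_monom_image_lead)
    define S where "S = ((coeff (monom_image (n + 2)) (Suc n))\<^sup>2 - 2 * c * coeff (monom_image (n + 2)) n) / c\<^sup>2"
    define R where "R = \<bar>c\<bar> * (\<bar>t\<bar> + sqrt S) ^ (n + 2)"
    have "\<bar>poly (monom_image (n + 2)) t + N * poly (monom_image (n + 1)) t\<bar> \<le> R" for N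
    proof -
      define f where "f = monom_image (n + 2) + smult N (monom_image (n + 1))"
      have "only_real_zeros ([:0, 1:] ^ (n + 1) * [:N, 1:])"
      proof -
        have "z \<noteq> 0" "of_real N + z \<noteq> 0" if "Im z > 0" for z
          using that by (auto simp: complex_eq_iff)
        then show ?thesis
          by (auto simp: only_real_zeros_iff upper_free_def cpoly_mult cpoly_power cpoly_pCons
              simp del: mult_pCons_left mult_pCons_right)
      qed
      moreover have "[:0, 1:] ^ (n + 1) * [:N, 1:] = monom 1 (n + 2) + smult N (monom 1 (n + 1))"
        by (simp add: monom_altdef)
      ultimately have rr: "only_real_zeros f"
        using T_real[of "monom 1 (n + 2) + smult N (monom 1 (n + 1))"] by (simp add: f_def monom_image_def T_add T_smult)
      have cf: "coeff f (Suc (Suc n)) = c" "coeff f (Suc n) = coeff (monom_image (n + 2)) (Suc n)" "coeff f n = coeff (monom_image (n + 2)) n"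
        using Uz[of "Suc (Suc n)"] Uz[of "Suc n"] Uz[of n] by (simp_all add: f_def c_def)
      have "degree f \<le> Suc (Suc n)"
        by (rule degree_le) (simp add: f_def coeff_monom_image_eq_0)
      then have deg: "degree f = Suc (Suc n)" using c cf(1) by (metis le_antisym le_degree)
      then have lc: "lead_coeff f = c" using cf by simp
      obtain B where B: "f = smult (lead_coeff f) (\<Prod>x\<in>#B. [:-x, 1:])" "size B = Suc (Suc n)"
        "(lead_coeff f)\<^sup>2 * (\<Sum>x\<in>#B. x\<^sup>2) = (coeff f (Suc n))\<^sup>2 - 2 * lead_coeff f * coeff f n"
        using real_rooted_top_coeffs[OF rr deg] by blast
      have S: "(\<Sum>x\<in>#B. x\<^sup>2) = S" using B(3) c unfolding lc cf by (simp add: S_def field_simps)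
      have "\<bar>x\<bar> \<le> sqrt S" if xB: "x \<in># B" for x
      proof -
        have "x\<^sup>2 \<le> (\<Sum>x\<in>#B. x\<^sup>2)"
        proof -
          obtain C where "B = add_mset x C" using multi_member_split[OF xB] by blast
          then show ?thesis using sum_mset_squares_nonneg[of C] by simp
        qed
        then show ?thesis unfolding S using real_le_rsqrt[of "\<bar>x\<bar>" S] by simp
      qed
      then have "\<bar>\<Prod>x\<in>#B. t - x\<bar> \<le> (\<bar>t\<bar> + sqrt S) ^ size B" by (rule abs_prod_mset_le)
      moreover have "poly f t = c * (\<Prod>x\<in>#B. t - x)"
        by (subst B(1)) (simp add: lc poly_prod_mset image_mset.compositionality o_def)
      ultimately have "\<bar>poly f t\<bar> \<le> R"
        using B(2) by (simp add: R_def abs_mult mult_left_mono)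
      then show ?thesis by (simp add: f_def)
    qed
    \<comment> \<open>Choose \<open>N\<close> so that the left-hand side is \<open>R + 1\<close>.\<close>
    from this[of "(R + 1 - poly (monom_image (n + 2)) t) / poly (monom_image (n + 1)) t"] show False using t by simp
  qed
  show ?thesis
  proof (rule ccontr)
    assume "\<gamma> j \<noteq> 0"
    define i where "i = Max {j. j \<le> n + 1 \<and> \<gamma> j \<noteq> 0}"
    have fin: "finite {j. j \<le> n + 1 \<and> \<gamma> j \<noteq> 0}" by simp
    have "i \<in> {j. j \<le> n + 1 \<and> \<gamma> j \<noteq> 0}"
      unfolding i_def by (rule Max_in[OF fin]) (use \<open>\<gamma> j \<noteq> 0\<close> assms(4) in \<open>auto intro!: exI[of _ j]\<close>)
    then have i: "i \<le> n + 1" "\<gamma> i \<noteq> 0" by auto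
    have i': "\<gamma> l = 0" if "i < l" "l \<le> n + 1" for l
    proof (rule ccontr)
      assume "\<gamma> l \<noteq> 0"
      then have "l \<le> i" unfolding i_def using that by (intro Max_ge[OF fin]) auto
      then show False using that by simp
    qed
    have "(\<Sum>m\<le>n + 1. (-1) ^ m * real ((n + 1) choose m) * \<gamma> m * ((-1) ^ i / fact i * real (m choose i)))
      = (\<Sum>m\<in>{i}. (-1) ^ m * real ((n + 1) choose m) * \<gamma> m * ((-1) ^ i / fact i * real (m choose i)))"
      by (rule sum.mono_neutral_right) (use i i' in \<open>auto simp: not_le not_less binomial_eq_0 linorder_neq_iff\<close>)
    moreover have "coeff (monom_image (n + 1)) i = fact (n + 1) * (\<Sum>m\<le>n + 1. (-1) ^ m * real ((n + 1) choose m) * \<gamma> m * ((-1) ^ i / fact i * real (m choose i)))"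
      by (simp only: monom_image_eq coeff_sum coeff_smult coeff_laguerre_poly)
    ultimately show False using U0 i by (simp del: binomial_Suc_Suc fact_Suc)
  qed
qed

text \<open>
  A first zero \<open>n\<close> after the beginning of the support is followed by zeros only, since a later non-zero
  value would sit above a gap. The support is then finite, and more than two elements are
  excluded, so that \<open>\<gamma>\<close> is trivial.
\<close>

lemma gamma_support:
  assumes "\<not> trivial_sequence \<gamma>"
  obtains q where "\<And>k. k < q \<Longrightarrow> \<gamma> k = 0" "\<And>k. k \<ge> q \<Longrightarrow> \<gamma> k \<noteq> 0"
proof -
  have "\<exists>k. \<gamma> k \<noteq> 0"
  proof (rule ccontr)
    assume "\<not> ?thesis"
    then have "\<gamma> = (\<lambda>k. if k = 0 then 0 else if k = Suc 0 then 0 else 0)" by auto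
    then show False using assms unfolding trivial_sequence_def by blast
  qed
  define q where "q = (LEAST k. \<gamma> k \<noteq> 0)"
  have q: "\<gamma> q \<noteq> 0" unfolding q_def by (rule LeastI_ex) fact
  have q': "\<gamma> k = 0" if "k < q" for k using that not_less_Least unfolding q_def by blast
  have "\<gamma> k \<noteq> 0" if "k \<ge> q" for k
  proof (rule ccontr)
    assume "\<not> \<gamma> k \<noteq> 0"
    then have ex: "\<exists>k. k \<ge> q \<and> \<gamma> k = 0" using that by blast
    define n where "n = (LEAST k. k \<ge> q \<and> \<gamma> k = 0)"
    have n: "n \<ge> q" "\<gamma> n = 0" using LeastI_ex[OF ex] unfolding n_def by auto
    have n': "\<gamma> k \<noteq> 0" if "q \<le> k" "k < n" for k
      using not_less_Least[of k "\<lambda>k. k \<ge> q \<and> \<gamma> k = 0"] that unfolding n_def by blast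
    have "n \<noteq> q" using n q by auto
    then have nq: "q < n" using n by simp
    then obtain l where l: "n = l + 1" "q \<le> l" by (cases n) auto
    have z: "\<gamma> k = 0" if "k \<ge> n" for k
      using that
    proof (induction k rule: less_induct)
      case (less k)
      have "k = n \<or> k = n + 1 \<or> (k = (k - 2) + 2 \<and> k - 2 \<ge> n)" using less.prems by linarith
      then consider "k = n" | "k = n + 1" | m where "k = m + 2" "m \<ge> n" by blast
      then show ?case
      proof cases
        case 2
        have "\<gamma> l * \<gamma> (l + 2) = 0" using gamma_no_single_gap[of l] n l by simp
        then show ?thesis using n'[of l] l 2 by simp
      next
        case 3
        have "\<gamma> (m + 1) = 0" "\<gamma> m = 0" using less 3 by auto
        then have "\<gamma> (m + 2) = 0" using gamma_no_double_gap[of m q] q 3 n(1) by (meson order_trans)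
        then show ?thesis using 3 by simp
      qed (use n in simp)
    qed
    show False
    proof (cases "n \<ge> q + 3")
      case True
      define K where "K = n - 3"
      have K: "n = K + 3" "K \<ge> q" using True by (simp_all add: K_def)
      have "\<gamma> K = 0"
        by (rule gamma_top_of_support) (use z n' K in auto)
      then show False using n'[of K] K by simp
    next
      case False
      have "\<gamma> = (\<lambda>k. if k = q then \<gamma> q else if k = Suc q then \<gamma> (Suc q) else 0)"
      proof
        fix k
        consider "k < q" | "k = q" | "k = Suc q" | "k \<ge> n" using False by linarith
        then show "\<gamma> k = (if k = q then \<gamma> q else if k = Suc q then \<gamma> (Suc q) else 0)"
          using q' z by cases auto
      qed
      then show False using assms unfolding trivial_sequence_def by blast
    qed
  qed
  then show thesis using that q' by blast
qed

lemma gamma_signs: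
  assumes "\<And>k. k \<ge> q \<Longrightarrow> \<gamma> k \<noteq> 0"
  obtains \<kappa> :: real where "\<kappa> = 1 \<or> \<kappa> = -1" "\<And>k. k \<ge> q \<Longrightarrow> \<kappa> * (\<gamma> k * \<gamma> (Suc k)) > 0"
proof -
  define \<kappa> where "\<kappa> = sgn (\<gamma> q * \<gamma> (Suc q))"
  have nz: "\<gamma> q * \<gamma> (Suc q) \<noteq> 0" using assms[of q] assms[of "Suc q"] by simp
  then have 1: "\<kappa> = 1 \<or> \<kappa> = -1"
    by (auto simp: \<kappa>_def sgn_if)
  have base: "\<kappa> * (\<gamma> q * \<gamma> (Suc q)) > 0"
    using nz unfolding \<kappa>_def by (metis abs_sgn mult.commute zero_less_abs_iff)
  have "\<kappa> * (\<gamma> k * \<gamma> (Suc k)) > 0" if "k \<ge> q" for k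
    using that
  proof (induction k rule: dec_induct)
    case base
    show ?case by fact
  next
    case (step k)
    have "\<gamma> k * \<gamma> (k + 2) \<noteq> 0" using assms[of k] assms[of "k + 2"] step by simp
    then have "\<gamma> k * \<gamma> (k + 2) > 0" using gamma_step_two_nonneg[of k] by linarith
    then have p: "\<kappa> * (\<gamma> k * \<gamma> (Suc k)) * (\<gamma> k * \<gamma> (k + 2)) > 0" using step.IH by simp
    have "\<kappa> * (\<gamma> k * \<gamma> (Suc k)) * (\<gamma> k * \<gamma> (k + 2)) = (\<gamma> k)\<^sup>2 * (\<kappa> * (\<gamma> (Suc k) * \<gamma> (Suc (Suc k))))"
      by (simp add: power2_eq_square)
    moreover have "(\<gamma> k)\<^sup>2 > 0" using assms[of k] step by simp
    ultimately show ?case using p zero_less_mult_pos by metis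
  qed
  with 1 show thesis using that by blast
qed

end

section \<open>The half-plane of zeros of shifted powers\<close>

lemma continuous_on_poly_comp [continuous_intros]:
  fixes p :: "'a::{real_normed_field} poly"
  shows "continuous_on S f \<Longrightarrow> continuous_on S (\<lambda>x. poly p (f x))"
  by (induction p) (auto intro!: continuous_intros)

lemma upper_half_constant_sign:
  fixes f :: "complex \<Rightarrow> real"
  assumes cont: "continuous_on {z. Im z > 0} f" and nz: "\<And>z. Im z > 0 \<Longrightarrow> f z \<noteq> 0"
    and "Im x > 0" "Im y > 0" "f x > 0"
  shows "f y > 0"
proof (rule ccontr)
  assume "\<not> f y > 0"
  define h where "h t = of_real (1 - t) * x + of_real t * y" for t :: real
  have Im: "Im (h t) > 0" if "t \<in> {0..1}" for t
  proof (cases "t = 0")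
    case False
    then have "(1 - t) * Im x \<ge> 0" "t * Im y > 0" using that assms by auto
    then show ?thesis by (simp add: h_def)
  qed (use assms in \<open>simp add: h_def\<close>)
  have "continuous_on {0..1} (f \<circ> h)"
  proof (rule continuous_on_compose)
    show "continuous_on {0..1} h" unfolding h_def by (intro continuous_intros)
    show "continuous_on (h ` {0..1}) f"
      by (rule continuous_on_subset[OF cont]) (use Im in auto)
  qed
  moreover have "(f \<circ> h) 1 \<le> 0" "0 \<le> (f \<circ> h) 0" using assms \<open>\<not> f y > 0\<close> by (auto simp: h_def)
  ultimately obtain t where "t \<in> {0..1}" "(f \<circ> h) t = 0"
    using IVT2'[of "f \<circ> h" 1 0 0] by auto
  then show False using nz Im by auto
qed

text \<open>
  The theorem of Hermite and Biehler, without a choice of the half-plane: a pencil of real-rooted polynomials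
  means that \<open>f / h\<close> is never real off the real axis, so \<open>Im (f / h)\<close> has a constant sign on the upper
  half-plane and cannot take both values \<open>\<i>\<close> and \<open>-\<i>\<close>.
\<close>

lemma pencil_dichotomy:
  fixes f h :: "real poly"
  assumes h: "only_real_zeros h" "h \<noteq> 0"
    and pencil: "\<And>t. only_real_zeros (f - smult t h)" "\<And>t. f \<noteq> smult t h"
  shows "(\<forall>z. Im z > 0 \<longrightarrow> poly (cpoly f) z + \<i> * poly (cpoly h) z \<noteq> 0)
       \<or> (\<forall>z. Im z < 0 \<longrightarrow> poly (cpoly f) z + \<i> * poly (cpoly h) z \<noteq> 0)"
proof -
  have hz: "poly (cpoly h) z \<noteq> 0" if "Im z > 0" for z
    using that h by (auto simp: only_real_zeros_iff upper_free_def)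
  define \<phi> where "\<phi> z = Im (poly (cpoly f) z / poly (cpoly h) z)" for z
  have cont: "continuous_on {z. Im z > 0} \<phi>"
    unfolding \<phi>_def by (intro continuous_intros) (auto simp: hz)
  have nz: "\<phi> z \<noteq> 0" if z: "Im z > 0" for z
  proof
    assume "\<phi> z = 0"
    then obtain t where "poly (cpoly f) z / poly (cpoly h) z = of_real t"
      unfolding \<phi>_def by (metis complex_is_Real_iff Reals_cases)
    then have "poly (cpoly (f - smult t h)) z = 0"
      using hz[OF z] by (simp add: cpoly_add cpoly_minus cpoly_smult field_simps diff_conv_add_uminus del: add_uminus_conv_diff)
    moreover have "f - smult t h \<noteq> 0" using pencil(2)[of t] by simp
    ultimately show False using pencil(1)[of t] z by (auto simp: only_real_zeros_iff upper_free_def)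
  qed
  show ?thesis
  proof (rule ccontr)
    assume "\<not> ?thesis"
    then obtain z w where z: "Im z > 0" "poly (cpoly f) z + \<i> * poly (cpoly h) z = 0"
      and w: "Im w < 0" "poly (cpoly f) w + \<i> * poly (cpoly h) w = 0" by blast
    have "poly (cpoly f) z / poly (cpoly h) z = - \<i>"
      using z(2) hz[OF z(1)] by (simp add: field_simps add_eq_0_iff2)
    then have 1: "\<phi> z < 0" by (simp add: \<phi>_def)
    have "cnj (poly (cpoly f) w + \<i> * poly (cpoly h) w) = 0" by (simp only: w complex_cnj_zero)
    then have "poly (cpoly f) (cnj w) - \<i> * poly (cpoly h) (cnj w) = 0" by (simp add: poly_cpoly_cnj)
    then have "poly (cpoly f) (cnj w) / poly (cpoly h) (cnj w) = \<i>"
      using hz[of "cnj w"] w(1) by (simp add: field_simps)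
    then have 2: "\<phi> (cnj w) > 0" by (simp add: \<phi>_def)
    have "\<phi> z > 0"
      by (rule upper_half_constant_sign[OF cont nz _ _ 2]) (use z w in auto)
    then show False using 1 by simp
  qed
qed

lemma Im_sum_mset_nonneg:
  "(\<And>x. x \<in># A \<Longrightarrow> \<kappa> * Im x \<ge> 0) \<Longrightarrow> \<kappa> * Im (\<Sum>x\<in>#A. x) \<ge> 0"
  by (induction A) (auto simp: distrib_left)

text \<open>
  Here \<open>P\<close> and \<open>Q\<close> are the values at \<open>z\<close> of the polynomials formed by the real and the imaginary parts of the
  coefficients of \<open>(x + s)^M\<close>. Expressing them by \<open>(z + s)^M\<close> and \<open>(z + cnj s)^M\<close>, whose
  coefficients in the combination have equal modulus, shows that \<open>z\<close> is equidistant from \<open>-s\<close> and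
  \<open>-cnj s\<close>.
\<close>

lemma shifted_power_pencil_real:
  assumes s: "Im s > 0" and ab: "\<alpha> \<noteq> 0 \<or> \<beta> \<noteq> 0"
    and z: "of_real \<alpha> * P + of_real \<beta> * Q = 0" "P + \<i> * Q = (z + s) ^ M" "P - \<i> * Q = (z + cnj s) ^ M" and M: "M > 0"
  shows "Im z = 0"
proof -
  let ?w = "of_real \<alpha> - \<i> * of_real \<beta>"
  have "?w * (P + \<i> * Q) + cnj ?w * (P - \<i> * Q) = 2 * (of_real \<alpha> * P + of_real \<beta> * Q)"
    by (simp add: algebra_simps)
  then have "?w * (z + s) ^ M = - (cnj ?w * (z + cnj s) ^ M)"
    unfolding z by (simp add: add_eq_0_iff2)
  then have "cmod (?w * (z + s) ^ M) = cmod (cnj ?w * (z + cnj s) ^ M)" by (metis norm_minus_cancel)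
  then have "cmod ?w * cmod (z + s) ^ M = cmod ?w * cmod (z + cnj s) ^ M"
    by (simp only: norm_mult norm_power complex_mod_cnj)
  moreover have "?w \<noteq> 0" using ab by (auto simp: complex_eq_iff)
  ultimately have "cmod (z + s) = cmod (z + cnj s)"
    using M ab by (auto simp: power_eq_iff_eq_base)
  then have "(cmod (z + s))\<^sup>2 = (cmod (z + cnj s))\<^sup>2" by simp
  then have "Im z * Im s = 0" unfolding cmod_power2 by (simp add: power2_eq_square algebra_simps)
  then show ?thesis using s by simp
qed

context laguerre_multiplier
begin

text \<open>
  The image of \<open>(x + s)^M\<close> under the complex-linear extension of \<open>T\<close>.
\<close>

definition shifted_power_image :: "nat \<Rightarrow> complex \<Rightarrow> complex poly" where
  "shifted_power_image M s = (\<Sum>k\<le>M. smult (of_nat (M choose k) * s ^ (M - k)) (cpoly (monom_image k)))"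

text \<open>
  The image is \<open>f + \<i> h\<close> for a pencil of real-rooted polynomials, so its zeros lie in one closed
  half-plane. Which one is decided by the imaginary part of their sum, that is, by the two leading coefficients,
  whose ratio is governed by \<open>\<gamma> (M - 1) / \<gamma> M\<close>.
\<close>

lemma shifted_power_image_half_plane:
  assumes M: "M > 0" and \<kappa>: "\<kappa> = 1 \<or> \<kappa> = -1" and \<gamma>: "\<kappa> * (\<gamma> (M - 1) * \<gamma> M) > 0"
    and s: "Im s > 0" and x: "\<kappa> * Im x > 0"
  shows "poly (shifted_power_image M s) x \<noteq> 0"
proof -
  define p where "p = (\<Sum>k\<le>M. monom (real (M choose k) * Re (s ^ (M - k))) k)"
  define q where "q = (\<Sum>k\<le>M. monom (real (M choose k) * Im (s ^ (M - k))) k)"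
  have cp: "coeff p k = (if k \<le> M then real (M choose k) * Re (s ^ (M - k)) else 0)" for k
    by (simp add: p_def coeff_sum)
  have cq: "coeff q k = (if k \<le> M then real (M choose k) * Im (s ^ (M - k)) else 0)" for k
    by (simp add: q_def coeff_sum)
  have ReIm: "of_real (Re w) + \<i> * of_real (Im w) = w" "of_real (Re w) - \<i> * of_real (Im w) = cnj w" for w
    by (simp_all add: complex_eq_iff)
  have P: "poly (cpoly p) z = (\<Sum>k\<le>M. of_nat (M choose k) * z ^ k * of_real (Re (s ^ (M - k))))" for z
    by (simp add: p_def cpoly_sum cpoly_monom poly_sum poly_monom mult_ac)
  have Q: "poly (cpoly q) z = (\<Sum>k\<le>M. of_nat (M choose k) * z ^ k * of_real (Im (s ^ (M - k))))" for z
    by (simp add: q_def cpoly_sum cpoly_monom poly_sum poly_monom mult_ac)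
  have PQ1: "poly (cpoly p) z + \<i> * poly (cpoly q) z = (z + s) ^ M" for z
  proof -
    have "poly (cpoly p) z + \<i> * poly (cpoly q) z = (\<Sum>k\<le>M. of_nat (M choose k) * z ^ k *
       (of_real (Re (s ^ (M - k))) + \<i> * of_real (Im (s ^ (M - k)))))"
      by (simp add: P Q sum_distrib_left sum.distrib algebra_simps)
    also have "\<dots> = (z + s) ^ M" unfolding ReIm by (rule binomial_ring[symmetric])
    finally show ?thesis .
  qed
  have PQ2: "poly (cpoly p) z - \<i> * poly (cpoly q) z = (z + cnj s) ^ M" for z
  proof -
    have "poly (cpoly p) z - \<i> * poly (cpoly q) z = (\<Sum>k\<le>M. of_nat (M choose k) * z ^ k *
       (of_real (Re (s ^ (M - k))) - \<i> * of_real (Im (s ^ (M - k)))))"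
      by (simp add: P Q sum_distrib_left sum_subtractf algebra_simps)
    also have "\<dots> = (z + cnj s) ^ M" unfolding ReIm complex_cnj_power by (rule binomial_ring[symmetric])
    finally show ?thesis .
  qed
  have pencil: "only_real_zeros (smult \<alpha> p + smult \<beta> q)" if "\<alpha> \<noteq> 0 \<or> \<beta> \<noteq> 0" for \<alpha> \<beta>
    unfolding only_real_zeros_def
  proof (intro disjI2 allI impI)
    fix z assume "poly (cpoly (smult \<alpha> p + smult \<beta> q)) z = 0"
    then have "of_real \<alpha> * poly (cpoly p) z + of_real \<beta> * poly (cpoly q) z = 0"
      by (simp add: cpoly_add cpoly_smult)
    from shifted_power_pencil_real[OF s that this PQ1 PQ2 M] show "z \<in> \<real>" by (simp add: complex_is_Real_iff)
  qed
  define f where "f = T p"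
  define h where "h = T q"
  have dp: "degree p \<le> M" "degree q \<le> M" by (auto intro!: degree_le simp: cp cq)
  have fs: "f = (\<Sum>k\<le>M. smult (real (M choose k) * Re (s ^ (M - k))) (monom_image k))"
    unfolding f_def T_eq_sum[OF dp(1)] by (rule sum.cong) (auto simp: cp)
  have hs: "h = (\<Sum>k\<le>M. smult (real (M choose k) * Im (s ^ (M - k))) (monom_image k))"
    unfolding h_def T_eq_sum[OF dp(2)] by (rule sum.cong) (auto simp: cq)
  have V: "poly (shifted_power_image M s) z = poly (cpoly f) z + \<i> * poly (cpoly h) z" for z
  proof -
    have "poly (cpoly f) z + \<i> * poly (cpoly h) z = (\<Sum>k\<le>M. of_nat (M choose k) * poly (cpoly (monom_image k)) z *
       (of_real (Re (s ^ (M - k))) + \<i> * of_real (Im (s ^ (M - k)))))"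
      by (simp add: fs hs cpoly_sum cpoly_smult poly_sum sum_distrib_left sum.distrib algebra_simps)
    then show ?thesis unfolding ReIm by (simp add: shifted_power_image_def poly_sum mult_ac)
  qed
  obtain m where m: "M = Suc m" using M by (cases M) auto
  have \<gamma>nz: "\<gamma> m \<noteq> 0" "\<gamma> M \<noteq> 0" using \<gamma> m by auto
  have top: "coeff (\<Sum>k\<le>M. smult (c k) (monom_image k)) M = c M * \<gamma> M" for c :: "nat \<Rightarrow> real"
    by (simp add: m coeff_sum coeff_monom_image_eq_0 coeff_monom_image_lead)
  have hM: "coeff h M = 0" unfolding hs top by simp
  have fM: "coeff f M = \<gamma> M" unfolding fs top by simp
  have sub: "coeff (\<Sum>k\<le>M. smult (c k) (monom_image k)) m = c M * coeff (monom_image M) m + c m * \<gamma> m" for c :: "nat \<Rightarrow> real"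
  proof -
    have "(\<Sum>k<m. c k * coeff (monom_image k) m) = 0" by (rule sum.neutral) (auto simp: coeff_monom_image_eq_0)
    then show ?thesis by (simp add: m coeff_sum coeff_monom_image_lead lessThan_Suc_atMost[symmetric])
  qed
  \<comment> \<open>The imaginary part of \<open>(x + s)^M\<close> has degree \<open>M - 1\<close>, so \<open>h\<close> has no term of degree \<open>M\<close>.\<close>
  have hm: "coeff h m = real M * Im s * \<gamma> m" unfolding hs sub using m by simp
  have h0: "h \<noteq> 0" using hm M s \<gamma>nz by auto
  have dich: "(\<forall>z. Im z > 0 \<longrightarrow> poly (shifted_power_image M s) z \<noteq> 0) \<or> (\<forall>z. Im z < 0 \<longrightarrow> poly (shifted_power_image M s) z \<noteq> 0)"
    unfolding V
  proof (rule pencil_dichotomy)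
    show "only_real_zeros h" unfolding h_def using pencil[of 0 1] T_real by simp
    show "h \<noteq> 0" by fact
    show "only_real_zeros (f - smult t h)" for t
    proof -
      have "T (smult 1 p + smult (- t) q) = f - smult t h"
        by (simp only: T_add T_smult f_def h_def) simp
      then show ?thesis using pencil[of 1 "-t"] T_real by fastforce
    qed
    show "f \<noteq> smult t h" for t using fM hM \<gamma>nz by auto
  qed
  show ?thesis
  proof
    assume zero: "poly (shifted_power_image M s) x = 0"
    have lower: "\<kappa> * Im z \<ge> 0" if "poly (shifted_power_image M s) z = 0" for z
    proof (rule ccontr)
      assume "\<not> ?thesis"
      then have "\<kappa> * Im z < 0" by simp
      with \<kappa> x have "(Im z < 0 \<and> Im x > 0) \<or> (Im z > 0 \<and> Im x < 0)" by auto
      then show False using dich that zero by blast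
    qed
    have cV: "coeff (shifted_power_image M s) i = of_real (coeff f i) + \<i> * of_real (coeff h i)" for i
    proof -
      have "of_real (coeff f i) + \<i> * of_real (coeff h i) = (\<Sum>k\<le>M. of_nat (M choose k) * of_real (coeff (monom_image k) i) *
       (of_real (Re (s ^ (M - k))) + \<i> * of_real (Im (s ^ (M - k)))))"
        by (simp add: fs hs coeff_sum sum_distrib_left sum.distrib algebra_simps)
      then show ?thesis unfolding ReIm by (simp add: shifted_power_image_def coeff_sum coeff_map_poly mult_ac)
    qed
    have degV: "degree (shifted_power_image M s) = M"
    proof (rule antisym)
      show "degree (shifted_power_image M s) \<le> M"
        by (rule degree_le) (simp add: shifted_power_image_def coeff_sum coeff_map_poly coeff_monom_image_eq_0)
      show "M \<le> degree (shifted_power_image M s)" by (rule le_degree) (simp add: cV fM hM \<gamma>nz complex_eq_iff)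
    qed
    have lc: "lead_coeff (shifted_power_image M s) = of_real (\<gamma> M)" by (simp add: degV cV fM hM)
    have "shifted_power_image M s \<noteq> 0" using degV M by auto
    then obtain A where A: "shifted_power_image M s = smult (lead_coeff (shifted_power_image M s)) (\<Prod>x\<in>#A. [:-x, 1:])" "size A = degree (shifted_power_image M s)"
      "\<And>x. x \<in># A \<longleftrightarrow> poly (shifted_power_image M s) x = 0" using complex_poly_factor by blast
    have "coeff (shifted_power_image M s) m = of_real (\<gamma> M) * (- (\<Sum>x\<in>#A. x))"
      by (subst A(1)[unfolded lc]) (use A(2) degV m in \<open>simp add: vieta_sum\<close>)
    then have "Im (coeff (shifted_power_image M s) m) = - \<gamma> M * Im (\<Sum>x\<in>#A. x)" by simp
    moreover have "Im (coeff (shifted_power_image M s) m) = real M * Im s * \<gamma> m" by (simp add: cV hm)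
    ultimately have "\<gamma> M * Im (\<Sum>x\<in>#A. x) = - (real M * Im s * \<gamma> m)" by simp
    then have "(\<gamma> M)\<^sup>2 * (\<kappa> * Im (\<Sum>x\<in>#A. x)) = - (real M * Im s * (\<kappa> * (\<gamma> m * \<gamma> M)))"
      by (simp add: power2_eq_square algebra_simps)
    also have "\<dots> < 0" using M s \<gamma> m by simp
    finally have "\<kappa> * Im (\<Sum>x\<in>#A. x) < 0" by (simp add: mult_less_0_iff not_less[symmetric])
    moreover have "\<kappa> * Im (\<Sum>x\<in>#A. x) \<ge> 0" by (rule Im_sum_mset_nonneg) (use A(3) lower in blast)
    ultimately show False by simp
  qed
qed

section \<open>Values and derivatives at the origin\<close>

definition monom_const :: "nat \<Rightarrow> real" where "monom_const k = coeff (monom_image k) 0"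

lemma monom_const_forward_diff: "monom_const k = (-1) ^ k * fact k * forward_diff \<gamma> k"
proof -
  have "forward_diff \<gamma> k = (\<Sum>j\<le>k. real (k choose j) * \<gamma> j * (-1) ^ (k - j))"
    by (simp add: forward_diff_def reversed_jensen_poly_def poly_sum poly_monom atLeast0AtMost)
  also have "\<dots> = (\<Sum>j\<le>k. (-1) ^ k * ((-1) ^ j * real (k choose j) * \<gamma> j))"
  proof (rule sum.cong[OF refl])
    fix j assume "j \<in> {..k}"
    then have "(-1::real) ^ (k - j) = (-1) ^ k * (-1) ^ j"
      by (simp add: minus_one_power_iff)
    then show "real (k choose j) * \<gamma> j * (-1) ^ (k - j) = (-1) ^ k * ((-1) ^ j * real (k choose j) * \<gamma> j)"
      by (simp add: mult_ac)
  qed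
  finally have "forward_diff \<gamma> k = (-1) ^ k * (\<Sum>j\<le>k. (-1) ^ j * real (k choose j) * \<gamma> j)"
    by (simp add: sum_distrib_left)
  then have "(-1) ^ k * forward_diff \<gamma> k = ((-1) ^ k * (-1) ^ k) * (\<Sum>j\<le>k. (-1) ^ j * real (k choose j) * \<gamma> j)"
    by simp
  then have "(-1) ^ k * forward_diff \<gamma> k = (\<Sum>j\<le>k. (-1) ^ j * real (k choose j) * \<gamma> j)"
    by (simp flip: power_add)
  moreover have "monom_const k = fact k * (\<Sum>j\<le>k. (-1) ^ j * real (k choose j) * \<gamma> j)"
    by (simp add: monom_const_def monom_image_eq coeff_sum coeff_laguerre_poly)
  ultimately show ?thesis by (simp add: mult_ac)
qed

lemma coeff_monom_image_1: "coeff (monom_image k) 1 = - real k * monom_const k + (real k)\<^sup>2 * monom_const (k - 1)"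
proof (cases k)
  case 0
  then show ?thesis using coeff_monom_image_eq_0[of 0 1] by simp
next
  case (Suc l)
  have "(\<Sum>j\<le>l. (-1) ^ j * real (l choose j) * \<gamma> j) = (\<Sum>j\<le>k. (-1) ^ j * real (l choose j) * \<gamma> j)"
    by (simp add: Suc)
  then have ul: "monom_const l = fact l * (\<Sum>j\<le>k. (-1) ^ j * real (l choose j) * \<gamma> j)"
    by (simp add: monom_const_def monom_image_eq coeff_sum coeff_laguerre_poly)
  have c: "real k * real (l choose j) = (real k - real j) * real (k choose j)" if "j \<le> k" for j
    using binomial_absorb_pred[of k j] by (simp add: Suc)
  have "(real k)\<^sup>2 * monom_const l = fact k * (\<Sum>j\<le>k. (-1) ^ j * (real k * real (l choose j)) * \<gamma> j)"
  proof -
    have "(real k)\<^sup>2 * monom_const l = (real k * fact l) * (real k * (\<Sum>j\<le>k. (-1) ^ j * real (l choose j) * \<gamma> j))"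
      unfolding ul by (simp add: power2_eq_square mult_ac)
    also have "real k * fact l = fact k" by (simp add: Suc)
    also have "real k * (\<Sum>j\<le>k. (-1) ^ j * real (l choose j) * \<gamma> j) = (\<Sum>j\<le>k. (-1) ^ j * (real k * real (l choose j)) * \<gamma> j)"
      by (simp only: sum_distrib_left mult_ac)
    finally show ?thesis .
  qed
  also have "\<dots> = fact k * (\<Sum>j\<le>k. (-1) ^ j * ((real k - real j) * real (k choose j)) * \<gamma> j)"
    by (rule arg_cong2[where f = "(*)", OF refl], rule sum.cong[OF refl]) (simp add: c)
  finally have "- real k * monom_const k + (real k)\<^sup>2 * monom_const l = fact k * (\<Sum>j\<le>k. - ((-1) ^ j * real j * real (k choose j) * \<gamma> j))"
    by (simp add: monom_const_def monom_image_eq coeff_sum coeff_laguerre_poly sum_distrib_left sum_negf[symmetric] sum.distrib[symmetric] algebra_simps)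
  also have "\<dots> = coeff (monom_image k) 1"
    by (simp add: monom_image_eq coeff_sum coeff_laguerre_poly sum_distrib_left mult_ac)
  finally show ?thesis by (simp add: Suc)
qed

text \<open>
  The value at \<open>x = 0\<close> of the image of \<open>(x + s)^M\<close> and its derivative there, as polynomials in \<open>s\<close>.
\<close>

definition value_at_0 :: "nat \<Rightarrow> real poly" where
  "value_at_0 M = (\<Sum>i\<le>M. monom (real (M choose i) * monom_const (M - i)) i)"

definition deriv_at_0 :: "nat \<Rightarrow> real poly" where
  "deriv_at_0 M = (\<Sum>i\<le>M. monom (real (M choose i) * coeff (monom_image (M - i)) 1) i)"

lemma coeff_value_at_0: "coeff (value_at_0 M) i = real (M choose i) * monom_const (M - i)"
  by (cases "i \<le> M") (auto simp: value_at_0_def coeff_sum binomial_eq_0)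

lemma coeff_deriv_at_0: "coeff (deriv_at_0 M) i = real (M choose i) * coeff (monom_image (M - i)) 1"
  by (cases "i \<le> M") (auto simp: deriv_at_0_def coeff_sum binomial_eq_0)

text \<open>
  This is the relation at \<open>x = 0\<close> that expresses that \<open>T\<close> commutes with the operator
  \<open>-x D\<^sup>2 + (x - 1) D\<close>, of which the Laguerre polynomials are the eigenvectors.
\<close>

lemma deriv_at_0_eq: "deriv_at_0 M = smult (- real M) (value_at_0 M) + [:real M, 1:] * pderiv (value_at_0 M) - pCons 0 (pderiv (pderiv (value_at_0 M)))"
proof (rule poly_eqI)
  fix i
  note b = binomial_absorb_Suc[of i M]
  have d: "coeff (pderiv (value_at_0 M)) i = (real M - real i) * real (M choose i) * monom_const (M - i - 1)"
    unfolding coeff_pderiv coeff_value_at_0 mult.assoc[symmetric] b by simp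
  have pc: "coeff (pCons 0 (pderiv p)) i = real i * coeff p i" for p :: "real poly"
    by (cases i) (auto simp: coeff_pderiv)
  have "coeff (smult (- real M) (value_at_0 M) + [:real M, 1:] * pderiv (value_at_0 M) - pCons 0 (pderiv (pderiv (value_at_0 M)))) i
    = - real M * coeff (value_at_0 M) i + real M * coeff (pderiv (value_at_0 M)) i + coeff (pCons 0 (pderiv (value_at_0 M))) i
       - coeff (pCons 0 (pderiv (pderiv (value_at_0 M)))) i"
    by simp
  also have "\<dots> = real (M choose i) * (- (real M - real i) * monom_const (M - i) + (real M - real i)\<^sup>2 * monom_const (M - i - 1))"
    unfolding pc d coeff_value_at_0 by (simp add: algebra_simps power2_eq_square)
  also have "\<dots> = coeff (deriv_at_0 M) i"
    unfolding coeff_deriv_at_0 coeff_monom_image_1 by (cases "i \<le> M") (auto simp: of_nat_diff binomial_eq_0)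
  finally show "coeff (deriv_at_0 M) i = coeff (smult (- real M) (value_at_0 M) + [:real M, 1:] * pderiv (value_at_0 M) - pCons 0 (pderiv (pderiv (value_at_0 M)))) i" ..
qed

lemma shifted_power_image_at_0: "poly (shifted_power_image M s) 0 = poly (cpoly (value_at_0 M)) s" "poly (pderiv (shifted_power_image M s)) 0 = poly (cpoly (deriv_at_0 M)) s"
proof -
  have rev: "(\<Sum>k\<le>M. of_nat (M choose k) * s ^ (M - k) * of_real (c k)) = (\<Sum>i\<le>M. of_nat (M choose i) * s ^ i * of_real (c (M - i)))" for c
    by (rule sum.reindex_bij_witness[of _ "\<lambda>i. M - i" "\<lambda>i. M - i"]) (auto simp: binomial_symmetric[symmetric])
  have "poly (shifted_power_image M s) 0 = (\<Sum>k\<le>M. of_nat (M choose k) * s ^ (M - k) * of_real (monom_const k))"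
    by (simp add: shifted_power_image_def poly_0_coeff_0 coeff_sum coeff_map_poly monom_const_def)
  then show "poly (shifted_power_image M s) 0 = poly (cpoly (value_at_0 M)) s"
    unfolding rev by (simp add: value_at_0_def cpoly_sum cpoly_monom poly_sum poly_monom mult_ac)
  have "poly (pderiv (shifted_power_image M s)) 0 = (\<Sum>k\<le>M. of_nat (M choose k) * s ^ (M - k) * of_real (coeff (monom_image k) 1))"
    by (simp add: shifted_power_image_def poly_0_coeff_0 coeff_pderiv coeff_sum coeff_map_poly)
  then show "poly (pderiv (shifted_power_image M s)) 0 = poly (cpoly (deriv_at_0 M)) s"
    unfolding rev by (simp add: deriv_at_0_def cpoly_sum cpoly_monom poly_sum poly_monom mult_ac)
qed

text \<open>
  For fixed \<open>s\<close> this is the sign of a logarithmic derivative in \<open>x\<close>; for \<open>\<kappa> = -1\<close> the half-planes are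
  exchanged by the reflection \<open>x \<mapsto> -x\<close>.
\<close>

lemma im_pair_deriv_value:
  assumes M: "M > 0" and \<kappa>: "\<kappa> = 1 \<or> \<kappa> = -1" and \<gamma>: "\<kappa> * (\<gamma> (M - 1) * \<gamma> M) > 0"
    and s: "Im s > 0"
  shows "\<kappa> * im_pair (cpoly (deriv_at_0 M)) (cpoly (value_at_0 M)) s \<le> 0"
proof -
  let ?W = "pcompose (shifted_power_image M s) [:0, of_real \<kappa>:]"
  have "upper_free ?W"
    unfolding upper_free_def
    using shifted_power_image_half_plane[OF M \<kappa> \<gamma> s] \<kappa> by (auto simp: poly_pcompose)
  then have "im_pair (pderiv ?W) ?W 0 \<le> 0" by (rule upper_free_log_deriv) simp
  moreover have "poly (pderiv ?W) 0 = of_real \<kappa> * poly (pderiv (shifted_power_image M s)) 0"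
    by (simp add: pderiv_pcompose poly_pcompose pderiv_pCons)
  moreover have "poly ?W 0 = poly (shifted_power_image M s) 0" by (simp add: poly_pcompose)
  ultimately show ?thesis unfolding im_pair_def shifted_power_image_at_0 by (simp add: mult.assoc)
qed

end

text \<open>
  Zeros in the closed lower half-plane are far from \<open>s\<close>, so moving from \<open>s\<close> to \<open>t\<close> changes each distance by a bounded
  factor only. In a limit of polynomials of bounded degree, a zero in the upper half-plane therefore makes the
  limit vanish identically.
\<close>

lemma upper_free_harnack:
  assumes "upper_free p" "degree p \<le> M" "Im s > 0"
  shows "cmod (poly p t) \<le> (1 + cmod (t - s) / Im s) ^ M * cmod (poly p s)"
proof -
  obtain A where A: "p = smult (lead_coeff p) (\<Prod>x\<in>#A. [:-x, 1:])" "size A = degree p"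
    "\<And>x. x \<in># A \<Longrightarrow> Im x \<le> 0"
    using upper_free_factor[OF assms(1)] by metis
  define C where "C = 1 + cmod (t - s) / Im s"
  have C: "C \<ge> 1" using assms(3) by (simp add: C_def)
  have "cmod (poly (\<Prod>x\<in>#A. [:-x, 1:]) t) \<le> C ^ size A * cmod (poly (\<Prod>x\<in>#A. [:-x, 1:]) s)"
    using A(3)
  proof (induction A)
    case (add x A)
    have "Im s \<le> Im (s - x)" using add.prems by simp
    also have "\<dots> \<le> cmod (s - x)" by (rule order_trans[OF _ abs_Im_le_cmod]) simp
    finally have "Im s \<le> cmod (s - x)" .
    then have "cmod (t - s) * 1 \<le> cmod (t - s) * (cmod (s - x) / Im s)"
      using assms(3) by (intro mult_left_mono) auto
    then have "cmod (t - s) \<le> cmod (t - s) / Im s * cmod (s - x)" by simp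
    moreover have "cmod (t - x) \<le> cmod (t - s) + cmod (s - x)"
      using norm_triangle_ineq[of "t - s" "s - x"] by simp
    ultimately have "cmod (t - x) \<le> C * cmod (s - x)" by (simp add: C_def algebra_simps)
    then have "cmod (t - x) * cmod (poly (\<Prod>x\<in>#A. [:-x, 1:]) t) \<le>
       (C * cmod (s - x)) * (C ^ size A * cmod (poly (\<Prod>x\<in>#A. [:-x, 1:]) s))"
      using add C by (intro mult_mono) auto
    then show ?case
      by (simp only: image_mset_add_mset prod_mset.add_mset poly_mult norm_mult size_add_mset power_Suc) (simp add: mult_ac)
  qed simp
  then have "cmod (poly p t) \<le> C ^ size A * cmod (poly p s)"
  proof -
    assume le: "cmod (poly (\<Prod>x\<in>#A. [:-x, 1:]) t) \<le> C ^ size A * cmod (poly (\<Prod>x\<in>#A. [:-x, 1:]) s)"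
    show ?thesis
      using mult_left_mono[OF le, of "cmod (lead_coeff p)"]
      by (subst (1 2) A(1)) (simp add: norm_mult mult.left_commute)
  qed
  also have "\<dots> \<le> C ^ M * cmod (poly p s)"
    using C A(2) assms(2) by (intro mult_right_mono power_increasing) auto
  finally show ?thesis by (simp add: C_def)
qed

context laguerre_multiplier
begin

lemma only_real_zeros_value_at_0:
  assumes M: "M > 0" and \<kappa>: "\<kappa> = 1 \<or> \<kappa> = -1" and \<gamma>: "\<kappa> * (\<gamma> (M - 1) * \<gamma> M) > 0"
  shows "only_real_zeros (value_at_0 M)"
proof (rule ccontr)
  assume "\<not> ?thesis"
  then obtain s where s: "Im s > 0" "poly (cpoly (value_at_0 M)) s = 0" and P0: "value_at_0 M \<noteq> 0"
    by (auto simp: only_real_zeros_iff upper_free_def)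
  define W where "W x = (\<Sum>k\<le>M. monom (of_nat (M choose k) * poly (cpoly (monom_image k)) x) (M - k))" for x
  have W: "poly (W x) t = poly (shifted_power_image M t) x" for x t
    by (simp add: W_def shifted_power_image_def poly_sum poly_monom mult_ac)
  have zero: "poly (cpoly (value_at_0 M)) t = 0" if t: "Im t > 0" for t
  proof -
    define C where "C = (1 + cmod (t - s) / Im s) ^ M"
    \<comment> \<open>Approach \<open>x = 0\<close> from inside the half-plane where the image has no zeros.\<close>
    define x where "x n = \<i> * of_real (\<kappa> / real (Suc n))" for n
    have lim: "x \<longlonglongrightarrow> 0"
    proof -
      have "(\<lambda>n. \<kappa> * inverse (real (Suc n))) \<longlonglongrightarrow> \<kappa> * 0" by (intro tendsto_mult tendsto_const LIMSEQ_inverse_real_of_nat)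
      then have "(\<lambda>n. \<i> * of_real (\<kappa> * inverse (real (Suc n)))) \<longlonglongrightarrow> \<i> * of_real (\<kappa> * 0)"
        by (rule tendsto_mult[OF tendsto_const tendsto_of_real])
      then show ?thesis by (simp add: x_def[abs_def] divide_inverse)
    qed
    have ineq: "cmod (poly (shifted_power_image M t) (x n)) \<le> C * cmod (poly (shifted_power_image M s) (x n))" for n
    proof -
      have "\<kappa> * Im (x n) > 0" using \<kappa> by (auto simp: x_def)
      then have "upper_free (W (x n))"
        unfolding upper_free_def W using shifted_power_image_half_plane[OF M \<kappa> \<gamma>] by blast
      moreover have "degree (W (x n)) \<le> M"
        unfolding W_def by (intro degree_sum_le) (auto intro: order_trans[OF degree_monom_le])
      ultimately show ?thesis using upper_free_harnack[of "W (x n)" M s t] s by (simp add: W C_def)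
    qed
    have lim2: "(\<lambda>n. poly (shifted_power_image M r) (x n)) \<longlonglongrightarrow> poly (shifted_power_image M r) 0" for r
      by (rule isCont_tendsto_compose[OF _ lim]) simp
    have "cmod (poly (shifted_power_image M t) 0) \<le> C * cmod (poly (shifted_power_image M s) 0)"
      by (rule LIMSEQ_le[OF tendsto_norm[OF lim2] tendsto_mult[OF tendsto_const tendsto_norm[OF lim2]]])
        (use ineq in blast)
    then show ?thesis using s by (simp add: shifted_power_image_at_0)
  qed
  have "{z. Im z > 0} \<subseteq> {z. poly (cpoly (value_at_0 M)) z = 0}" using zero by auto
  moreover have "finite {z. poly (cpoly (value_at_0 M)) z = 0}" using P0 by (intro poly_roots_finite) (simp add: cpoly_eq_0_iff)
  ultimately have "finite {z. Im z > 0}" by (rule finite_subset)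
  then have "finite ((\<lambda>n. \<i> * of_nat (Suc n)) ` (UNIV :: nat set))" by (rule rev_finite_subset) auto
  then show False by (subst (asm) finite_image_iff) (auto simp: inj_on_def)
qed

end

section \<open>Bounding the number of interacting points\<close>

lemma sum_antisym:
  fixes f :: "real \<Rightarrow> real \<Rightarrow> real"
  assumes "\<And>z w. f z w = - f w z"
  shows "(\<Sum>z\<in>S. \<Sum>w\<in>S. f z w) = 0"
proof -
  have "(\<Sum>z\<in>S. \<Sum>w\<in>S. f z w) = (\<Sum>z\<in>S. \<Sum>w\<in>S. f w z)" by (rule sum.swap)
  also have "\<dots> = (\<Sum>z\<in>S. \<Sum>w\<in>S. - f z w)" by (intro sum.cong refl assms)
  also have "\<dots> = - (\<Sum>z\<in>S. \<Sum>w\<in>S. f z w)" by (simp add: sum_negf)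
  finally show ?thesis by simp
qed

text \<open>
  The antisymmetric kernel behind the interaction \<open>2 z / (z - w) = 1 + kernel z w\<close> of two zeros. The
  convention \<open>x / 0 = 0\<close> gives \<open>kernel z z = 0\<close>, so that sums may include the diagonal.
\<close>

definition kernel :: "real \<Rightarrow> real \<Rightarrow> real" where "kernel z w = (z + w) / (z - w)"

lemma kernel_antisym: "kernel z w = - kernel w z"
  unfolding kernel_def by (metis add.commute minus_diff_eq minus_divide_right)

lemma kernel_nonneg: "\<bar>w\<bar> \<le> \<bar>z\<bar> \<Longrightarrow> kernel z w \<ge> 0"
  unfolding kernel_def by (cases "z \<ge> 0") (auto intro: divide_nonneg_nonneg divide_nonpos_nonpos)

lemma kernel_ge_third:
  assumes "2 * \<bar>w\<bar> \<le> \<bar>z\<bar>" "z \<noteq> 0"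
  shows "kernel z w \<ge> 1 / 3"
proof (cases "z > 0")
  case True
  then show ?thesis using assms unfolding kernel_def by (simp add: field_simps)
next
  case False
  then have "z - w < 0" using assms by auto
  then show ?thesis using assms False unfolding kernel_def by (simp add: neg_le_divide_eq)
qed

lemma kernel_ge_minus_three:
  assumes "2 * \<bar>z\<bar> \<le> \<bar>w\<bar>" "w \<noteq> 0"
  shows "kernel z w \<ge> - 3"
proof (cases "w > 0")
  case True
  then have "z - w < 0" using assms by auto
  then show ?thesis using assms True unfolding kernel_def by (simp add: neg_le_divide_eq)
next
  case False
  then have "z - w > 0" using assms by auto
  then show ?thesis using assms False unfolding kernel_def by (simp add: pos_le_divide_eq)
qed

text \<open>
  The weight \<open>z\<^sup>2\<close> makes the kernel positive: symmetrising \<open>z\<^sup>2 kernel z w\<close> yields half of \<open>(z + w)\<^sup>2\<close>.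
\<close>

lemma kernel_square_sum:
  assumes "finite R"
  shows "(\<Sum>z\<in>R. \<Sum>w\<in>R. z\<^sup>2 * kernel z w) \<ge> (real (card R) - 2) * (\<Sum>z\<in>R. z\<^sup>2)"
proof -
  let ?Q = "\<Sum>z\<in>R. z\<^sup>2"
  let ?X = "\<Sum>z\<in>R. \<Sum>w\<in>R. z\<^sup>2 * kernel z w"
  have "?X = (\<Sum>z\<in>R. \<Sum>w\<in>R. w\<^sup>2 * kernel w z)" by (rule sum.swap)
  then have "2 * ?X = (\<Sum>z\<in>R. \<Sum>w\<in>R. z\<^sup>2 * kernel z w + w\<^sup>2 * kernel w z)" by (simp add: sum.distrib)
  also have "\<dots> = (\<Sum>z\<in>R. \<Sum>w\<in>R. (z + w)\<^sup>2 - (if w = z then 4 * z\<^sup>2 else 0))"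
  proof (intro sum.cong refl)
    fix z w :: real
    show "z\<^sup>2 * kernel z w + w\<^sup>2 * kernel w z = (z + w)\<^sup>2 - (if w = z then 4 * z\<^sup>2 else 0)"
    proof (cases "w = z")
      case False
      have "z\<^sup>2 * kernel z w + w\<^sup>2 * kernel w z = (z\<^sup>2 - w\<^sup>2) * kernel z w"
        using kernel_antisym[of w z] by (simp add: algebra_simps)
      also have "\<dots> = (z + w)\<^sup>2" using False by (simp add: kernel_def field_simps power2_eq_square)
      finally show ?thesis using False by simp
    qed (simp add: kernel_def power2_eq_square)
  qed
  also have "\<dots> = (\<Sum>z\<in>R. \<Sum>w\<in>R. (z + w)\<^sup>2) - 4 * ?Q"
    using assms by (simp add: sum_subtractf sum_distrib_left)
  also have "(\<Sum>z\<in>R. \<Sum>w\<in>R. (z + w)\<^sup>2) = 2 * real (card R) * ?Q + 2 * (\<Sum>z\<in>R. z)\<^sup>2"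
  proof -
    have "(\<Sum>z\<in>R. \<Sum>w\<in>R. (z + w)\<^sup>2) = (\<Sum>z\<in>R. \<Sum>w\<in>R. z\<^sup>2 + w\<^sup>2 + 2 * (z * w))"
      by (simp add: power2_sum mult.assoc)
    also have "\<dots> = 2 * real (card R) * ?Q + 2 * (\<Sum>z\<in>R. \<Sum>w\<in>R. z * w)"
      by (simp add: sum.distrib sum_distrib_left mult_ac)
    also have "(\<Sum>z\<in>R. \<Sum>w\<in>R. z * w) = (\<Sum>z\<in>R. z)\<^sup>2"
      by (simp add: sum_product power2_eq_square)
    finally show ?thesis .
  qed
  finally have "?X = (real (card R) - 2) * ?Q + (\<Sum>z\<in>R. z)\<^sup>2" by (simp add: algebra_simps)
  then show ?thesis by simp
qed

text \<open>Each of \<open>m + 1\<close> consecutive dyadic shells beyond \<open>l\<close> would otherwise contain one of at most \<open>m\<close> points.\<close>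

lemma empty_dyadic_shell:
  fixes Z :: "real set"
  assumes "finite Z" "card {z \<in> Z. \<bar>z\<bar> > l} \<le> m"
  obtains j where "j \<le> m" "\<And>z. z \<in> Z \<Longrightarrow> \<bar>z\<bar> > l * 2 ^ j \<Longrightarrow> \<bar>z\<bar> > l * 2 ^ Suc j"
proof (rule ccontr)
  note main = that
  assume no: "\<not> thesis"
  have ex: "\<exists>z\<in>Z. l * 2 ^ j < \<bar>z\<bar> \<and> \<bar>z\<bar> \<le> l * 2 ^ Suc j" if j: "j \<le> m" for j
  proof (rule ccontr)
    assume "\<not> ?thesis"
    then have "\<And>z. z \<in> Z \<Longrightarrow> \<bar>z\<bar> > l * 2 ^ j \<Longrightarrow> \<bar>z\<bar> > l * 2 ^ Suc j" by (meson not_le)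
    with no j main show False by blast
  qed
  define c where "c j = card {z \<in> Z. \<bar>z\<bar> > l * 2 ^ j}" for j :: nat
  have "c j + j \<le> c 0" if "j \<le> Suc m" for j
    using that
  proof (induction j)
    case (Suc j)
    obtain z where z: "z \<in> Z" "l * 2 ^ j < \<bar>z\<bar>" "\<bar>z\<bar> \<le> l * 2 ^ Suc j" using ex[of j] Suc.prems by auto
    have "l * 2 ^ j < l * 2 ^ Suc j" using z by linarith
    then have "{z \<in> Z. \<bar>z\<bar> > l * 2 ^ Suc j} \<subset> {z \<in> Z. \<bar>z\<bar> > l * 2 ^ j}" using z by force
    then have "c (Suc j) < c j" unfolding c_def using assms(1) by (intro psubset_card_mono) auto
    then show ?case using Suc by simp
  qed simp
  from this[of "Suc m"] show False using assms(2) by (simp add: c_def)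
qed

text \<open>
  The points of \<open>Z\<close> are non-zero zeros of a polynomial that also vanishes \<open>z0\<close> times at the origin. The
  hypotheses bound their second moment and say that each of them satisfies the inequality that comes from the sign of a
  residue. First, summing this inequality over the points of modulus larger than a
  multiple of \<open>sqrt n\<close>, where \<open>n\<close> is the total number, bounds their number: by antisymmetry their mutual interactions cancel, and
  each of them feels at least \<open>n / 6\<close> from the rest. So some dyadic shell is empty, and it separates
  the points into a bounded number of large ones and the others. Summing the inequality over the others with weight \<open>z\<^sup>2\<close>, the
  positivity of the symmetrised kernel beats all other terms and leaves no room for a non-zero
  point. The gap is needed to control the interaction with the large points.
\<close>

lemma few_nonzero_zeros:
  fixes C q :: real
  assumes "C \<ge> 1" "q \<ge> 0"
  shows "\<exists>m n0 :: nat. \<forall>Z (z0::nat). finite Z \<and> 0 \<notin> Z \<and> n0 \<le> z0 + card Z \<and>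
     (\<Sum>z\<in>Z. z\<^sup>2) \<le> C * (real (z0 + card Z))\<^sup>2 \<and>
     (\<forall>z\<in>Z. real z0 + (\<Sum>w\<in>Z. kernel z w) \<le> z + 1 + q) \<longrightarrow> card Z \<le> m"
proof -
  define m where "m = nat \<lceil>72 * C\<rceil>"
  define K where "K = sqrt (8 * C) * 2 ^ m"
  define n0 where "n0 = nat \<lceil>4 * K\<^sup>2 + 2 * (4 * real m + 3 + q) + 24 * (1 + q) + 1\<rceil>"
  have m: "72 * C \<le> real m" unfolding m_def by (rule real_nat_ceiling_ge)
  have n0: "4 * K\<^sup>2 + 2 * (4 * real m + 3 + q) + 24 * (1 + q) + 1 \<le> real n0"
    unfolding n0_def by (rule real_nat_ceiling_ge)
  have "card Z \<le> m"
    if fin: "finite Z" and Z0: "0 \<notin> Z" and large: "z0 + card Z \<ge> n0"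
      and sq: "(\<Sum>z\<in>Z. z\<^sup>2) \<le> C * (real (z0 + card Z))\<^sup>2"
      and ineq: "\<And>z. z \<in> Z \<Longrightarrow> real z0 + (\<Sum>w\<in>Z. kernel z w) \<le> z + 1 + q"
    for Z and z0 :: nat
  proof -
    define n where "n = real (z0 + card Z)"
    have nge: "real n0 \<le> n" using large by (simp add: n_def)
    have K0: "K \<ge> 0" using assms by (simp add: K_def)
    have n1: "n \<ge> 4 * K\<^sup>2" "n > 2 * (4 * real m + 3 + q)" "n \<ge> 24 * (1 + q)" "n > 0"
    proof -
      have "0 \<le> 4 * K\<^sup>2" "0 \<le> 2 * (4 * real m + 3 + q)" "0 \<le> 24 * (1 + q)" using assms by auto
      then show "n \<ge> 4 * K\<^sup>2" "n > 2 * (4 * real m + 3 + q)" "n \<ge> 24 * (1 + q)" "n > 0"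
        using n0 nge by linarith+
    qed
    \<comment> \<open>By Chebyshev's inequality at most half of the \<open>n\<close> points exceed \<open>l / 2\<close> in modulus.\<close>
    define l where "l = sqrt (8 * C * n)"
    have l: "l\<^sup>2 = 8 * C * n" "l > 0" using assms n1 by (auto simp: l_def)
    define S where "S = {z \<in> Z. \<bar>z\<bar> > l}"
    have finS: "finite S" using fin by (simp add: S_def)
    have SZ: "S \<subseteq> Z" by (auto simp: S_def)
    have cardS: "card S \<le> m"
    proof -
      define B where "B = {z \<in> Z. 2 * \<bar>z\<bar> > l}"
      have BZ: "B \<subseteq> Z" and SB: "S \<subseteq> B" using l by (auto simp: B_def S_def)
      have "real (card B) * (l\<^sup>2 / 4) \<le> (\<Sum>z\<in>B. z\<^sup>2)"
      proof -
        have "(\<Sum>z\<in>B. l\<^sup>2 / 4) \<le> (\<Sum>z\<in>B. z\<^sup>2)"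
        proof (rule sum_mono)
          fix z assume "z \<in> B"
          then have "l \<le> 2 * \<bar>z\<bar>" by (simp add: B_def)
          then have "l\<^sup>2 \<le> (2 * \<bar>z\<bar>)\<^sup>2" using l by (intro power_mono) auto
          then show "l\<^sup>2 / 4 \<le> z\<^sup>2" by (simp add: power_mult_distrib)
        qed
        then show ?thesis by simp
      qed
      also have "\<dots> \<le> (\<Sum>z\<in>Z. z\<^sup>2)" using fin BZ by (intro sum_mono2) auto
      also have "\<dots> \<le> C * n\<^sup>2" using sq by (simp add: n_def)
      finally have "real (card B) * (2 * C * n) \<le> (n / 2) * (2 * C * n)"
        unfolding l(1) by (simp add: power2_eq_square mult_ac)
      then have cB: "real (card B) \<le> n / 2" using assms n1 by simp
      have cZB: "real (card (Z - B)) = real (card Z) - real (card B)"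
        using fin BZ by (simp add: card_Diff_subset finite_subset of_nat_diff card_mono)
      have each: "n / 6 \<le> real z0 + (\<Sum>w\<in>Z - S. kernel z w)" if z: "z \<in> S" for z
      proof -
        have "(\<Sum>w\<in>Z - B. 1 / 3) \<le> (\<Sum>w\<in>Z - B. kernel z w)"
          by (rule sum_mono, rule kernel_ge_third) (use z l in \<open>auto simp: B_def S_def\<close>)
        also have "\<dots> \<le> (\<Sum>w\<in>Z - S. kernel z w)"
          by (rule sum_mono2) (use fin SB z in \<open>auto simp: S_def intro!: kernel_nonneg\<close>)
        finally have le: "(real (card Z) - real (card B)) / 3 \<le> (\<Sum>w\<in>Z - S. kernel z w)" by (simp add: cZB)
        have cZ: "real (card Z) = n - real z0" by (simp add: n_def)
        have "n / 6 \<le> real z0 + (n - real z0 - n / 2) / 3" by (simp add: field_simps)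
        also have "\<dots> \<le> real z0 + (\<Sum>w\<in>Z - S. kernel z w)" using le cB unfolding cZ by simp
        finally show ?thesis .
      qed
      have "real (card S) * (n / 6) \<le> (\<Sum>z\<in>S. real z0 + (\<Sum>w\<in>Z - S. kernel z w))"
        using sum_mono[of S "\<lambda>_. n / 6", OF each] by simp
      also have "\<dots> = (\<Sum>z\<in>S. real z0 + (\<Sum>w\<in>Z - S. kernel z w)) + (\<Sum>z\<in>S. \<Sum>w\<in>S. kernel z w)"
        using sum_antisym[of kernel S, OF kernel_antisym] by simp
      also have "\<dots> = (\<Sum>z\<in>S. real z0 + (\<Sum>w\<in>Z. kernel z w))"
        using fin SZ by (simp add: sum.distrib[symmetric] sum.subset_diff[of S Z] add.assoc)
      also have "\<dots> \<le> (\<Sum>z\<in>S. z + 1 + q)" using ineq SZ by (intro sum_mono) auto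
      also have "\<dots> \<le> (\<Sum>z\<in>S. n / 12 + 3 / n * z\<^sup>2 + (1 + q))"
      proof (rule sum_mono)
        fix z :: real
        \<comment> \<open>The inequality of the means, weighted so that \<open>n / 12\<close> stays below the \<open>n / 6\<close> on the left.\<close>
        have "0 \<le> (n - 6 * z)\<^sup>2 / (12 * n)" using n1 by simp
        also have "\<dots> = n / 12 + 3 / n * z\<^sup>2 - z" using n1 by (simp add: power2_eq_square field_simps)
        finally show "z + 1 + q \<le> n / 12 + 3 / n * z\<^sup>2 + (1 + q)" by simp
      qed
      also have "\<dots> = real (card S) * (n / 12) + 3 / n * (\<Sum>z\<in>S. z\<^sup>2) + real (card S) * (1 + q)"
        by (simp add: sum.distrib sum_distrib_left)
      also have "3 / n * (\<Sum>z\<in>S. z\<^sup>2) \<le> 3 / n * (C * n\<^sup>2)"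
      proof (rule mult_left_mono)
        have "(\<Sum>z\<in>S. z\<^sup>2) \<le> (\<Sum>z\<in>Z. z\<^sup>2)" using fin SZ by (intro sum_mono2) auto
        then show "(\<Sum>z\<in>S. z\<^sup>2) \<le> C * n\<^sup>2" using sq by (simp add: n_def)
      qed (use n1 in simp)
      also have "3 / n * (C * n\<^sup>2) = 3 * C * n" using n1 by (simp add: power2_eq_square)
      finally have "real (card S) * (n / 6) \<le> real (card S) * (n / 12) + 3 * C * n + real (card S) * (1 + q)" by simp
      moreover have "real (card S) * (1 + q) \<le> real (card S) * (n / 24)" using n1 by (intro mult_left_mono) auto
      ultimately have "real (card S) * (n / 24) \<le> 3 * C * n" by (simp add: algebra_simps)
      then have "real (card S) * n \<le> (72 * C) * n" by simp
      then have "real (card S) \<le> 72 * C" using n1 by simp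
      then show ?thesis using m by linarith
    qed
    obtain j where j: "j \<le> m" "\<And>z. z \<in> Z \<Longrightarrow> \<bar>z\<bar> > l * 2 ^ j \<Longrightarrow> \<bar>z\<bar> > l * 2 ^ Suc j"
      using empty_dyadic_shell[OF fin, of l m] cardS unfolding S_def by blast
    define \<mu> where "\<mu> = l * 2 ^ j"
    have \<mu>l: "l \<le> \<mu>" "\<mu> > 0" using l by (auto simp: \<mu>_def)
    have \<mu>n: "\<mu> \<le> n / 2"
    proof -
      have "\<mu> \<le> l * 2 ^ m" unfolding \<mu>_def using l j by (intro mult_left_mono power_increasing) auto
      also have "\<dots> = K * sqrt n" by (simp add: K_def l_def real_sqrt_mult)
      also have "\<dots> \<le> (sqrt n / 2) * sqrt n"
      proof (rule mult_right_mono)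
        have "2 * K \<le> sqrt n" by (rule real_le_rsqrt) (use n1 in \<open>simp add: power_mult_distrib\<close>)
        then show "K \<le> sqrt n / 2" by simp
      qed (use n1 in simp)
      also have "\<dots> = n / 2" using n1 by simp
      finally show ?thesis .
    qed
    \<comment> \<open>The shell between \<open>\<mu>\<close> and \<open>2 \<mu>\<close> is empty.\<close>
    define R where "R = {z \<in> Z. \<bar>z\<bar> \<le> \<mu>}"
    define S' where "S' = Z - R"
    have finR: "finite R" and finS': "finite S'" using fin by (auto simp: R_def S'_def)
    have RZ: "R \<subseteq> Z" by (auto simp: R_def)
    have S'S: "S' \<subseteq> S" using \<mu>l by (auto simp: S'_def R_def S_def)
    then have cS': "card S' \<le> m" using card_mono[OF finS S'S] cardS by simp
    have S'big: "2 * \<mu> < \<bar>w\<bar>" if "w \<in> S'" for w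
      using j(2)[of w] that by (auto simp: S'_def R_def \<mu>_def not_le mult_ac)
    have cR: "real (card R) = real (card Z) - real (card S')"
      unfolding S'_def using fin RZ by (simp add: card_Diff_subset finite_subset of_nat_diff card_mono)
    let ?Q = "\<Sum>z\<in>R. z\<^sup>2"
    have Q0: "?Q \<ge> 0" by (rule sum_nonneg) simp
    have "(\<Sum>z\<in>R. z\<^sup>2 * (real z0 + (\<Sum>w\<in>Z. kernel z w))) \<le> (\<Sum>z\<in>R. z\<^sup>2 * (\<mu> + 1 + q))"
    proof (intro sum_mono mult_left_mono)
      fix z assume "z \<in> R"
      then show "real z0 + (\<Sum>w\<in>Z. kernel z w) \<le> \<mu> + 1 + q" using ineq[of z] by (auto simp: R_def)
    qed simp
    then have upper: "(\<Sum>z\<in>R. z\<^sup>2 * (real z0 + (\<Sum>w\<in>Z. kernel z w))) \<le> (\<mu> + 1 + q) * ?Q"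
      by (simp add: sum_distrib_left mult.commute)
    have split: "(\<Sum>w\<in>Z. kernel z w) = (\<Sum>w\<in>S'. kernel z w) + (\<Sum>w\<in>R. kernel z w)" for z
      unfolding S'_def using fin RZ by (simp add: sum.subset_diff[of R Z])
    have "(\<Sum>z\<in>R. z\<^sup>2 * (real z0 + (\<Sum>w\<in>Z. kernel z w))) =
       real z0 * ?Q + (\<Sum>z\<in>R. z\<^sup>2 * (\<Sum>w\<in>S'. kernel z w)) + (\<Sum>z\<in>R. \<Sum>w\<in>R. z\<^sup>2 * kernel z w)"
      unfolding split by (simp add: sum.distrib sum_distrib_left distrib_left mult.commute[of _ "real z0"])
    also have "\<dots> \<ge> real z0 * ?Q + (- 3 * real (card S')) * ?Q + (real (card R) - 2) * ?Q"
    proof -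
      have "(\<Sum>z\<in>R. z\<^sup>2 * (- 3 * real (card S'))) \<le> (\<Sum>z\<in>R. z\<^sup>2 * (\<Sum>w\<in>S'. kernel z w))"
      proof (intro sum_mono mult_left_mono)
        fix z assume z: "z \<in> R"
        have "(\<Sum>w\<in>S'. - 3) \<le> (\<Sum>w\<in>S'. kernel z w)"
        proof (intro sum_mono kernel_ge_minus_three)
          fix w assume "w \<in> S'"
          then show "2 * \<bar>z\<bar> \<le> \<bar>w\<bar>" "w \<noteq> 0" using S'big[of w] z \<mu>l by (auto simp: R_def)
        qed
        then show "- 3 * real (card S') \<le> (\<Sum>w\<in>S'. kernel z w)" by simp
      qed simp
      then have "(- 3 * real (card S')) * ?Q \<le> (\<Sum>z\<in>R. z\<^sup>2 * (\<Sum>w\<in>S'. kernel z w))"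
        by (simp add: sum_distrib_left sum_distrib_right mult.commute)
      then show ?thesis using kernel_square_sum[OF finR] by linarith
    qed
    finally have "(real z0 + real (card R) - 2 - 3 * real (card S')) * ?Q \<le> (\<mu> + 1 + q) * ?Q"
      using upper by (simp add: algebra_simps)
    then have le: "(n - 4 * real (card S') - 3 - q - \<mu>) * ?Q \<le> 0"
      by (simp add: cR n_def algebra_simps)
    have "n - 4 * real (card S') - 3 - q - \<mu> > 0"
    proof -
      have "real (card S') \<le> real m" using cS' by simp
      moreover have "2 * (4 * real m + 3 + q) < n" by (rule n1)
      ultimately show ?thesis using \<mu>n by argo
    qed
    then have "?Q = 0" using le Q0 by (simp add: mult_le_0_iff)
    then have "\<forall>z\<in>R. z\<^sup>2 = 0" using finR by (simp add: sum_nonneg_eq_0_iff)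
    then have "R = {}" using Z0 RZ by auto
    then have "S' = Z" by (simp add: S'_def)
    then show ?thesis using cS' by simp
  qed
  then show ?thesis by blast
qed

section \<open>Poles of half-plane maps\<close>

text \<open>
  The leading term of \<open>X / Y\<close> at \<open>s0\<close> in the direction \<open>w\<close>. If \<open>s0\<close> is real, then \<open>w\<close> has to point into the upper
  half-plane; otherwise all directions are admissible, which leaves no possibility for a pole.
\<close>

lemma im_pair_local:
  fixes X Y :: "complex poly"
  assumes neg: "\<And>s. Im s > 0 \<Longrightarrow> im_pair X Y s \<le> 0"
    and X: "X = [:-s0, 1:] ^ k * N" and Y: "Y = [:-s0, 1:] ^ r * G"
    and dir: "\<delta> > 0" "\<And>e::real. 0 < e \<Longrightarrow> e \<le> \<delta> \<Longrightarrow> Im (s0 + of_real e * w) > 0"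
  shows "Im (w ^ k * cnj w ^ r * (poly N s0 * cnj (poly G s0))) \<le> 0"
proof -
  define e where "e n = \<delta> / real (Suc n)" for n
  define s where "s n = s0 + of_real (e n) * w" for n
  have e: "0 < e n" "e n \<le> \<delta>" for n using dir(1) by (auto simp: e_def field_simps)
  have "(\<lambda>n. \<delta> * inverse (real (Suc n))) \<longlonglongrightarrow> \<delta> * 0"
    by (intro tendsto_mult tendsto_const LIMSEQ_inverse_real_of_nat)
  then have "e \<longlonglongrightarrow> 0" by (simp add: e_def[abs_def] divide_inverse)
  then have "(\<lambda>n. s0 + of_real (e n) * w) \<longlonglongrightarrow> s0 + of_real 0 * w"
    by (intro tendsto_intros)
  then have s: "s \<longlonglongrightarrow> s0" by (simp add: s_def[abs_def])
  have le: "Im (w ^ k * cnj w ^ r * (poly N (s n) * cnj (poly G (s n)))) \<le> 0" for n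
  proof -
    have sn: "s n - s0 = of_real (e n) * w" by (simp add: s_def)
    have "poly X (s n) * cnj (poly Y (s n)) =
      (of_real (e n) * w) ^ k * poly N (s n) * (cnj (of_real (e n) * w) ^ r * cnj (poly G (s n)))"
      unfolding X Y sn[symmetric] by simp
    also have "\<dots> = of_real (e n ^ (k + r)) * (w ^ k * cnj w ^ r * (poly N (s n) * cnj (poly G (s n))))"
      by (simp add: power_mult_distrib power_add mult_ac)
    finally have "im_pair X Y (s n) = e n ^ (k + r) * Im (w ^ k * cnj w ^ r * (poly N (s n) * cnj (poly G (s n))))"
      unfolding im_pair_def by (simp only: Im_complex_of_real Re_complex_of_real times_complex.sel(2) mult_zero_left add_0_right)
    then have "e n ^ (k + r) * Im (w ^ k * cnj w ^ r * (poly N (s n) * cnj (poly G (s n)))) \<le> 0"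
      using neg[of "s n"] dir(2)[of "e n"] e[of n] by (simp add: s_def)
    moreover have "e n ^ (k + r) > 0" using e[of n] by simp
    ultimately show ?thesis by (simp only: mult_le_0_iff) auto
  qed
  have lim: "(\<lambda>n. Im (w ^ k * cnj w ^ r * (poly N (s n) * cnj (poly G (s n))))) \<longlonglongrightarrow>
     Im (w ^ k * cnj w ^ r * (poly N s0 * cnj (poly G s0)))"
    by (intro tendsto_intros isCont_tendsto_compose[OF _ s]) simp_all
  show ?thesis by (rule LIMSEQ_le_const2[OF lim]) (use le in blast)
qed

lemma pderiv_linear_power_mult:
  fixes G :: "'a::field_char_0 poly"
  shows "pderiv ([:-z, 1:] ^ Suc n * G) = [:-z, 1:] ^ n * (smult (of_nat (Suc n)) G + [:-z, 1:] * pderiv G)"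
proof -
  have "pderiv ([:-z, 1:] ^ Suc n * G) = [:-z, 1:] ^ Suc n * pderiv G + pderiv ([:-z, 1:] ^ Suc n) * G"
    by (subst pderiv_mult) (simp add: mult.commute)
  also have "pderiv ([:-z, 1::'a:] ^ Suc n) = smult (of_nat (Suc n)) ([:-z, 1:] ^ n)"
    by (subst pderiv_power_Suc) (simp add: pderiv_pCons)
  finally show ?thesis by (simp add: algebra_simps del: mult_pCons_left mult_pCons_right)
qed

context laguerre_multiplier
begin

text \<open>
  At a zero \<open>z\<close> of multiplicity at least two the term \<open>-s P''\<close> of the derivative produces a double
  pole, and a double pole takes values in both half-planes unless its coefficient, a multiple of \<open>z\<close>, is zero.
\<close>

lemma value_at_0_nonzero_roots_simple:
  assumes neg: "\<And>s. Im s > 0 \<Longrightarrow> im_pair (cpoly (deriv_at_0 M)) (cpoly (value_at_0 M)) s \<le> 0"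
    and P: "value_at_0 M = [:-z, 1:] ^ r * G" "poly G z \<noteq> 0" "z \<noteq> 0"
  shows "r \<le> 1"
proof (rule ccontr)
  assume "\<not> r \<le> 1"
  then obtain k where r: "r = Suc (Suc k)" by (metis One_nat_def not_less_eq_eq Suc_le_D le_SucI not0_implies_Suc le0)
  let ?L = "[:-z, 1:]"
  define H1 where "H1 = smult (real (Suc (Suc k))) G + ?L * pderiv G"
  define H2 where "H2 = smult (real (Suc k)) H1 + ?L * pderiv H1"
  have d1: "pderiv (value_at_0 M) = ?L ^ Suc k * H1"
    unfolding P r pderiv_linear_power_mult H1_def ..
  have d2: "pderiv (pderiv (value_at_0 M)) = ?L ^ k * H2"
    unfolding d1 pderiv_linear_power_mult H2_def ..
  define N where "N = smult (- real M) (?L * (?L * G)) + [:real M, 1:] * (?L * H1) - pCons 0 H2"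
  have "pCons 0 (?L ^ k * H2) = ?L ^ k * pCons 0 H2" by simp
  moreover have PM: "value_at_0 M = ?L ^ k * (?L * (?L * G))" by (simp only: P(1) r power_Suc mult_ac)
  ultimately have "deriv_at_0 M = ?L ^ k * N"
    unfolding deriv_at_0_eq unfolding d2 unfolding d1 unfolding PM N_def by (simp add: algebra_simps del: mult_pCons_left mult_pCons_right)
  then have X: "cpoly (deriv_at_0 M) = [:- of_real z, 1:] ^ k * cpoly N"
    by (simp add: cpoly_mult cpoly_power cpoly_pCons)
  have Y: "cpoly (value_at_0 M) = [:- of_real z, 1:] ^ r * cpoly G"
    by (simp only: P cpoly_mult cpoly_power cpoly_pCons) simp
  have Nz: "poly N z = - (z * (real (Suc k) * real (Suc (Suc k)))) * poly G z"
    by (simp add: N_def H2_def H1_def)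
  define t where "t = real (Suc k) * real (Suc (Suc k)) * (poly G z)\<^sup>2"
  have t: "t > 0" using P(2) by (simp add: t_def)
  have main: "Im (w ^ k * cnj w ^ r * of_real (- (z * t))) \<le> 0" if w: "Im w > 0" for w
  proof -
    have "Im (w ^ k * cnj w ^ r * (poly (cpoly N) (of_real z) * cnj (poly (cpoly G) (of_real z)))) \<le> 0"
      by (rule im_pair_local[OF neg X Y, of 1]) (use w in auto)
    moreover have "poly (cpoly N) (of_real z) * cnj (poly (cpoly G) (of_real z)) = of_real (- (z * t))"
      unfolding poly_cpoly_of_real complex_cnj_complex_of_real of_real_mult[symmetric] Nz t_def
      by (simp add: power2_eq_square mult_ac del: of_nat_Suc)
    ultimately show ?thesis by simp
  qed
  have "w ^ k * cnj w ^ r = of_real ((cmod w)\<^sup>2) ^ k * (cnj w)\<^sup>2" for w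
    unfolding r complex_norm_square by (simp add: power_mult_distrib power2_eq_square mult_ac)
  then have main': "Im (of_real ((cmod w)\<^sup>2) ^ k * (cnj w)\<^sup>2 * of_real (- (z * t))) \<le> 0" if "Im w > 0" for w
    using main[OF that] by simp
  \<comment> \<open>Two directions whose squares point to opposite sides.\<close>
  have "(cnj (Complex 1 1))\<^sup>2 = Complex 0 (-2)" "(cnj (Complex (-1) 1))\<^sup>2 = Complex 0 2"
    by (simp_all add: power2_eq_square complex_eq_iff)
  then have "z * t * (2 * 2 ^ k) \<le> 0" "- (z * t * (2 * 2 ^ k)) \<le> 0"
    using main'[of "Complex 1 1"] main'[of "Complex (-1) 1"]
    by (simp_all add: cmod_power2 flip: of_real_power)
  then have "z * t * (2 * 2 ^ k) = 0" by linarith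
  then show False using P(3) t by simp
qed

text \<open>At a simple zero the residue has to be non-negative.\<close>

lemma value_at_0_simple_root_ineq:
  assumes neg: "\<And>s. Im s > 0 \<Longrightarrow> im_pair (cpoly (deriv_at_0 M)) (cpoly (value_at_0 M)) s \<le> 0"
    and P: "value_at_0 M = [:-z, 1:] * G" "poly G z \<noteq> 0"
  shows "2 * z * (poly (pderiv G) z / poly G z) \<le> real M + z"
proof -
  have d1: "pderiv (value_at_0 M) = G + [:-z, 1:] * pderiv G"
    using pderiv_linear_power_mult[of z 0 G] P by simp
  have d2: "pderiv (pderiv (value_at_0 M)) = pderiv G + (pderiv G + [:-z, 1:] * pderiv (pderiv G))"
    using pderiv_linear_power_mult[of z 0 "pderiv G"] unfolding d1 pderiv_add by simp
  have "poly (deriv_at_0 M) z = (real M + z) * poly G z - z * (2 * poly (pderiv G) z)"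
    unfolding deriv_at_0_eq unfolding d2 unfolding d1 unfolding P by (simp add: algebra_simps)
  moreover have "poly (deriv_at_0 M) z * poly G z \<ge> 0"
  proof -
    have X: "cpoly (deriv_at_0 M) = [:- of_real z, 1:] ^ 0 * cpoly (deriv_at_0 M)" by simp
    have Y: "cpoly (value_at_0 M) = [:- of_real z, 1:] ^ 1 * cpoly G"
      by (simp only: P cpoly_mult cpoly_pCons power_one_right) simp
    have "Im (\<i> ^ 0 * cnj \<i> ^ 1 * (poly (cpoly (deriv_at_0 M)) (of_real z) * cnj (poly (cpoly G) (of_real z)))) \<le> 0"
      by (rule im_pair_local[OF neg X Y, of 1]) auto
    then show ?thesis by (simp add: poly_cpoly_of_real)
  qed
  ultimately have "((real M + z) * poly G z - z * (2 * poly (pderiv G) z)) * poly G z \<ge> 0" by simp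
  then have "((real M + z) * poly G z - z * (2 * poly (pderiv G) z)) * poly G z / (poly G z)\<^sup>2 \<ge> 0" by simp
  also have "((real M + z) * poly G z - z * (2 * poly (pderiv G) z)) * poly G z / (poly G z)\<^sup>2
     = real M + z - 2 * z * (poly (pderiv G) z / poly G z)"
    using P(2) by (simp add: power2_eq_square field_simps)
  finally show ?thesis by simp
qed

end

section \<open>Exclusion of alternating signs\<close>

text \<open>The inequality of Cauchy and Schwarz for multisets.\<close>

lemma sum_mset_cauchy: "(\<Sum>x\<in>#B. x)\<^sup>2 \<le> real (size B) * (\<Sum>x\<in>#B. (x::real)\<^sup>2)"
proof (induction B)
  case (add x B)
  let ?S = "\<Sum>x\<in>#B. x" and ?Q = "\<Sum>x\<in>#B. x\<^sup>2" and ?n = "real (size B)"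
  have "2 * x * ?S \<le> ?n * x\<^sup>2 + ?Q"
  proof (cases "B = {#}")
    case False
    then have n: "?n > 0" by (simp add: nonempty_has_size)
    have "0 \<le> (?n * x - ?S)\<^sup>2 + (?n * ?Q - ?S\<^sup>2)" using add.IH by simp
    also have "\<dots> = ?n * (?n * x\<^sup>2 + ?Q - 2 * x * ?S)" by (simp add: power2_eq_square algebra_simps)
    finally have "?n * x\<^sup>2 + ?Q - 2 * x * ?S \<ge> 0" using n by (metis zero_le_mult_iff not_less)
    then show ?thesis by simp
  qed simp
  then show ?case using add.IH by (simp add: power2_eq_square algebra_simps)
qed simp

lemma real_rooted_newton_sharp:
  assumes "only_real_zeros p" "degree p = Suc (Suc i)"
  shows "2 * (real i + 2) * lead_coeff p * coeff p i \<le> (real i + 1) * (coeff p (Suc i))\<^sup>2"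
proof -
  obtain B where B: "size B = Suc (Suc i)"
    "(lead_coeff p)\<^sup>2 * (\<Sum>x\<in>#B. x\<^sup>2) = (coeff p (Suc i))\<^sup>2 - 2 * lead_coeff p * coeff p i"
    "coeff p (Suc i) = - lead_coeff p * (\<Sum>x\<in>#B. x)"
    using real_rooted_top_coeffs[OF assms] by metis
  have "(coeff p (Suc i))\<^sup>2 = (lead_coeff p)\<^sup>2 * (\<Sum>x\<in>#B. x)\<^sup>2" by (simp add: B(3) power_mult_distrib)
  also have "\<dots> \<le> (lead_coeff p)\<^sup>2 * (real (size B) * (\<Sum>x\<in>#B. x\<^sup>2))"
    by (intro mult_left_mono sum_mset_cauchy) simp
  also have "\<dots> = (real i + 2) * ((coeff p (Suc i))\<^sup>2 - 2 * lead_coeff p * coeff p i)"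
    unfolding B(2)[symmetric] by (simp add: B(1) algebra_simps)
  finally show ?thesis by (simp add: algebra_simps)
qed

lemma only_real_zeros_reflect_poly:
  assumes "only_real_zeros p"
  shows "only_real_zeros (reflect_poly p)"
proof (cases "p = 0")
  case False
  have r: "cpoly (reflect_poly p) = reflect_poly (cpoly p)"
    by (rule poly_eqI) (simp add: coeff_map_poly coeff_reflect_poly degree_cpoly)
  have "z \<in> \<real>" if z: "poly (cpoly (reflect_poly p)) z = 0" for z
  proof (cases "z = 0")
    case False
    then have "poly (cpoly p) (inverse z) = 0"
      using z unfolding r by (simp add: poly_reflect_poly_nz)
    then have "inverse z \<in> \<real>" using assms \<open>p \<noteq> 0\<close> by (auto simp: only_real_zeros_def)
    then show ?thesis using Reals_inverse by fastforce
  qed simp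
  then show ?thesis by (simp add: only_real_zeros_def)
qed (simp add: only_real_zeros_def)

context laguerre_multiplier
begin

lemma monom_const_low:
  assumes "\<And>k. k < q \<Longrightarrow> \<gamma> k = 0"
  shows "k < q \<Longrightarrow> monom_const k = 0" "monom_const q = fact q * (-1) ^ q * \<gamma> q"
proof -
  have ueq: "monom_const k = fact k * (\<Sum>j\<le>k. (-1) ^ j * real (k choose j) * \<gamma> j)" for k
    by (simp add: monom_const_def monom_image_eq coeff_sum coeff_laguerre_poly)
  show "monom_const k = 0" if "k < q" using that assms by (simp add: ueq)
  have "(\<Sum>j\<le>q. (-1) ^ j * real (q choose j) * \<gamma> j) = (\<Sum>j\<in>{q}. (-1) ^ j * real (q choose j) * \<gamma> j)"
    by (rule sum.mono_neutral_right) (use assms in auto)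
  then show "monom_const q = fact q * (-1) ^ q * \<gamma> q" by (simp add: ueq)
qed

text \<open>
  The first \<open>q\<close> forward differences vanish together with \<open>\<gamma> 0, \<dots>, \<gamma> (q - 1)\<close>, so the degree drops from \<open>M\<close>
  to \<open>M - q\<close>.
\<close>

lemma degree_value_at_0:
  assumes "\<And>k. k < q \<Longrightarrow> \<gamma> k = 0" "\<gamma> q \<noteq> 0" "q \<le> M"
  shows "degree (value_at_0 M) = M - q" "lead_coeff (value_at_0 M) = real (M choose q) * monom_const q"
proof -
  have "coeff (value_at_0 M) (M - q) = real (M choose q) * monom_const q"
    using assms(3) binomial_symmetric[of q M] by (simp add: coeff_value_at_0)
  moreover have "\<dots> \<noteq> 0" using monom_const_low(2)[OF assms(1)] assms by simp
  ultimately have ge: "M - q \<le> degree (value_at_0 M)" by (intro le_degree) simp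
  have "degree (value_at_0 M) \<le> M - q"
  proof (rule degree_le, intro allI impI)
    fix i assume "i > M - q"
    then have "M < i \<or> M - i < q" using assms(3) by linarith
    then show "coeff (value_at_0 M) i = 0" using monom_const_low(1)[OF assms(1)] by (auto simp: coeff_value_at_0 binomial_eq_0)
  qed
  with ge show d: "degree (value_at_0 M) = M - q" by simp
  show "lead_coeff (value_at_0 M) = real (M choose q) * monom_const q" unfolding d by fact
qed

text \<open>
  Alternating signs of \<open>\<gamma>\<close> make the values at \<open>0\<close> of the images of the monomials non-zero and of equal sign from
  \<open>q\<close> on; \<open>v\<close> denotes their moduli. Newton's inequalities say that \<open>v (k + 1) / v k\<close> does not
  increase, whereas the reversed orientation at \<open>s = 0\<close> makes this ratio at least of the order of \<open>k\<close>.
\<close>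

lemma negative_orientation_impossible:
  assumes low: "\<And>k. k < q \<Longrightarrow> \<gamma> k = 0" and high: "\<And>k. k \<ge> q \<Longrightarrow> \<gamma> k * \<gamma> (Suc k) < 0"
  shows False
proof -
  have nz: "\<gamma> k \<noteq> 0" if "k \<ge> q" for k using high[OF that] by auto
  have orient: "- im_pair (cpoly (deriv_at_0 M)) (cpoly (value_at_0 M)) s \<le> 0" if "M > q" "Im s > 0" for M s
    using im_pair_deriv_value[of M "-1" s] that high[of "M - 1"] by simp
  have rr: "only_real_zeros (value_at_0 M)" if "M > q" for M
    using only_real_zeros_value_at_0[of M "-1"] that high[of "M - 1"] by simp
  define \<sigma> where "\<sigma> = sgn ((-1) ^ q * \<gamma> q)"
  have sig: "\<sigma> * ((-1) ^ k * \<gamma> k) > 0" if "k \<ge> q" for k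
    using that
  proof (induction k rule: dec_induct)
    case base
    have "(-1) ^ q * \<gamma> q \<noteq> 0" using nz by simp
    then show ?case unfolding \<sigma>_def by (metis abs_sgn mult.commute zero_less_abs_iff)
  next
    case (step k)
    have "(\<sigma> * ((-1) ^ k * \<gamma> k)) * (\<sigma> * ((-1) ^ Suc k * \<gamma> (Suc k))) = \<sigma>\<^sup>2 * (((-1) ^ k)\<^sup>2 * (- (\<gamma> k * \<gamma> (Suc k))))"
      by (simp add: power2_eq_square mult_ac)
    also have "\<dots> > 0"
      using step.IH high[OF step.hyps(1)] by (intro mult_pos_pos) (auto simp: zero_less_power2)
    finally show ?case using step.IH zero_less_mult_pos by blast
  qed
  define v where "v k = \<sigma> * monom_const k" for k
  have v: "v k > 0" if "k \<ge> q" for k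
  proof -
    have "v k = fact k * (\<Sum>j\<le>k. real (k choose j) * (\<sigma> * ((-1) ^ j * \<gamma> j)))"
      by (simp add: v_def monom_const_def monom_image_eq coeff_sum coeff_laguerre_poly sum_distrib_left mult_ac)
    moreover have "(\<Sum>j\<le>k. real (k choose j) * (\<sigma> * ((-1) ^ j * \<gamma> j))) > 0"
    proof (rule sum_pos2[of _ q])
      show "0 < real (k choose q) * (\<sigma> * ((-1) ^ q * \<gamma> q))" using sig[of q] that by simp
      show "0 \<le> real (k choose j) * (\<sigma> * ((-1) ^ j * \<gamma> j))" for j
        using sig[of j] low[of j] by (cases "j < q") auto
    qed (use that in auto)
    ultimately show ?thesis by simp
  qed
  have sq: "\<sigma> * \<sigma> = 1" using v[of q] by (auto simp: v_def \<sigma>_def sgn_if split: if_splits)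
  have vv: "v i * v j = monom_const i * monom_const j" for i j
  proof -
    have "v i * v j = (\<sigma> * \<sigma>) * (monom_const i * monom_const j)" by (simp add: v_def mult_ac)
    then show ?thesis by (simp only: sq mult_1)
  qed
  have newton: "v (m + 2) * v m \<le> (v (m + 1))\<^sup>2" if "m \<ge> q" for m
  proof -
    let ?M = "m + 2" and ?p = "reflect_poly (value_at_0 (m + 2))"
    have c0: "coeff (value_at_0 ?M) 0 = monom_const ?M" by (simp add: coeff_value_at_0)
    then have P0: "coeff (value_at_0 ?M) 0 \<noteq> 0" using v[of ?M] that by (auto simp: v_def)
    define i where "i = m - q"
    have i: "?M - q = Suc (Suc i)" "i \<le> m" using that by (simp_all add: i_def)
    have dP: "degree (value_at_0 ?M) = Suc (Suc i)" using degree_value_at_0(1)[of q ?M] low nz that i by simp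
    have deg: "degree ?p = Suc (Suc i)" using P0 dP by simp
    have lc: "lead_coeff ?p = monom_const ?M" using P0 c0 dP deg by (simp add: coeff_reflect_poly)
    have c1: "coeff ?p (Suc i) = (real m + 2) * monom_const (m + 1)"
      using dP by (simp add: coeff_reflect_poly coeff_value_at_0)
    have c2: "coeff ?p i = (real m + 2) * (real m + 1) / 2 * monom_const m"
    proof -
      have "real (?M choose 2) = (real m + 2) * (real m + 1) / 2"
      proof -
        have "?M choose 2 = (m + 2) * (m + 1) div 2" by (simp add: choose_two)
        moreover have "even ((m + 2) * (m + 1))" by simp
        ultimately have "2 * (?M choose 2) = (m + 2) * (m + 1)" by simp
        then have "real (2 * (?M choose 2)) = real ((m + 2) * (m + 1))" by (rule arg_cong)
        then show ?thesis by (simp add: algebra_simps)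
      qed
      then show ?thesis using dP by (simp add: coeff_reflect_poly coeff_value_at_0 Suc_diff_le numeral_2_eq_2 del: binomial_Suc_Suc)
    qed
    have "only_real_zeros ?p" using rr[of ?M] that by (intro only_real_zeros_reflect_poly) simp
    note sharp = real_rooted_newton_sharp[OF this deg]
    have e1: "2 * (real i + 2) * monom_const ?M * ((real m + 2) * (real m + 1) / 2 * monom_const m)
        = (real i + 2) * (real m + 2) * ((real m + 1) * (monom_const ?M * monom_const m))" by simp
    have e2: "(real i + 1) * ((real m + 2) * monom_const (m + 1))\<^sup>2 = (real i + 1) * (real m + 2) * ((real m + 2) * (monom_const (m + 1))\<^sup>2)"
      by (simp add: power2_eq_square)
    have N: "(real i + 2) * (real m + 2) * ((real m + 1) * (monom_const ?M * monom_const m)) \<le> (real i + 1) * (real m + 2) * ((real m + 2) * (monom_const (m + 1))\<^sup>2)"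
      using sharp unfolding lc c1 c2 e1 e2 .
    then have "(real m + 2) * ((real i + 2) * (real m + 1) * (monom_const ?M * monom_const m)) \<le> (real m + 2) * ((real i + 1) * (real m + 2) * (monom_const (m + 1))\<^sup>2)"
      by (simp only: mult_ac)
    then have "(real i + 2) * (real m + 1) * (monom_const ?M * monom_const m) \<le> (real i + 1) * (real m + 2) * (monom_const (m + 1))\<^sup>2"
      by (rule mult_left_le_imp_le) simp
    also have "\<dots> \<le> (real i + 2) * (real m + 1) * (monom_const (m + 1))\<^sup>2"
      using i(2) by (intro mult_right_mono) (simp_all add: algebra_simps)
    finally have "monom_const ?M * monom_const m \<le> (monom_const (m + 1))\<^sup>2" by (rule mult_left_le_imp_le) simp
    then show ?thesis using vv[of "m + 1" "m + 1"] by (simp add: vv power2_eq_square)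
  qed
  have wron: "(real m + 2)\<^sup>2 * (v (m + 1))\<^sup>2 \<le> v (m + 2) * v (m + 1) + (real m + 1)\<^sup>2 * (v (m + 2) * v m)" if m: "m \<ge> q" for m
  proof -
    let ?M = "m + 2"
    define p0 where "p0 = monom_const ?M"
    define r0 where "r0 = coeff (deriv_at_0 ?M) 0"
    \<comment> \<open>Subtracting a real multiple of the value does not change the sign of the imaginary part but makes
      the numerator vanish at \<open>0\<close>, so that its derivative at \<open>0\<close> becomes visible.\<close>
    define X where "X = smult (p0 * r0) (value_at_0 ?M) - smult (p0 * p0) (deriv_at_0 ?M)"
    have p0: "p0 = coeff (value_at_0 ?M) 0" "p0 \<noteq> 0" using v[of ?M] m by (auto simp: v_def p0_def coeff_value_at_0)
    have "coeff X 0 = 0" by (simp add: X_def p0(1) r0_def)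
    then obtain N where N: "X = pCons 0 N" by (metis coeff_pCons_0 pCons_cases)
    have im: "im_pair (cpoly X) (cpoly (value_at_0 ?M)) s \<le> 0" if "Im s > 0" for s
    proof -
      have "poly (cpoly X) s * cnj (poly (cpoly (value_at_0 ?M)) s) =
         of_real (p0 * r0 * (cmod (poly (cpoly (value_at_0 ?M)) s))\<^sup>2) - of_real (p0 * p0) * (poly (cpoly (deriv_at_0 ?M)) s * cnj (poly (cpoly (value_at_0 ?M)) s))"
        unfolding of_real_mult complex_norm_square X_def
        by (simp add: cpoly_add cpoly_minus cpoly_smult diff_conv_add_uminus algebra_simps del: add_uminus_conv_diff)
      then have "im_pair (cpoly X) (cpoly (value_at_0 ?M)) s = p0 * p0 * (- im_pair (cpoly (deriv_at_0 ?M)) (cpoly (value_at_0 ?M)) s)"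
      proof -
        have "Im (of_real a * z) = a * Im z" for a z by simp
        then show "?thesis" if "poly (cpoly X) s * cnj (poly (cpoly (value_at_0 ?M)) s) =
         of_real (p0 * r0 * (cmod (poly (cpoly (value_at_0 ?M)) s))\<^sup>2) - of_real (p0 * p0) * (poly (cpoly (deriv_at_0 ?M)) s * cnj (poly (cpoly (value_at_0 ?M)) s))"
          unfolding im_pair_def that by (simp only: minus_complex.sel Im_complex_of_real mult_minus_right diff_0)
      qed
      also have "\<dots> \<le> 0" using orient[of ?M s] that m by (intro mult_nonneg_nonpos) auto
      finally show ?thesis .
    qed
    have "Im (\<i> ^ 1 * cnj \<i> ^ 0 * (poly (cpoly N) 0 * cnj (poly (cpoly (value_at_0 ?M)) 0))) \<le> 0"
      by (rule im_pair_local[OF im, of _ 1 _ 0 _ 1]) (auto simp: N cpoly_pCons)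
    moreover have "poly (cpoly N) 0 = of_real (coeff X 1)" "poly (cpoly (value_at_0 ?M)) 0 = of_real p0"
      by (simp_all add: N poly_0_coeff_0 coeff_map_poly p0(1))
    ultimately have "coeff X 1 * p0 \<le> 0" by simp
    moreover have "coeff X 1 = p0 * (r0 * coeff (value_at_0 ?M) 1 - p0 * coeff (deriv_at_0 ?M) 1)" by (simp add: X_def algebra_simps)
    ultimately have "(p0 * p0) * (r0 * coeff (value_at_0 ?M) 1 - p0 * coeff (deriv_at_0 ?M) 1) \<le> 0" by (simp add: mult_ac)
    moreover have "p0 * p0 > 0" using p0(2) by (auto simp: zero_less_mult_iff)
    ultimately have "r0 * coeff (value_at_0 ?M) 1 - p0 * coeff (deriv_at_0 ?M) 1 \<le> 0" by (metis mult_pos_pos not_le)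
    then have le: "r0 * coeff (value_at_0 ?M) 1 \<le> p0 * coeff (deriv_at_0 ?M) 1" by simp
    have er: "r0 = - (real m + 2) * monom_const ?M + (real m + 2)\<^sup>2 * monom_const (m + 1)"
      by (simp add: r0_def coeff_deriv_at_0 coeff_monom_image_1[unfolded One_nat_def] algebra_simps power2_eq_square)
    have eP: "coeff (value_at_0 ?M) 1 = (real m + 2) * monom_const (m + 1)" by (simp add: coeff_value_at_0)
    have eR: "coeff (deriv_at_0 ?M) 1 = (real m + 2) * (- (real m + 1) * monom_const (m + 1) + (real m + 1)\<^sup>2 * monom_const m)"
      by (simp add: coeff_deriv_at_0 coeff_monom_image_1[unfolded One_nat_def] algebra_simps power2_eq_square)
    have "(real m + 2) * ((real m + 2)\<^sup>2 * (monom_const (m + 1) * monom_const (m + 1))) \<le> (real m + 2) * (monom_const ?M * monom_const (m + 1) + (real m + 1)\<^sup>2 * (monom_const ?M * monom_const m))"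
      using le unfolding er eP eR p0_def by (simp add: algebra_simps power2_eq_square)
    then have "(real m + 2)\<^sup>2 * (monom_const (m + 1) * monom_const (m + 1)) \<le> monom_const ?M * monom_const (m + 1) + (real m + 1)\<^sup>2 * (monom_const ?M * monom_const m)"
      by (rule mult_left_le_imp_le) simp
    then show ?thesis by (simp only: vv power2_eq_square)
  qed
  have grow: "(2 * real m + 3) * v (m + 1) \<le> v (m + 2)" if m: "m \<ge> q" for m
  proof -
    have "(real m + 1)\<^sup>2 * (v (m + 2) * v m) \<le> (real m + 1)\<^sup>2 * (v (m + 1))\<^sup>2"
      by (intro mult_left_mono newton m) simp
    then have "((2 * real m + 3) * v (m + 1)) * v (m + 1) \<le> v (m + 2) * v (m + 1)"
      using wron[OF m] by (simp add: power2_eq_square algebra_simps)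
    then show ?thesis using v[of "m + 1"] m by simp
  qed
  have ratio: "v (Suc k) * v q \<le> v (Suc q) * v k" if "k \<ge> q" for k
    using that
  proof (induction k rule: dec_induct)
    case (step k)
    have "(v (Suc (Suc k)) * v q) * v k \<le> v q * (v (Suc k))\<^sup>2"
      using newton[OF step.hyps(1)] v[of q] by (simp add: mult.commute mult.left_commute)
    also have "\<dots> = (v (Suc k) * v q) * v (Suc k)" by (simp add: power2_eq_square)
    also have "\<dots> \<le> (v (Suc q) * v k) * v (Suc k)"
      using step.IH v[of "Suc k"] step.hyps by (intro mult_right_mono) auto
    finally have "(v (Suc (Suc k)) * v q) * v k \<le> (v (Suc q) * v (Suc k)) * v k" by (simp add: mult_ac)
    then show ?case using v[of k] step.hyps by simp
  qed simp
  obtain m :: nat where m: "real m \<ge> v (Suc q) / v q" "m \<ge> q"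
  proof -
    obtain a :: nat where "v (Suc q) / v q \<le> real a" using real_arch_simple by blast
    then show ?thesis using that[of "max a q"] by simp
  qed
  have "((2 * real m + 3) * v (m + 1)) * v q \<le> v (m + 2) * v q"
    using grow[OF m(2)] v[of q] by (intro mult_right_mono) auto
  also have "\<dots> \<le> v (Suc q) * v (m + 1)" using ratio[of "m + 1"] m(2) by simp
  finally have "((2 * real m + 3) * v q) * v (m + 1) \<le> v (Suc q) * v (m + 1)" by (simp add: mult_ac)
  then have "(2 * real m + 3) * v q \<le> v (Suc q)" using v[of "m + 1"] m(2) by simp
  also have "\<dots> \<le> real m * v q" using m(1) v[of q] by (simp add: field_simps)
  finally have "(real m + 3) * v q \<le> 0" by (simp add: algebra_simps)
  then show False using v[of q] by (simp add: mult_le_0_iff)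
qed

end

section \<open>Vanishing of high forward differences\<close>

context laguerre_multiplier
begin

text \<open>
  The inequality at a zero \<open>z\<close> is the condition on the residue there, rewritten with
  \<open>P'' / P' = 2 (\<Sum>w. 1 / (z - w))\<close> at \<open>z\<close>, the sum being over the other zeros, and with
  \<open>2 z / (z - w) = 1 + kernel z w\<close>.
\<close>

lemma value_at_0_factor:
  assumes low: "\<And>k. k < q \<Longrightarrow> \<gamma> k = 0" and nz: "\<gamma> q \<noteq> 0" and M: "q + 2 \<le> M"
    and rr: "only_real_zeros (value_at_0 M)"
    and neg: "\<And>s. Im s > 0 \<Longrightarrow> im_pair (cpoly (deriv_at_0 M)) (cpoly (value_at_0 M)) s \<le> 0"
  obtains Z and z0 :: nat where "finite Z" "0 \<notin> Z" "z0 + card Z = M - q"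
    "value_at_0 M = smult (lead_coeff (value_at_0 M)) (monom 1 z0 * (\<Prod>z\<in>Z. [:-z, 1:]))"
    "(lead_coeff (value_at_0 M))\<^sup>2 * (\<Sum>z\<in>Z. z\<^sup>2) = (coeff (value_at_0 M) (M - q - 1))\<^sup>2 - 2 * lead_coeff (value_at_0 M) * coeff (value_at_0 M) (M - q - 2)"
    "\<And>z. z \<in> Z \<Longrightarrow> real z0 + (\<Sum>w\<in>Z. kernel z w) \<le> z + 1 + real q"
proof -
  define i where "i = M - q - 2"
  have i: "M - q = Suc (Suc i)" using M by (simp add: i_def)
  have deg: "degree (value_at_0 M) = Suc (Suc i)" using degree_value_at_0(1)[OF low nz, of M] M i by simp
  obtain B where B: "value_at_0 M = smult (lead_coeff (value_at_0 M)) (\<Prod>x\<in>#B. [:-x, 1:])" "size B = Suc (Suc i)"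
    "(lead_coeff (value_at_0 M))\<^sup>2 * (\<Sum>x\<in>#B. x\<^sup>2) = (coeff (value_at_0 M) (Suc i))\<^sup>2 - 2 * lead_coeff (value_at_0 M) * coeff (value_at_0 M) i"
    using real_rooted_top_coeffs[OF rr deg] by metis
  define c where "c = lead_coeff (value_at_0 M)"
  have P0: "value_at_0 M \<noteq> 0" using deg by auto
  then have c0: "c \<noteq> 0" by (simp add: c_def)
  define Z where "Z = set_mset B - {0}"
  define z0 where "z0 = count B 0"
  have simple: "count B z = 1" if z: "z \<in> Z" for z
  proof (rule ccontr)
    assume "count B z \<noteq> 1"
    moreover have "count B z > 0" "z \<noteq> 0" using z by (auto simp: Z_def)
    ultimately have "count B z \<ge> 2" by linarith
    then have "replicate_mset 2 z \<subseteq># B" by (simp add: count_le_replicate_mset_subset_eq[symmetric])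
    then obtain C where "B = add_mset z (add_mset z C)"
      by (metis mset_subset_eq_exists_conv numeral_2_eq_2 replicate_mset_Suc replicate_mset_0 union_mset_add_mset_left add_0)
    then have "value_at_0 M = [:-z, 1:] ^ 2 * smult c (\<Prod>x\<in>#C. [:-x, 1:])"
      by (subst B(1)[folded c_def]) (simp add: power2_eq_square mult_ac del: mult_pCons_left mult_pCons_right)
    then have "[:-z, 1:] ^ 2 dvd value_at_0 M" by (rule dvdI)
    then have "2 \<le> order z (value_at_0 M)" using P0 by (simp add: order_divides)
    moreover obtain G where "value_at_0 M = [:-z, 1:] ^ order z (value_at_0 M) * G" "\<not> [:-z, 1:] dvd G"
      using order_decomp[OF P0] by blast
    then have "order z (value_at_0 M) \<le> 1"
      using value_at_0_nonzero_roots_simple[OF neg] \<open>z \<noteq> 0\<close> by (simp add: poly_eq_0_iff_dvd)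
    ultimately show False by simp
  qed
  have finZ: "finite Z" and Z0: "0 \<notin> Z" by (auto simp: Z_def)
  have BZ: "B = replicate_mset z0 0 + mset_set Z"
  proof (rule multiset_eqI)
    fix x
    show "count B x = count (replicate_mset z0 0 + mset_set Z) x"
    proof (cases "x = 0 \<or> x \<in> Z")
      case True
      then show ?thesis using simple Z0 finZ by (auto simp: z0_def)
    next
      case False
      then have "x \<notin># B" by (auto simp: Z_def)
      then show ?thesis using False by (auto simp: count_eq_zero_iff)
    qed
  qed
  have card: "z0 + card Z = M - q" using B(2) i by (simp add: BZ)
  have fact1: "value_at_0 M = smult (lead_coeff (value_at_0 M)) (monom 1 z0 * (\<Prod>z\<in>Z. [:-z, 1:]))"
  proof -
    have "(\<Prod>x\<in>#B. [:-x, 1:]) = monom 1 z0 * (\<Prod>z\<in>Z. [:-z, 1:])"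
      by (simp add: BZ prod_unfold_prod_mset monom_altdef)
    then show ?thesis using B(1) by simp
  qed
  have sq: "(\<Sum>x\<in>#B. x\<^sup>2) = (\<Sum>z\<in>Z. z\<^sup>2)"
    by (simp add: BZ sum_unfold_sum_mset)
  have ineq: "real z0 + (\<Sum>w\<in>Z. kernel z w) \<le> z + 1 + real q" if z: "z \<in> Z" for z
  proof -
    have z': "z \<noteq> 0" using z Z0 by auto
    define C where "C = replicate_mset z0 0 + mset_set (Z - {z})"
    have BC: "B = add_mset z C"
      using z finZ by (simp add: BZ C_def mset_set.remove)
    have zC: "z \<notin># C" using z' finZ by (auto simp: C_def)
    define G where "G = smult c (\<Prod>x\<in>#C. [:-x, 1:])"
    have PG: "value_at_0 M = [:-z, 1:] * G"
      by (subst B(1)[folded c_def]) (simp add: BC G_def del: mult_pCons_left mult_pCons_right)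
    have Gz: "poly G z \<noteq> 0"
      using zC c0 by (auto simp: G_def poly_prod_mset image_mset.compositionality o_def prod_mset_zero_iff)
    have dG: "poly (pderiv G) z = poly G z * (\<Sum>x\<in>#C. inverse (z - x))"
      by (simp add: G_def pderiv_smult poly_pderiv_prod_mset[OF zC])
    have "2 * z * (\<Sum>x\<in>#C. inverse (z - x)) \<le> real M + z"
      using value_at_0_simple_root_ineq[OF neg PG Gz] Gz by (simp add: dG)
    also have "(\<Sum>x\<in>#C. inverse (z - x)) = real z0 * inverse z + (\<Sum>w\<in>Z - {z}. inverse (z - w))"
      by (simp add: C_def sum_unfold_sum_mset)
    also have "2 * z * (real z0 * inverse z + (\<Sum>w\<in>Z - {z}. inverse (z - w)))
        = 2 * real z0 + (\<Sum>w\<in>Z - {z}. 2 * z * inverse (z - w))"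
      using z' by (simp add: distrib_left sum_distrib_left)
    also have "(\<Sum>w\<in>Z - {z}. 2 * z * inverse (z - w)) = (\<Sum>w\<in>Z - {z}. 1 + kernel z w)"
      by (intro sum.cong refl) (simp add: kernel_def field_simps)
    also have "\<dots> = real (card (Z - {z})) + (\<Sum>w\<in>Z - {z}. kernel z w)" by (simp add: sum.distrib)
    also have "(\<Sum>w\<in>Z - {z}. kernel z w) = (\<Sum>w\<in>Z. kernel z w)"
      using z finZ by (simp add: sum.remove[of Z z] kernel_def)
    also have "real (card (Z - {z})) = real (card Z) - 1"
    proof -
      have "card Z > 0" using z finZ by (auto simp: card_gt_0_iff)
      then show ?thesis using z finZ by (simp add: of_nat_diff)
    qed
    finally have "2 * real z0 + (real (card Z) - 1 + (\<Sum>w\<in>Z. kernel z w)) \<le> real M + z" .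
    moreover have "real M = real q + real z0 + real (card Z)"
      using card M by linarith
    ultimately show ?thesis by linarith
  qed
  have ix: "M - q - 1 = Suc i" "M - q - 2 = i" using i by simp_all
  show thesis
    by (rule that[OF finZ Z0 card fact1 _ ineq]) (use B(3) in \<open>simp only: sq ix\<close>)
qed

text \<open>
  The number of non-zero zeros is bounded independently of \<open>M\<close>, so only a bounded number of leading
  coefficients can be different from zero; these coefficients belong to the smallest indices \<open>k\<close>. The second
  moment grows at most like \<open>(M - q)\<^sup>2\<close> because it is determined by the three leading coefficients.
\<close>

lemma monom_const_eventually_zero:
  assumes low: "\<And>k. k < q \<Longrightarrow> \<gamma> k = 0" and high: "\<And>k. k \<ge> q \<Longrightarrow> \<gamma> k * \<gamma> (Suc k) > 0"
  obtains K where "\<And>k. k > K \<Longrightarrow> monom_const k = 0"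
proof -
  have nz: "\<gamma> q \<noteq> 0" using high[of q] by auto
  have uq: "monom_const q \<noteq> 0" using monom_const_low(2)[OF low] nz by simp
  have neg: "im_pair (cpoly (deriv_at_0 M)) (cpoly (value_at_0 M)) s \<le> 0" if "M > q" "Im s > 0" for M s
    using im_pair_deriv_value[of M 1 s] that high[of "M - 1"] by simp
  have rr: "only_real_zeros (value_at_0 M)" if "M > q" for M
    using only_real_zeros_value_at_0[of M 1] that high[of "M - 1"] by simp
  define C where "C = 1 + ((monom_const (q + 1))\<^sup>2 + 2 * \<bar>monom_const q * monom_const (q + 2)\<bar>) / (monom_const q)\<^sup>2"
  have C1: "C \<ge> 1" by (simp add: C_def)
  obtain m n0 :: nat where few: "\<forall>Z (z0::nat). finite Z \<and> 0 \<notin> Z \<and> n0 \<le> z0 + card Z \<and>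
     (\<Sum>z\<in>Z. z\<^sup>2) \<le> C * (real (z0 + card Z))\<^sup>2 \<and>
     (\<forall>z\<in>Z. real z0 + (\<Sum>w\<in>Z. kernel z w) \<le> z + 1 + real q) \<longrightarrow> card Z \<le> m"
    using few_nonzero_zeros[OF C1 of_nat_0_le_iff[of q]] by blast
  have "monom_const k = 0" if k: "k > q + m" for k
  proof -
    \<comment> \<open>Any \<open>M\<close> that is large enough for the bound and for \<open>k\<close> to occur.\<close>
    define M where "M = k + n0 + q + 2"
    have Mq: "M > q" "q + 2 \<le> M" by (auto simp: M_def)
    obtain Z and z0 :: nat where Z: "finite Z" "0 \<notin> Z" "z0 + card Z = M - q"
      "value_at_0 M = smult (lead_coeff (value_at_0 M)) (monom 1 z0 * (\<Prod>z\<in>Z. [:-z, 1:]))"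
      "(lead_coeff (value_at_0 M))\<^sup>2 * (\<Sum>z\<in>Z. z\<^sup>2) = (coeff (value_at_0 M) (M - q - 1))\<^sup>2 - 2 * lead_coeff (value_at_0 M) * coeff (value_at_0 M) (M - q - 2)"
      "\<And>z. z \<in> Z \<Longrightarrow> real z0 + (\<Sum>w\<in>Z. kernel z w) \<le> z + 1 + real q"
      using value_at_0_factor[OF low nz Mq(2) rr[OF Mq(1)] neg[OF Mq(1)]] by blast
    define n where "n = real (M - q)"
    define b where "b = real (M choose q)"
    have b: "b > 0" using Mq by (simp add: b_def)
    have n0: "n \<ge> 0" by (simp add: n_def)
    have b1: "real (M choose (q + 1)) \<le> n * b"
    proof -
      have "real (M choose Suc q) \<le> real (Suc q) * real (M choose Suc q)" by (simp add: algebra_simps)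
      also have "\<dots> = (real M - real q) * real (M choose q)" by (rule binomial_absorb_Suc)
      finally show ?thesis using Mq by (simp add: n_def b_def of_nat_diff)
    qed
    have b2: "real (M choose (q + 2)) \<le> n\<^sup>2 * b"
    proof -
      have "real (M choose Suc (Suc q)) \<le> real (Suc (Suc q)) * real (M choose Suc (Suc q))" by (simp add: algebra_simps)
      also have "\<dots> = (real M - real (Suc q)) * real (M choose Suc q)" by (rule binomial_absorb_Suc)
      also have "\<dots> \<le> n * (n * b)" using b1 b n0 Mq by (intro mult_mono) (auto simp: n_def of_nat_diff)
      finally show ?thesis by (simp add: power2_eq_square mult.assoc)
    qed
    have lc: "lead_coeff (value_at_0 M) = b * monom_const q" using degree_value_at_0(2)[OF low nz] Mq by (simp add: b_def)
    have c1: "coeff (value_at_0 M) (M - q - 1) = real (M choose (q + 1)) * monom_const (q + 1)"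
      using Mq binomial_symmetric[of "q + 1" M] by (simp add: coeff_value_at_0)
    have c2: "coeff (value_at_0 M) (M - q - 2) = real (M choose (q + 2)) * monom_const (q + 2)"
      using Mq binomial_symmetric[of "q + 2" M] by (simp add: coeff_value_at_0)
    have "(\<Sum>z\<in>Z. z\<^sup>2) \<le> C * n\<^sup>2"
    proof -
      have "(b * monom_const q)\<^sup>2 * (\<Sum>z\<in>Z. z\<^sup>2) = (real (M choose (q + 1)) * monom_const (q + 1))\<^sup>2 - 2 * (b * monom_const q) * (real (M choose (q + 2)) * monom_const (q + 2))"
        using Z(5) unfolding lc c1 c2 .
      also have "\<dots> \<le> (n * b * monom_const (q + 1))\<^sup>2 + 2 * b * (n\<^sup>2 * b) * \<bar>monom_const q * monom_const (q + 2)\<bar>"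
      proof -
        have "(real (M choose (q + 1)) * monom_const (q + 1))\<^sup>2 \<le> (n * b * monom_const (q + 1))\<^sup>2"
          unfolding power_mult_distrib[of _ "monom_const (q + 1)"] using b1 by (intro mult_right_mono power_mono) auto
        moreover have "- (2 * (b * monom_const q) * (real (M choose (q + 2)) * monom_const (q + 2))) = 2 * b * real (M choose (q + 2)) * (- (monom_const q * monom_const (q + 2)))"
          by simp
        moreover have "2 * b * real (M choose (q + 2)) * (- (monom_const q * monom_const (q + 2))) \<le> 2 * b * real (M choose (q + 2)) * \<bar>monom_const q * monom_const (q + 2)\<bar>"
          using b by (intro mult_left_mono) auto
        moreover have "2 * b * real (M choose (q + 2)) * \<bar>monom_const q * monom_const (q + 2)\<bar> \<le> 2 * b * (n\<^sup>2 * b) * \<bar>monom_const q * monom_const (q + 2)\<bar>"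
          using b b2 by (intro mult_right_mono mult_left_mono) auto
        ultimately show ?thesis by linarith
      qed
      also have "\<dots> = (b * monom_const q)\<^sup>2 * ((C - 1) * n\<^sup>2)"
        using uq by (simp add: C_def power2_eq_square field_simps)
      finally have "(\<Sum>z\<in>Z. z\<^sup>2) \<le> (C - 1) * n\<^sup>2" using b uq by simp
      also have "\<dots> \<le> C * n\<^sup>2" by (intro mult_right_mono) auto
      finally show ?thesis .
    qed
    moreover have "n = real (z0 + card Z)" using Z(3) by (simp add: n_def)
    moreover have "n0 \<le> z0 + card Z" using Z(3) by (simp add: M_def)
    ultimately have "card Z \<le> m" using few Z(1,2,6) by blast
    then have "M - k < z0" using Z(3) k by (simp add: M_def)
    then have "coeff (value_at_0 M) (M - k) = 0" by (subst Z(4)) (simp add: coeff_monom_mult)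
    moreover have "k \<le> M" by (simp add: M_def)
    ultimately show ?thesis by (auto simp: coeff_value_at_0 binomial_eq_0_iff)
  qed
  then show thesis using that by blast
qed

end

section \<open>The limit and the location of the zeros\<close>

lemma binomial_ratio_tendsto_1: "(\<lambda>M. real (M choose k) * fact k / real M ^ k) \<longlonglongrightarrow> 1"
proof (induction k)
  case (Suc k)
  have "(\<lambda>M. real (M choose k) * fact k / real M ^ k * (1 - real k * inverse (real M))) \<longlonglongrightarrow> 1 * (1 - real k * 0)"
    by (rule tendsto_mult[OF Suc tendsto_diff[OF tendsto_const tendsto_mult[OF tendsto_const lim_inverse_n]]])
  moreover have "real (M choose Suc k) * fact (Suc k) / real M ^ Suc k =
     real (M choose k) * fact k / real M ^ k * (1 - real k * inverse (real M))" if "M > k" for M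
  proof -
    note e = binomial_absorb_Suc[of k M]
    have "real (M choose Suc k) * fact (Suc k) = (real (Suc k) * real (M choose Suc k)) * fact k"
      by (simp only: fact_Suc of_nat_mult mult_ac)
    then show ?thesis unfolding e using that by (simp add: field_simps)
  qed
  then have "eventually (\<lambda>M. real (M choose k) * fact k / real M ^ k * (1 - real k * inverse (real M)) =
     real (M choose Suc k) * fact (Suc k) / real M ^ Suc k) sequentially"
    by (intro eventually_mono[OF eventually_gt_at_top[of k]]) (rule sym)
  ultimately show ?case by (simp only: mult_1 mult_zero_right diff_zero) (rule Lim_transform_eventually)
qed simp

text \<open>
  At a zero \<open>y\<close> of \<open>A\<close> the quotient of the two polynomials has a simple pole whose residue is a positive multiple of
  \<open>y (1 + y)\<close>. If \<open>y\<close> is not real, this number has to vanish, which is absurd; if \<open>y\<close> is real, it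
  has to be \<open>\<le> 0\<close>.
\<close>

lemma unit_interval_zeros_of_im_pair:
  assumes A: "A \<noteq> 0"
    and pos: "\<And>y. Im y > 0 \<Longrightarrow> im_pair (cpoly (pCons 0 (A + [:1, 1:] * pderiv A))) (cpoly A) y \<ge> 0"
  shows "unit_interval_zeros A"
proof -
  have key: "Im (cnj w * (y * (1 + y))) \<ge> 0"
    if zero: "poly (cpoly A) y = 0" and w: "cmod w = 1" and dir: "(Im y > 0) \<or> (Im y = 0 \<and> Im w > 0)" for y w
  proof -
    let ?L = "[:-y, 1:]"
    have A0: "cpoly A \<noteq> 0" using A by (simp add: cpoly_eq_0_iff)
    obtain G where G: "cpoly A = ?L ^ order y (cpoly A) * G" "\<not> ?L dvd G"
      using order_decomp[OF A0] by blast
    have Gy: "poly G y \<noteq> 0" using G(2) by (simp add: poly_eq_0_iff_dvd)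
    have "order y (cpoly A) \<noteq> 0" using zero A0 by (simp add: order_root)
    then obtain k where k: "order y (cpoly A) = Suc k" by (cases "order y (cpoly A)") auto
    define H where "H = smult (of_nat (Suc k)) G + ?L * pderiv G"
    have A1: "cpoly A = ?L ^ Suc k * G" using G(1) k by simp
    have A2: "cpoly A = ?L ^ k * (?L * G)" unfolding A1 by (simp only: power_Suc mult_ac)
    have dA: "pderiv (cpoly A) = ?L ^ k * H" unfolding A1 pderiv_linear_power_mult H_def ..
    define N where "N = - pCons 0 (?L * G + [:1, 1:] * H)"
    have "pCons 0 (?L ^ k * X) = ?L ^ k * pCons 0 X" for X :: "complex poly" by simp
    moreover have "?L ^ k * (?L * G) + [:1, 1:] * (?L ^ k * H) = ?L ^ k * (?L * G + [:1, 1:] * H)"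
      by (simp only: distrib_left mult.left_commute)
    moreover have "cpoly (pCons 0 (A + [:1, 1:] * pderiv A)) = pCons 0 (cpoly A + [:1, 1:] * pderiv (cpoly A))"
      by (simp only: cpoly_pCons cpoly_add cpoly_mult cpoly_pderiv map_poly_0 of_real_0 of_real_1)
    moreover have "pCons 0 (cpoly A + [:1, 1:] * pderiv (cpoly A)) = pCons 0 (?L ^ k * (?L * G) + [:1, 1:] * (?L ^ k * H))"
      unfolding dA unfolding A2 ..
    ultimately have X: "- cpoly (pCons 0 (A + [:1, 1:] * pderiv A)) = ?L ^ k * N"
      unfolding N_def by (simp only: mult_minus_right)
    have neg: "im_pair (- cpoly (pCons 0 (A + [:1, 1:] * pderiv A))) (cpoly A) s \<le> 0" if "Im s > 0" for s
      using pos[OF that] by (simp add: im_pair_def)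
    define \<delta> where "\<delta> = (if Im y > 0 then Im y / 2 else 1)"
    have d: "\<delta> > 0" by (auto simp: \<delta>_def)
    have dir': "Im (y + of_real e * w) > 0" if "0 < e" "e \<le> \<delta>" for e :: real
    proof (cases "Im y > 0")
      case True
      have "\<bar>Im w\<bar> \<le> 1" using abs_Im_le_cmod[of w] w by simp
      then have "e * \<bar>Im w\<bar> \<le> e * 1" using that by (intro mult_left_mono) auto
      then have "- e \<le> e * Im w" using that by (simp add: abs_le_iff abs_mult_pos' flip: abs_mult)
      then show ?thesis using that True by (simp add: \<delta>_def)
    next
      case False
      then show ?thesis using that dir by simp
    qed
    have "Im (w ^ k * cnj w ^ Suc k * (poly N y * cnj (poly G y))) \<le> 0"
      by (rule im_pair_local[OF neg X A1 d dir'])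
    moreover have "w ^ k * cnj w ^ Suc k = cnj w"
    proof -
      have "w * cnj w = 1" using complex_norm_square[of w] w by simp
      then have "(w * cnj w) ^ k = 1" by simp
      then have "w ^ k * cnj w ^ k = 1" by (simp add: power_mult_distrib)
      then show ?thesis by (simp add: mult.commute mult.left_commute)
    qed
    moreover have "poly N y = - (of_nat (Suc k) * (y * (1 + y)) * poly G y)"
      by (simp add: N_def H_def algebra_simps)
    ultimately have "Im (cnj w * (- (of_nat (Suc k) * (y * (1 + y)) * poly G y) * cnj (poly G y))) \<le> 0" by (simp only:)
    also have "cnj w * (- (of_nat (Suc k) * (y * (1 + y)) * poly G y) * cnj (poly G y)) =
       of_real (- (real (Suc k) * (cmod (poly G y))\<^sup>2)) * (cnj w * (y * (1 + y)))"
      unfolding of_real_minus of_real_mult complex_norm_square by (simp add: mult_ac)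
    finally have "- (real (Suc k) * (cmod (poly G y))\<^sup>2) * Im (cnj w * (y * (1 + y))) \<le> 0"
      by (simp only: times_complex.sel Re_complex_of_real Im_complex_of_real mult_zero_left add_0_right)
    moreover have "real (Suc k) * (cmod (poly G y))\<^sup>2 > 0" using Gy by simp
    ultimately show ?thesis by (simp only: mult_minus_left neg_le_0_iff_le zero_le_mult_iff) linarith
  qed
  have no_upper: "\<not> Im y > 0" if zero: "poly (cpoly A) y = 0" for y
  proof
    assume y: "Im y > 0"
    have "Im (cnj w * (y * (1 + y))) \<ge> 0" if "cmod w = 1" for w
      using key[OF zero that] y by blast
    \<comment> \<open>The four directions bound the real and the imaginary part from both sides.\<close>
    from this[of 1] this[of "-1"] this[of "\<i>"] this[of "-\<i>"]
    have "Im (y * (1 + y)) = 0" "Re (y * (1 + y)) = 0" by simp_all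
    then have "y * (1 + y) = 0" by (rule complex_eqI[of _ 0, simplified, rotated])
    then have "y = 0 \<or> y = -1" by (auto simp: add_eq_0_iff)
    then show False using y by auto
  qed
  show ?thesis
    unfolding unit_interval_zeros_def
  proof (intro allI impI)
    fix y assume zero: "poly (cpoly A) y = 0"
    then have "poly (cpoly A) (cnj y) = 0" by (simp add: poly_cpoly_cnj)
    then have "Im y = 0" using no_upper[OF zero] no_upper[of "cnj y"] by simp
    then obtain t where t: "y = of_real t" by (metis complex_is_Real_iff Reals_cases)
    have "Im (cnj \<i> * (y * (1 + y))) \<ge> 0" using key[OF zero, of \<i>] \<open>Im y = 0\<close> by simp
    then have "t * (1 + t) \<le> 0" by (simp add: t)
    then have "- t \<in> {0..1}" by (auto simp: mult_le_0_iff)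
    then show "\<exists>\<theta>\<in>{0..1}. y = - of_real \<theta>" using t by (intro bexI[of _ "-t"]) auto
  qed
qed

context laguerre_multiplier
begin

text \<open>The substitution \<open>s = -M / y\<close>, after which the coefficients converge as \<open>M\<close> tends to infinity.\<close>

lemma rescaled_sum:
  fixes c :: "nat \<Rightarrow> real" and y :: complex
  assumes "\<And>k. k > K \<Longrightarrow> c k = 0" "K \<le> M" "y \<noteq> 0" "M > 0"
  shows "(\<Sum>i\<le>M. of_real (real (M choose i) * ((-1) ^ (M - i) * fact (M - i) * c (M - i))) * (- of_nat M / y) ^ i)
    = (- of_nat M / y) ^ M * (\<Sum>k\<le>K. of_real (real (M choose k) * fact k / real M ^ k * c k) * y ^ k)"
proof -
  let ?s = "- of_nat M / y :: complex"
  have "(\<Sum>i\<le>M. of_real (real (M choose i) * ((-1) ^ (M - i) * fact (M - i) * c (M - i))) * ?s ^ i)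
    = (\<Sum>k\<le>M. of_real (real (M choose k) * ((-1) ^ k * fact k * c k)) * ?s ^ (M - k))"
    by (rule sum.reindex_bij_witness[of _ "\<lambda>i. M - i" "\<lambda>i. M - i"]) (auto simp: binomial_symmetric[symmetric])
  also have "\<dots> = (\<Sum>k\<le>K. of_real (real (M choose k) * ((-1) ^ k * fact k * c k)) * ?s ^ (M - k))"
    by (rule sum.mono_neutral_right) (use assms in auto)
  also have "\<dots> = (\<Sum>k\<le>K. ?s ^ M * (of_real (real (M choose k) * fact k / real M ^ k * c k) * y ^ k))"
  proof (rule sum.cong[OF refl])
    fix k assume "k \<in> {..K}"
    then have k: "k \<le> M" using assms(2) by simp
    have "(-1) ^ k * ?s ^ (M - k) = ?s ^ M * (y ^ k / of_nat M ^ k)"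
    proof -
      have e1: "?s ^ M = ?s ^ (M - k) * ?s ^ k" using k by (simp flip: power_add)
      have e2: "?s ^ k * (y ^ k / of_nat M ^ k) = (-1) ^ k"
      proof -
        have "?s ^ k * (y ^ k / of_nat M ^ k) = (?s * (y / of_nat M)) ^ k" by (simp only: power_mult_distrib power_divide)
        also have "?s * (y / of_nat M) = -1" using assms by simp
        finally show ?thesis .
      qed
      show ?thesis unfolding e1 mult.assoc e2 by (rule mult.commute)
    qed
    then have "(of_nat (M choose k) * fact k * of_real (c k)) * ((-1) ^ k * ?s ^ (M - k)) =
       (of_nat (M choose k) * fact k * of_real (c k)) * (?s ^ M * (y ^ k / of_nat M ^ k))" by simp
    then show "of_real (real (M choose k) * ((-1) ^ k * fact k * c k)) * ?s ^ (M - k) =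
      ?s ^ M * (of_real (real (M choose k) * fact k / real M ^ k * c k) * y ^ k)"
      by (simp add: mult_ac)
  qed
  finally show ?thesis by (simp add: sum_distrib_left)
qed

text \<open>
  In the limit \<open>M \<rightarrow> \<infinity>\<close> with \<open>s = -M / y\<close>, the value at \<open>0\<close> becomes \<open>A(y)\<close> and the derivative at \<open>0\<close>
  becomes \<open>-(y A(y) + y (1 + y) A'(y))\<close>, up to a common factor. So the half-plane
  inequality survives for \<open>A\<close>.
\<close>

theorem forward_diff_unit_interval:
  assumes low: "\<And>k. k < q \<Longrightarrow> \<gamma> k = 0" and high: "\<And>k. k \<ge> q \<Longrightarrow> \<gamma> k * \<gamma> (Suc k) > 0"
  obtains A where "unit_interval_zeros A" "\<And>k. coeff A k = forward_diff \<gamma> k"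
proof -
  obtain K where K: "\<And>k. k > K \<Longrightarrow> monom_const k = 0" using monom_const_eventually_zero[OF low high] by blast
  define a where "a k = forward_diff \<gamma> k" for k
  have ua: "monom_const k = (-1) ^ k * fact k * a k" for k by (simp add: monom_const_forward_diff a_def)
  have aK: "a k = 0" if "k > K" for k using K[OF that] by (simp add: ua)
  define A where "A = (\<Sum>k\<le>K. monom (a k) k)"
  have cA: "coeff A k = a k" for k
    using aK[of k] by (cases "k \<le> K") (auto simp: A_def coeff_sum)
  have nz: "\<gamma> q \<noteq> 0" using high[of q] by auto
  have "monom_const q \<noteq> 0" using monom_const_low(2)[OF low] nz by simp
  then have "a q \<noteq> 0" by (simp add: ua)
  then have A0: "A \<noteq> 0" using cA[of q] by auto
  let ?r = "pCons 0 (A + [:1, 1:] * pderiv A)"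
  define c where "c k = coeff ?r k" for k
  have cU: "coeff (monom_image k) 1 = (-1) ^ k * fact k * (- c k)" for k
  proof (cases k)
    case 0
    then show ?thesis using coeff_monom_image_eq_0[of 0 1] by (simp add: c_def)
  next
    case (Suc l)
    have "coeff (pCons 0 (pderiv A)) l = real l * a l" by (cases l) (auto simp: coeff_pderiv cA)
    then have c: "c k = a l + (real (Suc l) * a (Suc l) + real l * a l)"
      by (simp add: c_def Suc coeff_pderiv cA del: of_nat_Suc)
    show ?thesis
      unfolding coeff_monom_image_1 ua c by (simp add: Suc power2_eq_square algebra_simps)
  qed
  have cK: "c k = 0" if "k > Suc K" for k
  proof -
    have "coeff (pCons 0 (pderiv A)) (k - 1) = real (k - 1) * a (k - 1)"
      using that by (cases "k - 1") (auto simp: coeff_pderiv cA)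
    then show ?thesis using that aK[of k] aK[of "k - 1"]
      by (cases k) (auto simp: c_def coeff_pderiv cA)
  qed
  have lim: "(\<lambda>M. \<Sum>k\<le>K'. of_real (real (M choose k) * fact k / real M ^ k * f k) * y ^ k) \<longlonglongrightarrow> (\<Sum>k\<le>K'. of_real (f k) * y ^ k)"
    for K' and f :: "nat \<Rightarrow> real" and y :: complex
  proof -
    have "(\<lambda>M. \<Sum>k\<le>K'. of_real (real (M choose k) * fact k / real M ^ k * f k) * y ^ k) \<longlonglongrightarrow> (\<Sum>k\<le>K'. of_real (1 * f k) * y ^ k)"
      by (intro tendsto_sum tendsto_mult tendsto_const tendsto_of_real binomial_ratio_tendsto_1)
    then show ?thesis by simp
  qed
  have "im_pair (cpoly ?r) (cpoly A) y \<ge> 0" if y: "Im y > 0" for y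
  proof -
    have y0: "y \<noteq> 0" using y by auto
    define p where "p M = (\<Sum>k\<le>K. of_real (real (M choose k) * fact k / real M ^ k * a k) * y ^ k)" for M
    define r where "r M = (\<Sum>k\<le>Suc K. of_real (real (M choose k) * fact k / real M ^ k * - c k) * y ^ k)" for M
    have "Im (r M * cnj (p M)) \<le> 0" if M: "M > q + K + 1" for M
    proof -
      let ?s = "- of_nat M / y"
      have M': "M > q" "M > 0" "K \<le> M" "Suc K \<le> M" using M by auto
      have s: "Im ?s > 0"
      proof -
        have "Im ?s = real M * Im y / (cmod y)\<^sup>2" by (simp add: Im_divide cmod_power2)
        then show ?thesis using y y0 M' by simp
      qed
      have "poly (cpoly (value_at_0 M)) ?s = ?s ^ M * p M"
        using rescaled_sum[of K a M y] aK M' y0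
        by (simp add: value_at_0_def cpoly_sum cpoly_monom poly_sum poly_monom p_def ua)
      moreover have "poly (cpoly (deriv_at_0 M)) ?s = ?s ^ M * r M"
        using rescaled_sum[of "Suc K" "\<lambda>k. - c k" M y] cK M' y0
        by (simp add: deriv_at_0_def cpoly_sum cpoly_monom poly_sum poly_monom r_def cU[unfolded One_nat_def] del: sum.atMost_Suc)
      ultimately have "poly (cpoly (deriv_at_0 M)) ?s * cnj (poly (cpoly (value_at_0 M)) ?s) = (?s ^ M * cnj (?s ^ M)) * (r M * cnj (p M))"
        by (simp only: complex_cnj_mult mult_ac)
      then have "im_pair (cpoly (deriv_at_0 M)) (cpoly (value_at_0 M)) ?s = (cmod (?s ^ M))\<^sup>2 * Im (r M * cnj (p M))"
        unfolding im_pair_def by (simp only: Im_cmod_mult)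
      moreover have "im_pair (cpoly (deriv_at_0 M)) (cpoly (value_at_0 M)) ?s \<le> 0"
        using im_pair_deriv_value[of M 1 ?s] high[of "M - 1"] M' s by simp
      moreover have "(cmod (?s ^ M))\<^sup>2 > 0" using y0 M' by simp
      ultimately show ?thesis by (metis mult_pos_pos not_le)
    qed
    then have ev: "\<exists>N. \<forall>M\<ge>N. Im (r M * cnj (p M)) \<le> 0" by (intro exI[of _ "q + K + 2"]) auto
    have "(\<lambda>M. Im (r M * cnj (p M))) \<longlonglongrightarrow> Im ((\<Sum>k\<le>Suc K. of_real (- c k) * y ^ k) * cnj (\<Sum>k\<le>K. of_real (a k) * y ^ k))"
      unfolding r_def p_def by (intro tendsto_Im tendsto_mult tendsto_cnj lim)
    then have "Im ((\<Sum>k\<le>Suc K. of_real (- c k) * y ^ k) * cnj (\<Sum>k\<le>K. of_real (a k) * y ^ k)) \<le> 0"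
      using ev by (rule LIMSEQ_le_const2)
    moreover have "(\<Sum>k\<le>K. of_real (a k) * y ^ k) = poly (cpoly A) y"
      by (simp add: A_def cpoly_sum cpoly_monom poly_sum poly_monom)
    moreover have "(\<Sum>k\<le>Suc K. of_real (- c k) * y ^ k) = - poly (cpoly ?r) y"
    proof -
      have "?r = (\<Sum>k\<le>Suc K. monom (c k) k)"
      proof (rule poly_eqI)
        fix n
        have "coeff (\<Sum>k\<le>Suc K. monom (c k) k) n = c n"
          using cK[of n] by (cases "n \<le> Suc K") (auto simp: coeff_sum simp del: sum.atMost_Suc)
        then show "coeff ?r n = coeff (\<Sum>k\<le>Suc K. monom (c k) k) n" by (simp only: c_def)
      qed
      then have "poly (cpoly ?r) y = (\<Sum>k\<le>Suc K. of_real (c k) * y ^ k)"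
        by (simp only: cpoly_sum cpoly_monom poly_sum poly_monom)
      then show ?thesis by (simp add: sum_negf del: sum.atMost_Suc)
    qed
    ultimately show ?thesis by (simp only: im_pair_def mult_minus_left uminus_complex.sel neg_le_0_iff_le)
  qed
  then have "unit_interval_zeros A" by (rule unit_interval_zeros_of_im_pair[OF A0])
  then show thesis using that cA by (simp add: a_def)
qed

end

section \<open>Transformed multiplier sequences\<close>

theorem theorem45:
  fixes \<gamma> :: "nat \<Rightarrow> real" and n :: nat
  assumes "laguerre_multiplier_sequence \<gamma>"
    and "\<not> trivial_sequence \<gamma>"
  shows "laguerre_multiplier_sequence
    (\<lambda>m. \<Sum>k=0..m. real (m choose k) * ((-1) ^ n / fact n *
        (\<Sum>j=0..n. real (n choose j) * falling_factorial (k + j) n *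
                    poly (reversed_jensen_poly \<gamma> (k + j)) (-1))))"
proof -
  obtain T where T: "hyperbolicity_preserving T" "\<And>n. T (laguerre_poly n) = smult (\<gamma> n) (laguerre_poly n)"
    using assms(1) unfolding laguerre_multiplier_sequence_def by blast
  interpret laguerre_multiplier T \<gamma> by unfold_locales (fact T)+
  obtain q where q: "\<And>k. k < q \<Longrightarrow> \<gamma> k = 0" "\<And>k. k \<ge> q \<Longrightarrow> \<gamma> k \<noteq> 0"
    using gamma_support[OF assms(2)] by blast
  obtain \<kappa> :: real where \<kappa>: "\<kappa> = 1 \<or> \<kappa> = -1" "\<And>k. k \<ge> q \<Longrightarrow> \<kappa> * (\<gamma> k * \<gamma> (Suc k)) > 0"
    using gamma_signs[OF q(2)] by blast
  have "\<kappa> = 1"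
  proof (rule ccontr)
    assume "\<kappa> \<noteq> 1"
    then have "\<gamma> k * \<gamma> (Suc k) < 0" if "k \<ge> q" for k using \<kappa>(1) \<kappa>(2)[OF that] by auto
    then show False using negative_orientation_impossible[OF q(1)] by blast
  qed
  then have "\<gamma> k * \<gamma> (Suc k) > 0" if "k \<ge> q" for k using \<kappa>(2)[OF that] by simp
  from forward_diff_unit_interval[OF q(1) this]
  obtain A where "unit_interval_zeros A" "\<And>k. coeff A k = forward_diff \<gamma> k" by blast
  then show ?thesis by (rule laguerre_multiplier_sequence_of_forward_diff_poly)
qed

end
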